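(* Let $q,d\in\mathbb{N}$, let $\mu$ be Lebesgue measure on $[0,1]$, and let $\Psi:=\{\psi_v:\ v\in[0,1]\}$ with $\psi_v(u):=(u-v)_+^{q-1}$, $u\in[0,1]$. Then, with respect to the $L_2(\mu)$-norm, $N(\epsilon,\Psi)\lesssim1/\epsilon$. For $\mathcal{F}:=\mathrm{absconv}(\Psi\otimes\cdots\otimes\Psi)$ ($d$ times), with the metric induced by the $L_2(\mu\times\cdots\times\mu)$-norm for functions on $[0,1]^d$, the entropy can be bounded by $$\mathcal{H}(\epsilon,\mathcal{F})\lesssim\epsilon^{-\frac1q}\,\log^{d-1}(1/\epsilon)\,\log^{\frac{1}{2q}}(1/\epsilon).$$
   Context: For $u\in\mathbb{R}$, $u_+:=\max\{u,0\}$, with the convention $u_+^0:=1$ if $u\ge0$ and $u_+^0:=0$ if $u<0$. For functions $g,h$ of $\epsilon\in(0,1]$, $h(\epsilon)\lesssim g(\epsilon)$ means $\limsup_{\epsilon\downarrow0}h(\epsilon)/g(\epsilon)<\infty$. For a subset $T$ of a metric space, $N(\epsilon,T)$ is the minimum number of balls with radius $\epsilon$ necessary to cover $T$, and $\mathcal{H}(\epsilon,T):=\log N(\epsilon,T)$. $\mathrm{absconv}(\Psi\otimes\cdots\otimes\Psi)$ is the closure (in $L_2(\mu\times\cdots\times\mu)$) of the set of all functions $$(u_1,\ldots,u_d)\mapsto\sum_{v_1\in V_1}\cdots\sum_{v_d\in V_d}\beta_{v_1,\ldots,v_d}\,\psi_{v_1}(u_1)\cdots\psi_{v_d}(u_d),$$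 where $V_1,\ldots,V_d$ are finite subsets of $[0,1]$ and the $\beta_{v_1,\ldots,v_d}\in\mathbb{R}$ satisfy $\sum|\beta_{v_1,\ldots,v_d}|\le1$.
   Formalization: The bound N(ε,Ψ) ≲ 1/ε is stated only for q ≥ 2: for q = 1 the functions are indicators of [v,1] at L2-distance |v−w|^{1/2}, so N(ε,Ψ) is of order ε^{-2} and the bound fails; the entropy bound is stated for all q, d ≥ 1. *)

theory Defs
  imports "HOL-Analysis.Analysis"
begin

(* In HOL 0 ^ 0 = 1, so the convention for the exponent 0 needs its own case. *)
definition trunc_pow :: "real \<Rightarrow> nat \<Rightarrow> real" where
  "trunc_pow u k = (if k = 0 then (if 0 \<le> u then 1 else 0) else (max u 0) ^ k)"

(* Extended-real h, so that infinite covering numbers are not silently turned into a number. *)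
definition lesssim :: "(real \<Rightarrow> ereal) \<Rightarrow> (real \<Rightarrow> real) \<Rightarrow> bool" (infix "\<lesssim>" 50) where
  "h \<lesssim> g \<longleftrightarrow> Limsup (at_right 0) (\<lambda>\<epsilon>. h \<epsilon> / ereal (g \<epsilon>)) < \<infinity>"

(* Elements of L2 are represented by functions instead of classes of almost everywhere equal
   functions; L2_dist is then a pseudometric, with the same covering numbers and closures. *)
definition L2_space :: "'a measure \<Rightarrow> ('a \<Rightarrow> real) set" where
  "L2_space M = {f \<in> borel_measurable M. integrable M (\<lambda>x. (f x)\<^sup>2)}"

definition L2_dist :: "'a measure \<Rightarrow> ('a \<Rightarrow> real) \<Rightarrow> ('a \<Rightarrow> real) \<Rightarrow> real" where
  "L2_dist M f g = sqrt (\<integral>x. (f x - g x)\<^sup>2 \<partial>M)"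

definition L2_closure :: "'a measure \<Rightarrow> ('a \<Rightarrow> real) set \<Rightarrow> ('a \<Rightarrow> real) set" where
  "L2_closure M S = {f \<in> L2_space M. \<forall>e>0. \<exists>g\<in>S. L2_dist M f g < e}"

(* Centres range over the whole space X; the infimum is \<infinity> if there is no finite cover. *)
definition covering_number :: "'a set \<Rightarrow> ('a \<Rightarrow> 'a \<Rightarrow> real) \<Rightarrow> real \<Rightarrow> 'a set \<Rightarrow> enat" where
  "covering_number X \<rho> \<epsilon> T =
     (INF C \<in> {C. finite C \<and> C \<subseteq> X \<and> T \<subseteq> (\<Union>c\<in>C. {x \<in> X. \<rho> c x < \<epsilon>})}. enat (card C))"

definition metric_entropy :: "'a set \<Rightarrow> ('a \<Rightarrow> 'a \<Rightarrow> real) \<Rightarrow> real \<Rightarrow> 'a set \<Rightarrow> ereal" where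
  "metric_entropy X \<rho> \<epsilon> T =
     (case covering_number X \<rho> \<epsilon> T of enat n \<Rightarrow> ereal (ln (real n)) | \<infinity> \<Rightarrow> \<infinity>)"

definition unit_measure :: "real measure" where
  "unit_measure = restrict_space lborel {0..1}"

(* Points of the cube [0,1]^d are functions on {..<d}. *)
definition cube_measure :: "nat \<Rightarrow> (nat \<Rightarrow> real) measure" where
  "cube_measure d = PiM {..<d} (\<lambda>_. unit_measure)"

definition psi :: "nat \<Rightarrow> real \<Rightarrow> real \<Rightarrow> real" where
  "psi q v u = trunc_pow (u - v) (q - 1)"

definition Psi :: "nat \<Rightarrow> (real \<Rightarrow> real) set" where
  "Psi q = psi q ` {0..1}"

definition tensor_combinations ::
    "(real \<Rightarrow> real \<Rightarrow> real) \<Rightarrow> nat \<Rightarrow> ((nat \<Rightarrow> real) \<Rightarrow> real) set" where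
  "tensor_combinations \<psi> d =
     {(\<lambda>u. \<Sum>v \<in> PiE {..<d} V. \<beta> v * (\<Prod>i<d. \<psi> (v i) (u i))) | V \<beta>.
        (\<forall>i<d. finite (V i) \<and> V i \<subseteq> {0..1}) \<and> (\<Sum>v \<in> PiE {..<d} V. \<bar>\<beta> v\<bar>) \<le> 1}"

definition absconv_tensor ::
    "(real \<Rightarrow> real \<Rightarrow> real) \<Rightarrow> nat \<Rightarrow> ((nat \<Rightarrow> real) \<Rightarrow> real) set" where
  "absconv_tensor \<psi> d = L2_closure (cube_measure d) (tensor_combinations \<psi> d)"

(* For q = 1 the functions are indicators of [v,1], whose L2 distance is the square root of
   the distance of the parameters. Hence N(\<epsilon>, \<Psi>) is of the exact order 1 / \<epsilon>^2, and the
   bound 1 / \<epsilon> can only be claimed for q \<ge> 2. *)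

lemma emeasure_unit_measure: "emeasure unit_measure (space unit_measure) = 1"
  by (simp add: unit_measure_def space_restrict_space emeasure_restrict_space)

lemma finite_measure_unit_measure: "finite_measure unit_measure"
  by (rule finite_measureI) (simp add: emeasure_unit_measure)

lemma psi_1: "psi (Suc 0) v u = (if v \<le> u then 1 else 0)"
  by (simp add: psi_def trunc_pow_def)

lemma measurable_psi_1: "psi 1 v \<in> borel_measurable unit_measure"
  unfolding unit_measure_def
  by (intro measurable_restrict_space1) (simp add: psi_1 [abs_def])

lemma integrable_diff_sq:
  assumes "f \<in> L2_space M" "g \<in> L2_space M"
  shows "integrable M (\<lambda>x. (f x - g x)\<^sup>2)"
proof (rule Bochner_Integration.integrable_bound)
  show "integrable M (\<lambda>x. 2 * (f x)\<^sup>2 + 2 * (g x)\<^sup>2)"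
    using assms by (auto simp: L2_space_def)
  show "(\<lambda>x. (f x - g x)\<^sup>2) \<in> borel_measurable M"
    using assms by (auto simp: L2_space_def)
  show "AE x in M. norm ((f x - g x)\<^sup>2) \<le> norm (2 * (f x)\<^sup>2 + 2 * (g x)\<^sup>2)"
  proof (rule AE_I2)
    fix x
    have "0 \<le> (f x + g x)\<^sup>2" by simp
    then have "(f x - g x)\<^sup>2 \<le> 2 * (f x)\<^sup>2 + 2 * (g x)\<^sup>2"
      by (simp add: power2_eq_square algebra_simps)
    then show "norm ((f x - g x)\<^sup>2) \<le> norm (2 * (f x)\<^sup>2 + 2 * (g x)\<^sup>2)"
      by simp
  qed
qed

lemma psi_1_L2: "psi 1 v \<in> L2_space unit_measure"
proof -
  interpret finite_measure unit_measure by (rule finite_measure_unit_measure)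
  have "integrable unit_measure (\<lambda>x. (psi 1 v x)\<^sup>2)"
  proof (rule integrable_const_bound[where B = 1])
    show "(\<lambda>x. (psi 1 v x)\<^sup>2) \<in> borel_measurable unit_measure"
      by (rule borel_measurable_power[OF measurable_psi_1])
  qed (simp add: psi_1)
  then show ?thesis
    using measurable_psi_1 by (simp add: L2_space_def)
qed

lemma integral_psi_1_diff:
  assumes "0 \<le> v" "v \<le> w" "w \<le> 1"
  shows "(\<integral>x. (psi 1 v x - psi 1 w x)\<^sup>2 \<partial>unit_measure) = w - v"
proof -
  have "(\<integral>x. (psi 1 v x - psi 1 w x)\<^sup>2 \<partial>unit_measure)
      = (\<integral>x. indicator {0..1} x *\<^sub>R (psi 1 v x - psi 1 w x)\<^sup>2 \<partial>lborel)"
    unfolding unit_measure_def by (rule integral_restrict_space) simp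
  also have "\<dots> = (\<integral>x. indicator {v..<w} x \<partial>lborel)"
    by (rule Bochner_Integration.integral_cong)
       (use assms in \<open>auto simp: psi_1 indicator_def\<close>)
  also have "\<dots> = w - v"
    using assms by simp
  finally show ?thesis .
qed

lemma psi_1_near_centre:
  assumes c: "c \<in> L2_space unit_measure"
    and v: "L2_dist unit_measure c (psi 1 v) < e"
    and w: "L2_dist unit_measure c (psi 1 w) < e"
    and vw: "0 \<le> v" "v \<le> w" "w \<le> 1"
  shows "w - v < 4 * e\<^sup>2"
proof -
  let ?I = "\<lambda>f g. \<integral>x. (f x - g x)\<^sup>2 \<partial>unit_measure"
  have less: "?I c f < e\<^sup>2" if "L2_dist unit_measure c f < e" for f
  proof -
    have "0 \<le> ?I c f" by simp
    moreover have "0 \<le> L2_dist unit_measure c f" by (simp add: L2_dist_def)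
    ultimately show ?thesis
      using that power_strict_mono[of "sqrt (?I c f)" e 2] by (simp add: L2_dist_def)
  qed
  have "w - v = ?I (psi 1 v) (psi 1 w)"
    by (rule integral_psi_1_diff[symmetric]) (use vw in auto)
  also have "\<dots> \<le> (\<integral>x. 2 * (c x - psi 1 v x)\<^sup>2 + 2 * (c x - psi 1 w x)\<^sup>2 \<partial>unit_measure)"
  proof (rule integral_mono)
    fix x
    have "0 \<le> ((c x - psi 1 v x) + (c x - psi 1 w x))\<^sup>2" by simp
    then show "(psi 1 v x - psi 1 w x)\<^sup>2 \<le> 2 * (c x - psi 1 v x)\<^sup>2 + 2 * (c x - psi 1 w x)\<^sup>2"
      by (simp add: power2_eq_square algebra_simps)
  qed (intro Bochner_Integration.integrable_add integrable_mult_right integrable_diff_sq c psi_1_L2)+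
  also have "\<dots> = 2 * ?I c (psi 1 v) + 2 * ?I c (psi 1 w)"
    using c psi_1_L2[of v] psi_1_L2[of w] by (simp add: integrable_diff_sq)
  also have "\<dots> < 4 * e\<^sup>2"
    using less[OF v] less[OF w] by simp
  finally show ?thesis .
qed

lemma covering_number_Psi_1_ge:
  assumes m: "0 < m"
  shows "enat (m\<^sup>2) \<le> covering_number (L2_space unit_measure) (L2_dist unit_measure)
           (1 / (2 * real m)) (Psi 1)"
  unfolding covering_number_def
proof (rule INF_greatest)
  let ?e = "1 / (2 * real m)" and ?X = "L2_space unit_measure" and ?\<rho> = "L2_dist unit_measure"
  fix C assume "C \<in> {C. finite C \<and> C \<subseteq> ?X \<and> Psi 1 \<subseteq> (\<Union>c\<in>C. {x \<in> ?X. ?\<rho> c x < ?e})}"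
  then have C: "finite C" "C \<subseteq> ?X" "Psi 1 \<subseteq> (\<Union>c\<in>C. {x \<in> ?X. ?\<rho> c x < ?e})"
    by auto
  let ?v = "\<lambda>k::nat. real k / real (m\<^sup>2)"
  have v01: "?v k \<in> {0..1}" if "k \<in> {..<m\<^sup>2}" for k
  proof -
    have "real k \<le> real (m\<^sup>2)" using that by (simp del: of_nat_power)
    then show ?thesis using m by (simp add: divide_le_eq)
  qed
  have "\<forall>k\<in>{..<m\<^sup>2}. \<exists>c\<in>C. ?\<rho> c (psi 1 (?v k)) < ?e"
    using C(3) v01 unfolding Psi_def by blast
  then obtain c where c: "\<And>k. k \<in> {..<m\<^sup>2} \<Longrightarrow> c k \<in> C \<and> ?\<rho> (c k) (psi 1 (?v k)) < ?e"
    by metis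
  have less: False
    if jk: "j \<in> {..<m\<^sup>2}" "k \<in> {..<m\<^sup>2}" "j < k" and eq: "c j = c k" for j k
  proof -
    have "?v k - ?v j < 4 * ?e\<^sup>2"
    proof (rule psi_1_near_centre)
      show "c k \<in> ?X" using c[OF jk(2)] C(2) by blast
      show "?\<rho> (c k) (psi 1 (?v j)) < ?e" using c[OF jk(1)] eq by simp
      show "?\<rho> (c k) (psi 1 (?v k)) < ?e" using c[OF jk(2)] by simp
      show "?v j \<le> ?v k" using jk(3) by (intro divide_right_mono) auto
    qed (use v01[OF jk(1)] v01[OF jk(2)] in auto)
    moreover have "4 * ?e\<^sup>2 = 1 / real (m\<^sup>2)"
      by (simp add: power2_eq_square)
    ultimately have "(real k - real j) / real (m\<^sup>2) < 1 / real (m\<^sup>2)"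
      by (simp add: diff_divide_distrib)
    then have "real k - real j < 1"
      using m by (simp add: divide_less_cancel)
    then show False using jk(3) by linarith
  qed
  have "inj_on c {..<m\<^sup>2}"
    by (rule inj_onI) (metis less linorder_neqE_nat)
  then have "m\<^sup>2 \<le> card C"
    using card_inj_on_le[of c "{..<m\<^sup>2}" C] c C(1) by auto
  then show "enat (m\<^sup>2) \<le> enat (card C)" by simp
qed

lemma covering_number_Psi_1_not_lesssim:
  "\<not> (\<lambda>\<epsilon>. ereal_of_enat (covering_number (L2_space unit_measure) (L2_dist unit_measure)
         \<epsilon> (Psi 1))) \<lesssim> (\<lambda>\<epsilon>. 1 / \<epsilon>)"
proof
  let ?N = "\<lambda>\<epsilon>. ereal_of_enat (covering_number (L2_space unit_measure) (L2_dist unit_measure)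
         \<epsilon> (Psi 1))"
  assume "?N \<lesssim> (\<lambda>\<epsilon>. 1 / \<epsilon>)"
  then have "Limsup (at_right 0) (\<lambda>\<epsilon>. ?N \<epsilon> / ereal (1 / \<epsilon>)) < \<infinity>"
    by (simp add: lesssim_def)
  then obtain K where "Limsup (at_right 0) (\<lambda>\<epsilon>. ?N \<epsilon> / ereal (1 / \<epsilon>)) < ereal K"
    using less_PInf_Ex_of_nat by (metis ereal_dense2)
  then have "eventually (\<lambda>\<epsilon>. ?N \<epsilon> / ereal (1 / \<epsilon>) < ereal K) (at_right 0)"
    by (rule Limsup_lessD)
  then obtain b where b: "0 < b" "\<And>\<epsilon>. 0 < \<epsilon> \<Longrightarrow> \<epsilon> < b \<Longrightarrow> ?N \<epsilon> / ereal (1 / \<epsilon>) < ereal K"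
    by (auto simp: eventually_at_right_field)
  obtain m where m: "max (1 / b) (2 * K) + 1 < real m"
    using reals_Archimedean2 by blast
  let ?e = "1 / (2 * real m)"
  have m0: "0 < m" "1 / b < real m" "2 * K < real m"
    using m b(1) by (auto intro!: Nat.gr0I simp: max_def split: if_splits)
       (smt (verit) divide_pos_pos)+
  have e: "0 < ?e" "?e < b"
    using m0 b(1) by (auto simp: field_simps)
  have "ereal (real (m\<^sup>2)) \<le> ?N ?e"
    using covering_number_Psi_1_ge[OF m0(1)]
    by (metis ereal_of_enat_le_iff ereal_of_enat_simps(1))
  then have "ereal (real (m\<^sup>2)) / ereal (1 / ?e) \<le> ?N ?e / ereal (1 / ?e)"
    using m0(1) by (intro ereal_divide_right_mono) auto
  also have "\<dots> < ereal K" by (rule b(2)[OF e])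
  finally have "real (m\<^sup>2) / (1 / ?e) < K" using m0(1) by simp
  then have "real m / 2 < K" using m0(1) by (simp add: power2_eq_square field_simps)
  then show False using m0(3) by simp
qed

end

theory Submission
  imports Defs
begin

text \<open>
  Expand the generators \<open>psi q v\<close> in an orthonormal system adapted to dyadic scales. Piecewise polynomials
  of degree less than \<open>q\<close> on dyadic intervals of length \<open>2 powr (- k)\<close> form a space of dimension about
  \<open>2 ^ k\<close>, and \<open>psi q v\<close> differs from such a function only on the interval that contains \<open>v\<close>, so that its
  squared distance from the space is at most \<open>2 powr (- k * (2 * q - 1))\<close>
  (\<open>psi_multiresolution\<close>). In the tensor product, the levels of the \<open>d\<close> factors add up. There are at most
  \<open>(l + 1) ^ (d - 1)\<close> ways to write \<open>l\<close> as a sum of \<open>d\<close> levels; so on total level \<open>l\<close> there are about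
  \<open>P * 2 ^ l\<close> basis functions, on which a generator of the tensor class has coefficients of squared norm about
  \<open>P * 2 powr (- l * (2 * q - 1))\<close>, where \<open>P = (L + 1) ^ (d - 1)\<close> and \<open>l \<le> L\<close>. The part beyond a
  level \<open>L\<close> has a squared norm of the order of level \<open>L\<close> (\<open>tensor_coefficients\<close>, \<open>tensor_residual\<close>).

  Orthogonality is essential here: the squared norms over the \<open>P\<close> blocks of one total level add up, while the
  triangle inequality would lose a further factor \<open>P\<close>.

  The absolutely convex hull is covered level by level. Maurey's lemma approximates an element of a hull of
  atoms of norm \<open>R\<close> by an average of \<open>n\<close> signed atoms up to an error of order \<open>R / sqrt n\<close>. The parameters
  \<open>v\<close> may be rounded to a grid of mesh \<open>4 powr (- q * L)\<close> (\<open>tensor_combinations_near_grid\<close>), so that the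
  choice of an atom costs entropy of order \<open>L\<close>. With \<open>n\<close> of order \<open>P * 2 ^ L / L\<close> the part beyond level \<open>L\<close> is
  approximated up to an error of order \<open>sqrt L * 2 powr (- q * L)\<close> at a cost of order \<open>P * 2 ^ L\<close>. The factor
  \<open>sqrt L\<close> is the origin of the last logarithm in the theorem. The lower levels live in small dimensions, and
  there Maurey's lemma is followed by a rounding of the coordinates, whose cost is proportional to the dimension
  and to the logarithm of the required improvement (\<open>L2_cover_abs_hull_multilevel\<close>). In total, radius
  \<open>sqrt L * 2 powr (- q * L)\<close> has entropy of order \<open>(L + 1) ^ (d - 1) * 2 ^ L\<close>
  (\<open>absconv_tensor_cover\<close>), and solving for the radius gives the claim (\<open>choose_level\<close>).
\<close>

section \<open>The semi-inner product of \<open>L\<^sub>2\<close>\<close>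

definition L2_inner :: "'a measure \<Rightarrow> ('a \<Rightarrow> real) \<Rightarrow> ('a \<Rightarrow> real) \<Rightarrow> real" where
  "L2_inner M f g = (\<integral>x. f x * g x \<partial>M)"

definition L2_norm :: "'a measure \<Rightarrow> ('a \<Rightarrow> real) \<Rightarrow> real" where
  "L2_norm M f = sqrt (L2_inner M f f)"

lemma L2_dist_norm: "L2_dist M f g = L2_norm M (\<lambda>x. f x - g x)"
  by (simp add: L2_dist_def L2_norm_def L2_inner_def power2_eq_square)

lemma L2_spaceD: "f \<in> L2_space M \<Longrightarrow> f \<in> borel_measurable M"
  by (simp add: L2_space_def)

lemma L2_inner_integrable:
  assumes "f \<in> L2_space M" "g \<in> L2_space M"
  shows "integrable M (\<lambda>x. f x * g x)"
proof (rule Bochner_Integration.integrable_bound)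
  show "integrable M (\<lambda>x. (f x)\<^sup>2 + (g x)\<^sup>2)"
    using assms by (auto simp: L2_space_def)
  show "(\<lambda>x. f x * g x) \<in> borel_measurable M"
    using assms by (auto simp: L2_space_def)
  show "AE x in M. norm (f x * g x) \<le> norm ((f x)\<^sup>2 + (g x)\<^sup>2)"
  proof (rule AE_I2)
    fix x
    have "0 \<le> (\<bar>f x\<bar> - \<bar>g x\<bar>)\<^sup>2" by simp
    then have "2 * (\<bar>f x\<bar> * \<bar>g x\<bar>) \<le> (f x)\<^sup>2 + (g x)\<^sup>2"
      by (simp add: power2_eq_square algebra_simps)
    moreover have "0 \<le> \<bar>f x\<bar> * \<bar>g x\<bar>" by simp
    ultimately have "\<bar>f x\<bar> * \<bar>g x\<bar> \<le> (f x)\<^sup>2 + (g x)\<^sup>2" by linarith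
    then show "norm (f x * g x) \<le> norm ((f x)\<^sup>2 + (g x)\<^sup>2)"
      by (simp add: abs_mult)
  qed
qed

lemma L2_space_add [intro]:
  assumes "f \<in> L2_space M" "g \<in> L2_space M"
  shows "(\<lambda>x. f x + g x) \<in> L2_space M"
proof -
  have "(\<lambda>x. (f x + g x)\<^sup>2) = (\<lambda>x. f x * f x + (2 * (f x * g x) + g x * g x))"
    by (auto simp: power2_eq_square algebra_simps)
  then show ?thesis
    using assms L2_inner_integrable[OF assms] L2_inner_integrable[OF assms(1,1)]
      L2_inner_integrable[OF assms(2,2)]
    by (auto simp: L2_space_def)
qed

lemma L2_space_scale [intro]:
  assumes "f \<in> L2_space M"
  shows "(\<lambda>x. c * f x) \<in> L2_space M"
  using assms by (auto simp: L2_space_def power_mult_distrib)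

lemma L2_space_diff [intro]:
  assumes "f \<in> L2_space M" "g \<in> L2_space M"
  shows "(\<lambda>x. f x - g x) \<in> L2_space M"
  using L2_space_add[OF assms(1) L2_space_scale[OF assms(2), of "-1"]] by simp

lemma L2_space_zero [simp, intro]: "(\<lambda>_. 0) \<in> L2_space M"
  by (simp add: L2_space_def)

lemma L2_space_lincomb [intro]:
  assumes "\<And>i. i \<in> I \<Longrightarrow> g i \<in> L2_space M"
  shows "(\<lambda>x. \<Sum>i\<in>I. c i * g i x) \<in> L2_space M"
proof (cases "finite I")
  case True
  then show ?thesis using assms by (induction I) (auto intro!: L2_space_add L2_space_scale)
qed auto

lemma L2_space_sum [intro]:
  assumes "\<And>i. i \<in> I \<Longrightarrow> g i \<in> L2_space M"
  shows "(\<lambda>x. \<Sum>i\<in>I. g i x) \<in> L2_space M"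
  using L2_space_lincomb[of I g M "\<lambda>_. 1"] assms by simp

lemma L2_inner_commute: "L2_inner M f g = L2_inner M g f"
  by (simp add: L2_inner_def mult.commute)

lemma L2_inner_nonneg [simp]: "0 \<le> L2_inner M f f"
  by (simp add: L2_inner_def)

lemma L2_inner_zero [simp]: "L2_inner M (\<lambda>_. 0) f = 0" "L2_inner M f (\<lambda>_. 0) = 0"
  by (simp_all add: L2_inner_def)

lemma L2_inner_add_left:
  assumes "f \<in> L2_space M" "g \<in> L2_space M" "h \<in> L2_space M"
  shows "L2_inner M (\<lambda>x. f x + g x) h = L2_inner M f h + L2_inner M g h"
  using assms by (simp add: L2_inner_def distrib_right L2_inner_integrable)

lemma L2_inner_diff_left:
  assumes "f \<in> L2_space M" "g \<in> L2_space M" "h \<in> L2_space M"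
  shows "L2_inner M (\<lambda>x. f x - g x) h = L2_inner M f h - L2_inner M g h"
  using assms by (simp add: L2_inner_def left_diff_distrib L2_inner_integrable)

lemma L2_inner_scale_left: "L2_inner M (\<lambda>x. c * f x) h = c * L2_inner M f h"
  by (simp add: L2_inner_def mult.assoc)

lemma L2_inner_scale_right: "L2_inner M h (\<lambda>x. c * f x) = c * L2_inner M h f"
  using L2_inner_scale_left[of M c f h] by (metis L2_inner_commute)

lemma L2_inner_lincomb_left:
  assumes "\<And>i. i \<in> I \<Longrightarrow> g i \<in> L2_space M" "h \<in> L2_space M"
  shows "L2_inner M (\<lambda>x. \<Sum>i\<in>I. c i * g i x) h = (\<Sum>i\<in>I. c i * L2_inner M (g i) h)"
proof (cases "finite I")
  case True
  then show ?thesis using assms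
  proof (induction I)
    case (insert j I)
    then have "L2_inner M (\<lambda>x. c j * g j x + (\<Sum>i\<in>I. c i * g i x)) h
        = L2_inner M (\<lambda>x. c j * g j x) h + L2_inner M (\<lambda>x. \<Sum>i\<in>I. c i * g i x) h"
      by (intro L2_inner_add_left L2_space_scale L2_space_lincomb) auto
    then show ?case using insert by (simp add: L2_inner_scale_left)
  qed simp
qed simp

lemma L2_inner_lincomb_right:
  assumes "\<And>i. i \<in> I \<Longrightarrow> g i \<in> L2_space M" "h \<in> L2_space M"
  shows "L2_inner M h (\<lambda>x. \<Sum>i\<in>I. c i * g i x) = (\<Sum>i\<in>I. c i * L2_inner M h (g i))"
  using L2_inner_lincomb_left[OF assms] unfolding L2_inner_commute[of M _ h] .

lemma L2_inner_add_self:
  assumes "f \<in> L2_space M" "g \<in> L2_space M"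
  shows "L2_inner M (\<lambda>x. f x + g x) (\<lambda>x. f x + g x)
       = L2_inner M f f + 2 * L2_inner M f g + L2_inner M g g"
proof -
  have "L2_inner M f (\<lambda>x. f x + g x) = L2_inner M f f + L2_inner M f g"
    using L2_inner_add_left[OF assms assms(1)]
    by (simp add: L2_inner_commute[of M f "\<lambda>x. f x + g x"] L2_inner_commute[of M g f])
  moreover have "L2_inner M g (\<lambda>x. f x + g x) = L2_inner M f g + L2_inner M g g"
    using L2_inner_add_left[OF assms assms(2)]
    by (simp add: L2_inner_commute[of M g "\<lambda>x. f x + g x"])
  ultimately show ?thesis
    using L2_inner_add_left[OF assms L2_space_add[OF assms]] by simp
qed

lemma L2_inner_diff_self:
  assumes "f \<in> L2_space M" "g \<in> L2_space M"
  shows "L2_inner M (\<lambda>x. f x - g x) (\<lambda>x. f x - g x)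
       = L2_inner M f f - 2 * L2_inner M f g + L2_inner M g g"
  using L2_inner_add_self[OF assms(1) L2_space_scale[OF assms(2), of "-1"]]
  unfolding L2_inner_scale_left L2_inner_scale_right by simp

lemma L2_Cauchy_Schwarz:
  assumes "f \<in> L2_space M" "g \<in> L2_space M"
  shows "(L2_inner M f g)\<^sup>2 \<le> L2_inner M f f * L2_inner M g g"
proof -
  let ?a = "L2_inner M f f" and ?b = "L2_inner M g g" and ?c = "L2_inner M f g"
  have *: "0 \<le> ?a - 2 * t * ?c + t\<^sup>2 * ?b" for t
  proof -
    have "0 \<le> L2_inner M (\<lambda>x. f x - t * g x) (\<lambda>x. f x - t * g x)" by simp
    also have "\<dots> = ?a - 2 * t * ?c + t\<^sup>2 * ?b"
      using L2_inner_diff_self[OF assms(1) L2_space_scale[OF assms(2), of t]]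
      unfolding L2_inner_scale_left L2_inner_scale_right by (simp add: power2_eq_square)
    finally show ?thesis .
  qed
  show ?thesis
  proof (cases "?b = 0")
    case True
    show ?thesis
    proof (cases "?c = 0")
      case False
      then show ?thesis
        using *[of "(?a + 1) / (2 * ?c)"] True by (simp add: field_simps)
    qed simp
  next
    case False
    then have b: "0 < ?b" using L2_inner_nonneg[of M g] by linarith
    have "0 \<le> ?a - ?c\<^sup>2 / ?b"
      using *[of "?c / ?b"] b by (simp add: field_simps power2_eq_square)
    then show ?thesis using b by (simp add: field_simps)
  qed
qed

lemma L2_norm_nonneg [simp]: "0 \<le> L2_norm M f"
  by (simp add: L2_norm_def)

lemma L2_norm_zero [simp]: "L2_norm M (\<lambda>_. 0) = 0"
  by (simp add: L2_norm_def)

lemma L2_norm_sq: "(L2_norm M f)\<^sup>2 = L2_inner M f f"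
  by (simp add: L2_norm_def)

lemma L2_norm_le_iff: "0 \<le> c \<Longrightarrow> L2_norm M f \<le> c \<longleftrightarrow> L2_inner M f f \<le> c\<^sup>2"
  unfolding L2_norm_sq[symmetric] by (simp add: power2_le_iff_abs_le)

lemma L2_norm_scale: "L2_norm M (\<lambda>x. c * f x) = \<bar>c\<bar> * L2_norm M f"
proof -
  have "L2_inner M (\<lambda>x. c * f x) (\<lambda>x. c * f x) = c\<^sup>2 * L2_inner M f f"
    unfolding L2_inner_scale_left L2_inner_scale_right by (simp add: power2_eq_square)
  then show ?thesis by (simp add: L2_norm_def real_sqrt_mult)
qed

lemma L2_norm_triangle:
  assumes "f \<in> L2_space M" "g \<in> L2_space M"
  shows "L2_norm M (\<lambda>x. f x + g x) \<le> L2_norm M f + L2_norm M g"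
proof -
  have "(L2_inner M f g)\<^sup>2 \<le> (L2_norm M f * L2_norm M g)\<^sup>2"
    unfolding power_mult_distrib L2_norm_sq by (rule L2_Cauchy_Schwarz[OF assms])
  then have "L2_inner M f g \<le> L2_norm M f * L2_norm M g"
    by (rule power2_le_imp_le) simp
  then have "L2_inner M (\<lambda>x. f x + g x) (\<lambda>x. f x + g x) \<le> (L2_norm M f + L2_norm M g)\<^sup>2"
    unfolding L2_inner_add_self[OF assms] power2_sum L2_norm_sq by linarith
  then show ?thesis by (subst L2_norm_le_iff) simp_all
qed

lemma L2_norm_lincomb:
  assumes "\<And>i. i \<in> I \<Longrightarrow> g i \<in> L2_space M"
  shows "L2_norm M (\<lambda>x. \<Sum>i\<in>I. c i * g i x) \<le> (\<Sum>i\<in>I. \<bar>c i\<bar> * L2_norm M (g i))"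
proof (cases "finite I")
  case True
  then show ?thesis using assms
  proof (induction I)
    case (insert j I)
    have "L2_norm M (\<lambda>x. \<Sum>i\<in>insert j I. c i * g i x)
        \<le> L2_norm M (\<lambda>x. c j * g j x) + L2_norm M (\<lambda>x. \<Sum>i\<in>I. c i * g i x)"
      using insert by (simp add: L2_norm_triangle L2_space_scale L2_space_lincomb)
    moreover have "L2_norm M (\<lambda>x. \<Sum>i\<in>I. c i * g i x) \<le> (\<Sum>i\<in>I. \<bar>c i\<bar> * L2_norm M (g i))"
      using insert by auto
    ultimately show ?case using insert.hyps by (simp add: L2_norm_scale)
  qed simp
qed simp

lemma L2_dist_triangle:
  assumes "f \<in> L2_space M" "g \<in> L2_space M" "h \<in> L2_space M"
  shows "L2_dist M f h \<le> L2_dist M f g + L2_dist M g h"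
  using L2_norm_triangle[OF L2_space_diff[OF assms(1,2)] L2_space_diff[OF assms(2,3)]]
  by (simp add: L2_dist_norm)

lemma L2_dist_commute: "L2_dist M f g = L2_dist M g f"
  unfolding L2_dist_def by (subst power2_commute) simp

section \<open>Orthonormal systems\<close>

definition orthonormal :: "'a measure \<Rightarrow> ('j \<Rightarrow> 'a \<Rightarrow> real) \<Rightarrow> 'j set \<Rightarrow> bool" where
  "orthonormal M e J \<longleftrightarrow> finite J \<and> (\<forall>j\<in>J. e j \<in> L2_space M) \<and>
     (\<forall>i\<in>J. \<forall>j\<in>J. L2_inner M (e i) (e j) = (if i = j then 1 else 0))"

lemma orthonormal_subset: "orthonormal M e J \<Longrightarrow> J' \<subseteq> J \<Longrightarrow> orthonormal M e J'"
  unfolding orthonormal_def using finite_subset[of J' J] by (simp add: subset_iff)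

text \<open>The squared distance from \<open>f\<close> to the span of an orthonormal system.\<close>

definition residual :: "'a measure \<Rightarrow> ('j \<Rightarrow> 'a \<Rightarrow> real) \<Rightarrow> 'j set \<Rightarrow> ('a \<Rightarrow> real) \<Rightarrow> real" where
  "residual M e J f = L2_inner M f f - (\<Sum>j\<in>J. (L2_inner M f (e j))\<^sup>2)"

lemma inner_orthonormal_lincomb:
  assumes "orthonormal M e J" "k \<in> J"
  shows "L2_inner M (\<lambda>x. \<Sum>j\<in>J. c j * e j x) (e k) = c k"
proof -
  have "L2_inner M (\<lambda>x. \<Sum>j\<in>J. c j * e j x) (e k) = (\<Sum>j\<in>J. c j * L2_inner M (e j) (e k))"
    using assms by (intro L2_inner_lincomb_left) (auto simp: orthonormal_def)
  also have "\<dots> = (\<Sum>j\<in>J. if j = k then c j else 0)"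
    using assms by (intro sum.cong) (auto simp: orthonormal_def)
  finally show ?thesis using assms by (simp add: orthonormal_def)
qed

lemma norm_orthonormal_lincomb:
  assumes "orthonormal M e J"
  shows "L2_inner M (\<lambda>x. \<Sum>j\<in>J. c j * e j x) (\<lambda>x. \<Sum>j\<in>J. c j * e j x) = (\<Sum>j\<in>J. (c j)\<^sup>2)"
proof -
  have e: "\<And>j. j \<in> J \<Longrightarrow> e j \<in> L2_space M" using assms by (auto simp: orthonormal_def)
  show ?thesis
    by (subst L2_inner_lincomb_right)
       (auto simp: e L2_space_lincomb inner_orthonormal_lincomb[OF assms] power2_eq_square intro!: sum.cong)
qed

lemma norm_diff_orthonormal_lincomb:
  assumes J: "orthonormal M e J" and f: "f \<in> L2_space M"
  shows "L2_inner M (\<lambda>x. f x - (\<Sum>j\<in>J. c j * e j x)) (\<lambda>x. f x - (\<Sum>j\<in>J. c j * e j x))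
       = residual M e J f + (\<Sum>j\<in>J. (c j - L2_inner M f (e j))\<^sup>2)"
proof -
  have e: "\<And>j. j \<in> J \<Longrightarrow> e j \<in> L2_space M" using J by (auto simp: orthonormal_def)
  have "L2_inner M (\<lambda>x. f x - (\<Sum>j\<in>J. c j * e j x)) (\<lambda>x. f x - (\<Sum>j\<in>J. c j * e j x))
      = L2_inner M f f - 2 * (\<Sum>j\<in>J. c j * L2_inner M f (e j)) + (\<Sum>j\<in>J. (c j)\<^sup>2)"
    by (simp add: L2_inner_diff_self f e L2_space_lincomb L2_inner_lincomb_right
        norm_orthonormal_lincomb[OF J])
  also have "\<dots> = residual M e J f + (\<Sum>j\<in>J. (c j - L2_inner M f (e j))\<^sup>2)"
    by (simp add: residual_def power2_diff sum.distrib sum_subtractf sum_distrib_left mult_ac)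
  finally show ?thesis .
qed

lemma norm_diff_projection:
  assumes "orthonormal M e J" "f \<in> L2_space M"
  shows "L2_inner M (\<lambda>x. f x - (\<Sum>j\<in>J. L2_inner M f (e j) * e j x))
           (\<lambda>x. f x - (\<Sum>j\<in>J. L2_inner M f (e j) * e j x)) = residual M e J f"
  using norm_diff_orthonormal_lincomb[OF assms, of "\<lambda>j. L2_inner M f (e j)"] by simp

lemma residual_le:
  assumes "orthonormal M e J" "f \<in> L2_space M"
  shows "residual M e J f
    \<le> L2_inner M (\<lambda>x. f x - (\<Sum>j\<in>J. c j * e j x)) (\<lambda>x. f x - (\<Sum>j\<in>J. c j * e j x))"
  by (simp add: norm_diff_orthonormal_lincomb[OF assms] sum_nonneg)

lemma residual_nonneg:
  assumes "orthonormal M e J" "f \<in> L2_space M"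
  shows "0 \<le> residual M e J f"
  by (subst norm_diff_projection[OF assms, symmetric]) (rule L2_inner_nonneg)

text \<open>One step of the Gram--Schmidt process. A function that already lies in the span, up to a null
  set, adds nothing.\<close>

lemma Gram_Schmidt_step:
  assumes E: "orthonormal M (\<lambda>e. e) E" and g: "g \<in> L2_space M"
  shows "\<exists>E' c. E \<subseteq> E' \<and> orthonormal M (\<lambda>e. e) E' \<and> card E' \<le> Suc (card E) \<and>
           L2_norm M (\<lambda>x. g x - (\<Sum>e\<in>E'. c e * e x)) = 0"
proof -
  define h where "h = (\<lambda>x. g x - (\<Sum>e\<in>E. L2_inner M g e * e x))"
  have eL: "\<And>e. e \<in> E \<Longrightarrow> e \<in> L2_space M" and fin: "finite E"
    using E by (auto simp: orthonormal_def)
  have hL: "h \<in> L2_space M" unfolding h_def using g eL by (intro L2_space_diff L2_space_lincomb) auto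
  have orth: "L2_inner M h e = 0" if "e \<in> E" for e
    using that g eL inner_orthonormal_lincomb[OF E that, of "\<lambda>e. L2_inner M g e"]
    by (simp add: h_def L2_inner_diff_left L2_space_lincomb)
  show ?thesis
  proof (cases "L2_norm M h = 0")
    case True
    then show ?thesis using E by (intro exI[of _ E] exI[of _ "L2_inner M g"]) (auto simp: h_def)
  next
    case False
    define n where "n = L2_norm M h"
    have n: "0 < n" using False L2_norm_nonneg[of M h] unfolding n_def by linarith
    define k where "k = (\<lambda>x. (1 / n) * h x)"
    have kL: "k \<in> L2_space M" unfolding k_def by (rule L2_space_scale[OF hL])
    have kk: "L2_inner M k k = 1"
      using n unfolding L2_norm_sq[symmetric] k_def L2_norm_scale by (simp add: n_def)
    have ke: "L2_inner M k e = 0" "L2_inner M e k = 0" if "e \<in> E" for e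
      using orth[OF that] L2_inner_scale_left[of M "1 / n" h e]
      by (simp_all add: k_def L2_inner_commute[of M e])
    have nin: "k \<notin> E" using ke(1)[of k] kk by auto
    have "orthonormal M (\<lambda>e. e) (insert k E)"
      using E kL kk ke nin unfolding orthonormal_def by auto
    moreover have "(\<lambda>x. g x - (\<Sum>e\<in>insert k E. ((L2_inner M g)(k := n)) e * e x)) = (\<lambda>_. 0)"
    proof
      fix x
      have "(\<Sum>e\<in>insert k E. ((L2_inner M g)(k := n)) e * e x)
          = n * k x + (\<Sum>e\<in>E. L2_inner M g e * e x)"
        using fin nin by (auto intro!: sum.cong)
      also have "\<dots> = g x" using n by (simp add: k_def h_def)
      finally show "g x - (\<Sum>e\<in>insert k E. ((L2_inner M g)(k := n)) e * e x) = 0" by simp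
    qed
    ultimately show ?thesis
      using fin nin
      by (intro exI[of _ "insert k E"] exI[of _ "(L2_inner M g)(k := n)"]) auto
  qed
qed

text \<open>The vanishing distance to a linear combination expresses membership in the span up to null sets.\<close>

lemma Gram_Schmidt:
  assumes E: "orthonormal M (\<lambda>e. e) E" and K: "finite K" "\<And>k. k \<in> K \<Longrightarrow> b k \<in> L2_space M"
  shows "\<exists>E'. E \<subseteq> E' \<and> orthonormal M (\<lambda>e. e) E' \<and> card E' \<le> card E + card K \<and>
           (\<forall>k\<in>K. \<exists>c. L2_norm M (\<lambda>x. b k x - (\<Sum>e\<in>E'. c e * e x)) = 0)"
  using K
proof (induction K)
  case empty
  then show ?case using E by (intro exI[of _ E]) auto
next
  case (insert l K)
  then obtain E1 where E1: "E \<subseteq> E1" "orthonormal M (\<lambda>e. e) E1" "card E1 \<le> card E + card K"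
    "\<And>k. k \<in> K \<Longrightarrow> \<exists>c. L2_norm M (\<lambda>x. b k x - (\<Sum>e\<in>E1. c e * e x)) = 0"
    by auto
  obtain E2 c where E2: "E1 \<subseteq> E2" "orthonormal M (\<lambda>e. e) E2" "card E2 \<le> Suc (card E1)"
    "L2_norm M (\<lambda>x. b l x - (\<Sum>e\<in>E2. c e * e x)) = 0"
    using Gram_Schmidt_step[OF E1(2), of "b l"] insert.prems by auto
  have "\<exists>c. L2_norm M (\<lambda>x. b k x - (\<Sum>e\<in>E2. c e * e x)) = 0" if k: "k \<in> K" for k
  proof -
    obtain a where a: "L2_norm M (\<lambda>x. b k x - (\<Sum>e\<in>E1. a e * e x)) = 0" using E1(4)[OF k] by auto
    have "(\<Sum>e\<in>E2. (if e \<in> E1 then a e else 0) * e x) = (\<Sum>e\<in>E1. a e * e x)" for x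
      using E2(1,2) by (intro sum.mono_neutral_cong_right) (auto simp: orthonormal_def)
    then show ?thesis using a by (intro exI[of _ "\<lambda>e. if e \<in> E1 then a e else 0"]) simp
  qed
  then show ?case using E1 E2 insert.hyps by (intro exI[of _ E2]) auto
qed

lemma residual_le_spanned:
  assumes E: "orthonormal M (\<lambda>e. e) E" and f: "f \<in> L2_space M"
    and K: "finite K" "\<And>k. k \<in> K \<Longrightarrow> b k \<in> L2_space M"
      "\<And>k. k \<in> K \<Longrightarrow> \<exists>c. L2_norm M (\<lambda>x. b k x - (\<Sum>e\<in>E. c e * e x)) = 0"
  shows "residual M (\<lambda>e. e) E f
    \<le> L2_inner M (\<lambda>x. f x - (\<Sum>k\<in>K. a k * b k x)) (\<lambda>x. f x - (\<Sum>k\<in>K. a k * b k x))"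
proof -
  have "\<forall>k\<in>K. \<exists>c. L2_norm M (\<lambda>x. b k x - (\<Sum>e\<in>E. c e * e x)) = 0"
    using K(3) by blast
  from bchoice[OF this]
  obtain c where c: "\<And>k. k \<in> K \<Longrightarrow> L2_norm M (\<lambda>x. b k x - (\<Sum>e\<in>E. c k e * e x)) = 0"
    by blast
  have eL: "\<And>e. e \<in> E \<Longrightarrow> e \<in> L2_space M" using E by (auto simp: orthonormal_def)
  define w where "w = (\<lambda>x. \<Sum>k\<in>K. a k * b k x)"
  define d where "d = (\<lambda>e. \<Sum>k\<in>K. a k * c k e)"
  define p where "p = (\<lambda>x. \<Sum>e\<in>E. d e * e x)"
  have L: "w \<in> L2_space M" "p \<in> L2_space M"
    unfolding w_def p_def using K eL by (auto intro!: L2_space_lincomb)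
  have wp: "w x - p x = (\<Sum>k\<in>K. a k * (b k x - (\<Sum>e\<in>E. c k e * e x)))" for x
  proof -
    have "p x = (\<Sum>k\<in>K. \<Sum>e\<in>E. a k * c k e * e x)"
      unfolding p_def d_def sum_distrib_right by (rule sum.swap)
    then show ?thesis
      by (simp add: w_def sum_subtractf right_diff_distrib sum_distrib_left mult.assoc)
  qed
  have "L2_norm M (\<lambda>x. w x - p x) \<le> (\<Sum>k\<in>K. \<bar>a k\<bar> * L2_norm M (\<lambda>x. b k x - (\<Sum>e\<in>E. c k e * e x)))"
    unfolding wp using K(2) eL by (intro L2_norm_lincomb L2_space_diff L2_space_lincomb) auto
  also have "\<dots> = 0" using c by simp
  finally have 0: "L2_norm M (\<lambda>x. w x - p x) \<le> 0" .
  have "L2_norm M (\<lambda>x. f x - p x) \<le> L2_norm M (\<lambda>x. f x - w x)"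
    using L2_norm_triangle[OF L2_space_diff[OF f L(1)] L2_space_diff[OF L]] 0 by simp
  then have "L2_inner M (\<lambda>x. f x - p x) (\<lambda>x. f x - p x) \<le> L2_inner M (\<lambda>x. f x - w x) (\<lambda>x. f x - w x)"
    by (simp add: L2_norm_def)
  then show ?thesis
    using residual_le[OF E f, of d] by (simp add: p_def w_def)
qed

section \<open>Covers of absolutely convex hulls\<close>

definition abs_hull :: "('i \<Rightarrow> 'a \<Rightarrow> real) \<Rightarrow> 'i set \<Rightarrow> ('a \<Rightarrow> real) set" where
  "abs_hull g I = {(\<lambda>x. \<Sum>i\<in>I. \<beta> i * g i x) | \<beta>. (\<Sum>i\<in>I. \<bar>\<beta> i\<bar>) \<le> 1}"

text \<open>A cover by closed balls, with the entropy \<open>H\<close> in place of the number of balls, so that the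
  costs of successive approximations add up.\<close>

definition L2_cover :: "'a measure \<Rightarrow> ('a \<Rightarrow> real) set \<Rightarrow> real \<Rightarrow> real \<Rightarrow> bool" where
  "L2_cover M S \<epsilon> H \<longleftrightarrow> (\<exists>C. finite C \<and> C \<subseteq> L2_space M \<and> real (card C) \<le> exp H \<and>
     (\<forall>f\<in>S. \<exists>c\<in>C. L2_dist M f c \<le> \<epsilon>))"

lemma L2_cover_mono:
  assumes "L2_cover M S \<epsilon> H" "\<epsilon> \<le> \<epsilon>'" "H \<le> H'"
  shows "L2_cover M S \<epsilon>' H'"
  using assms unfolding L2_cover_def by (meson exp_le_cancel_iff order_trans)

lemma L2_cover_add:
  assumes "L2_cover M S \<epsilon> H" "L2_cover M T \<delta> K" "S \<subseteq> L2_space M" "T \<subseteq> L2_space M"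
    and U: "\<And>u. u \<in> U \<Longrightarrow> \<exists>f\<in>S. \<exists>g\<in>T. u = (\<lambda>x. f x + g x)"
  shows "L2_cover M U (\<epsilon> + \<delta>) (H + K)"
proof -
  obtain C where C: "finite C" "C \<subseteq> L2_space M" "real (card C) \<le> exp H"
    "\<And>f. f \<in> S \<Longrightarrow> \<exists>c\<in>C. L2_dist M f c \<le> \<epsilon>"
    using assms(1) by (auto simp: L2_cover_def)
  obtain D where D: "finite D" "D \<subseteq> L2_space M" "real (card D) \<le> exp K"
    "\<And>f. f \<in> T \<Longrightarrow> \<exists>c\<in>D. L2_dist M f c \<le> \<delta>"
    using assms(2) by (auto simp: L2_cover_def)
  let ?add = "\<lambda>(c, d) x. c x + d x :: real"
  let ?B = "?add ` (C \<times> D)"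
  have "card ?B \<le> card C * card D"
    using card_image_le[of "C \<times> D" ?add] C(1) D(1) by (simp add: card_cartesian_product)
  then have "real (card ?B) \<le> real (card C) * real (card D)"
    by (metis of_nat_le_iff of_nat_mult)
  also have "\<dots> \<le> exp H * exp K" using C(3) D(3) by (intro mult_mono) auto
  finally have card: "real (card ?B) \<le> exp (H + K)" by (simp add: exp_add)
  have near: "\<exists>b\<in>?B. L2_dist M u b \<le> \<epsilon> + \<delta>" if u: "u \<in> U" for u
  proof -
    obtain f g where fg: "f \<in> S" "g \<in> T" "u = (\<lambda>x. f x + g x)" using U[OF u] by auto
    obtain c d where cd: "c \<in> C" "L2_dist M f c \<le> \<epsilon>" "d \<in> D" "L2_dist M g d \<le> \<delta>"
      using C(4)[OF fg(1)] D(4)[OF fg(2)] by auto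
    have "L2_norm M (\<lambda>x. (f x - c x) + (g x - d x))
        \<le> L2_norm M (\<lambda>x. f x - c x) + L2_norm M (\<lambda>x. g x - d x)"
      using fg cd C D assms by (intro L2_norm_triangle L2_space_diff) auto
    then have "L2_dist M u (?add (c, d)) \<le> \<epsilon> + \<delta>"
      using cd(2,4) by (simp add: L2_dist_norm fg(3) algebra_simps)
    then show ?thesis using cd by blast
  qed
  have "?B \<subseteq> L2_space M" using C(2) D(2) by (auto intro!: L2_space_add)
  then show ?thesis
    using C(1) D(1) card near unfolding L2_cover_def by (intro exI[of _ ?B]) auto
qed

lemma L2_cover_sum:
  fixes F :: "'l \<Rightarrow> 'b \<Rightarrow> 'a \<Rightarrow> real"
  assumes "finite A" "\<And>l. l \<in> A \<Longrightarrow> L2_cover M (F l ` B) (\<epsilon> l) (H l)"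
    "\<And>l b. l \<in> A \<Longrightarrow> b \<in> B \<Longrightarrow> F l b \<in> L2_space M"
  shows "L2_cover M ((\<lambda>b x. \<Sum>l\<in>A. F l b x) ` B) (\<Sum>l\<in>A. \<epsilon> l) (\<Sum>l\<in>A. H l)"
  using assms
proof (induction A)
  case empty
  then show ?case
    by (auto simp: L2_cover_def L2_dist_norm intro!: exI[of _ "{\<lambda>_. 0}"])
next
  case (insert l A)
  have "L2_cover M ((\<lambda>b x. \<Sum>l\<in>insert l A. F l b x) ` B) (\<epsilon> l + (\<Sum>l\<in>A. \<epsilon> l)) (H l + (\<Sum>l\<in>A. H l))"
  proof (rule L2_cover_add)
    show "L2_cover M (F l ` B) (\<epsilon> l) (H l)" using insert by auto
    show "L2_cover M ((\<lambda>b x. \<Sum>l\<in>A. F l b x) ` B) (\<Sum>l\<in>A. \<epsilon> l) (\<Sum>l\<in>A. H l)"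
      using insert by auto
    show "F l ` B \<subseteq> L2_space M" using insert by auto
    show "(\<lambda>b x. \<Sum>l\<in>A. F l b x) ` B \<subseteq> L2_space M" using insert by (auto intro!: L2_space_sum)
    fix u assume "u \<in> (\<lambda>b x. \<Sum>l\<in>insert l A. F l b x) ` B"
    then show "\<exists>f\<in>F l ` B. \<exists>g\<in>(\<lambda>b x. \<Sum>l\<in>A. F l b x) ` B. u = (\<lambda>x. f x + g x)"
      using insert.hyps by auto
  qed
  then show ?case using insert.hyps by simp
qed

text \<open>Maurey's lemma, by a greedy choice. Some signed atom has at least as large an inner product with
  the current error \<open>D\<close> as \<open>f\<close> itself, since \<open>f\<close> is an absolutely convex combination of the atoms.
  Adding \<open>f\<close> minus this atom to \<open>D\<close> increases the squared norm by at most \<open>4 * R\<close>, so that it stays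
  linear in the number of steps.\<close>

lemma Maurey:
  assumes I: "finite I" "I \<noteq> {}" and g: "\<And>i. i \<in> I \<Longrightarrow> g i \<in> L2_space M"
    and R: "\<And>i. i \<in> I \<Longrightarrow> L2_inner M (g i) (g i) \<le> R" and f: "f \<in> abs_hull g I"
  shows "\<exists>xs. set xs \<subseteq> I \<times> {-1, 1} \<and> length xs = n \<and>
    L2_inner M (\<lambda>x. real n * f x - (\<Sum>(i, s)\<leftarrow>xs. s * g i x))
      (\<lambda>x. real n * f x - (\<Sum>(i, s)\<leftarrow>xs. s * g i x)) \<le> 4 * R * real n"
proof -
  obtain \<beta> where \<beta>: "f = (\<lambda>x. \<Sum>i\<in>I. \<beta> i * g i x)" "(\<Sum>i\<in>I. \<bar>\<beta> i\<bar>) \<le> 1"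
    using f by (auto simp: abs_hull_def)
  have fL: "f \<in> L2_space M" unfolding \<beta> using g by (rule L2_space_lincomb)
  obtain i0 where i0: "i0 \<in> I" using I by blast
  have R0: "0 \<le> R" using R[OF i0] L2_inner_nonneg[of M "g i0"] by linarith
  have norm_g: "L2_norm M (g i) \<le> sqrt R" if "i \<in> I" for i
    using R[OF that] R0 by (simp add: L2_norm_def)
  have "L2_norm M f \<le> (\<Sum>i\<in>I. \<bar>\<beta> i\<bar> * L2_norm M (g i))"
    unfolding \<beta> using g by (rule L2_norm_lincomb)
  also have "\<dots> \<le> (\<Sum>i\<in>I. \<bar>\<beta> i\<bar> * sqrt R)" by (intro sum_mono mult_left_mono norm_g) auto
  also have "\<dots> = (\<Sum>i\<in>I. \<bar>\<beta> i\<bar>) * sqrt R" by (simp add: sum_distrib_right)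
  also have "\<dots> \<le> sqrt R" using \<beta>(2) R0 by (simp add: mult_left_le_one_le sum_nonneg)
  finally have norm_f: "L2_norm M f \<le> sqrt R" .
  show ?thesis
  proof (induction n)
    case 0
    then show ?case by simp
  next
    case (Suc n)
    then obtain xs where xs: "set xs \<subseteq> I \<times> {-1, 1}" "length xs = n"
      and le: "L2_inner M (\<lambda>x. real n * f x - (\<Sum>(i, s)\<leftarrow>xs. s * g i x))
        (\<lambda>x. real n * f x - (\<Sum>(i, s)\<leftarrow>xs. s * g i x)) \<le> 4 * R * real n" by auto
    define D where "D = (\<lambda>x. real n * f x - (\<Sum>(i, s)\<leftarrow>xs. s * g i x))"
    have "(\<lambda>x. \<Sum>(i, s)\<leftarrow>xs. s * g i x) \<in> L2_space M"
      using xs(1) g by (induction xs) (auto intro!: L2_space_add L2_space_scale)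
    then have DL: "D \<in> L2_space M" unfolding D_def using fL by (intro L2_space_diff L2_space_scale)
    \<comment> \<open>Otherwise \<open>L2_inner M D f\<close> would exceed the maximum \<open>m\<close> of these absolute values.\<close>
    have "\<exists>i\<in>I. L2_inner M D f \<le> \<bar>L2_inner M D (g i)\<bar>"
    proof (rule ccontr)
      assume "\<not> ?thesis"
      then have less: "\<bar>L2_inner M D (g i)\<bar> < L2_inner M D f" if "i \<in> I" for i using that by force
      define m where "m = Max ((\<lambda>i. \<bar>L2_inner M D (g i)\<bar>) ` I)"
      have m: "\<bar>L2_inner M D (g i)\<bar> \<le> m" if "i \<in> I" for i
        unfolding m_def using that I by (intro Max_ge) auto
      have "m \<in> (\<lambda>i. \<bar>L2_inner M D (g i)\<bar>) ` I"
        unfolding m_def using I by (intro Max_in) auto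
      then have "m < L2_inner M D f" "0 \<le> m" using less by auto
      moreover have "L2_inner M D f = (\<Sum>i\<in>I. \<beta> i * L2_inner M D (g i))"
        unfolding \<beta> using g DL by (intro L2_inner_lincomb_right)
      moreover have "(\<Sum>i\<in>I. \<beta> i * L2_inner M D (g i)) \<le> (\<Sum>i\<in>I. \<bar>\<beta> i\<bar> * m)"
      proof (rule sum_mono)
        fix i assume i: "i \<in> I"
        have "\<beta> i * L2_inner M D (g i) \<le> \<bar>\<beta> i\<bar> * \<bar>L2_inner M D (g i)\<bar>"
          by (metis abs_ge_self abs_mult)
        also have "\<dots> \<le> \<bar>\<beta> i\<bar> * m" using m[OF i] by (rule mult_left_mono) simp
        finally show "\<beta> i * L2_inner M D (g i) \<le> \<bar>\<beta> i\<bar> * m" .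
      qed
      moreover have "(\<Sum>i\<in>I. \<bar>\<beta> i\<bar> * m) \<le> m"
        using \<beta>(2) \<open>0 \<le> m\<close> by (simp add: sum_distrib_right[symmetric] mult_left_le_one_le sum_nonneg)
      ultimately show False by linarith
    qed
    then obtain i where i: "i \<in> I" "L2_inner M D f \<le> \<bar>L2_inner M D (g i)\<bar>" by auto
    define s :: real where "s = (if 0 \<le> L2_inner M D (g i) then 1 else -1)"
    have s: "s \<in> {-1, 1}" "L2_inner M D f \<le> s * L2_inner M D (g i)"
      using i(2) by (auto simp: s_def)
    define w where "w = (\<lambda>x. f x - s * g i x)"
    have wL: "w \<in> L2_space M"
      unfolding w_def using fL g[OF i(1)] by (intro L2_space_diff L2_space_scale)
    have "L2_norm M w \<le> L2_norm M f + L2_norm M (\<lambda>x. (-s) * g i x)"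
      using L2_norm_triangle[OF fL L2_space_scale[OF g[OF i(1)], of "-s"]] by (simp add: w_def)
    also have "\<dots> \<le> 2 * sqrt R"
      unfolding L2_norm_scale using norm_f norm_g[OF i(1)] s(1) by auto
    finally have "L2_inner M w w \<le> (2 * sqrt R)\<^sup>2"
      using R0 by (subst (asm) L2_norm_le_iff) auto
    then have ww: "L2_inner M w w \<le> 4 * R" using R0 by (simp add: power_mult_distrib)
    have "L2_inner M D w = L2_inner M D f - s * L2_inner M D (g i)"
      using L2_inner_diff_left[OF fL L2_space_scale[OF g[OF i(1)], of s] DL]
      by (simp add: L2_inner_commute[of M D] w_def L2_inner_scale_left)
    then have Dw: "L2_inner M D w \<le> 0" using s(2) by simp
    have "L2_inner M (\<lambda>x. D x + w x) (\<lambda>x. D x + w x) \<le> 4 * R * real n + 4 * R"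
      unfolding L2_inner_add_self[OF DL wL] using le ww Dw by (simp add: D_def)
    moreover have "(\<lambda>x. D x + w x)
        = (\<lambda>x. real (Suc n) * f x - (\<Sum>(i, s)\<leftarrow>(i, s) # xs. s * g i x))"
      by (auto simp: D_def w_def algebra_simps)
    ultimately show ?case
      using xs i(1) s(1) by (intro exI[of _ "(i, s) # xs"]) (auto simp: algebra_simps)
  qed
qed

text \<open>Every \<open>x\<close> in \<open>(0, 1)\<close> gives the bound \<open>x powr (- T) * (2 / (1 - x)) ^ card J\<close> for the
  number of integer vectors of \<open>\<ell>\<^sub>1\<close>-norm at most \<open>T\<close>, by weighting a vector with \<open>x\<close> to its norm.
  With \<open>T = card J * A\<close> the choice \<open>x = 1 - 1 / (2 * A)\<close> is good enough.\<close>

lemma card_integer_ball: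
  fixes J :: "'j set"
  assumes J: "finite J" and A: "1 \<le> A"
  defines "Z \<equiv> {z \<in> J \<rightarrow>\<^sub>E UNIV. (\<Sum>j\<in>J. nat \<bar>z j :: int\<bar>) \<le> card J * A}"
  shows "finite Z" and "card Z \<le> (8 * A) ^ card J"
proof -
  let ?T = "card J * A"
  let ?B = "{- int ?T..int ?T}"
  have Z: "Z \<subseteq> (J \<rightarrow>\<^sub>E ?B)"
  proof
    fix z assume z: "z \<in> Z"
    have "z j \<in> ?B" if "j \<in> J" for j
    proof -
      have "nat \<bar>z j\<bar> \<le> (\<Sum>j\<in>J. nat \<bar>z j\<bar>)" using that J by (intro member_le_sum) auto
      also have "\<dots> \<le> ?T" using z by (simp add: Z_def)
      finally have "\<bar>z j\<bar> \<le> int ?T" by (simp only: nat_le_iff)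
      then have "- int ?T \<le> z j" "z j \<le> int ?T" by linarith+
      then show ?thesis by (simp only: atLeastAtMost_iff)
    qed
    then show "z \<in> (J \<rightarrow>\<^sub>E ?B)" using z by (auto simp: Z_def PiE_iff)
  qed
  have finB: "finite (J \<rightarrow>\<^sub>E ?B)" using J by (intro finite_PiE) auto
  then show "finite Z" using Z by (rule finite_subset[rotated])
  define x :: real where "x = 1 - 1 / (2 * real A)"
  have x: "1 / 2 \<le> x" "x < 1" using A by (auto simp: x_def field_simps)
  have geo: "(\<Sum>k\<in>?B. x ^ nat \<bar>k\<bar>) \<le> 4 * real A"
  proof -
    have "(\<Sum>k\<in>?B. x ^ nat \<bar>k\<bar>) \<le> (\<Sum>k\<in>(int ` {..?T}) \<union> (\<lambda>n. - int n) ` {..?T}. x ^ nat \<bar>k\<bar>)"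
    proof (rule sum_mono2)
      show "?B \<subseteq> int ` {..?T} \<union> (\<lambda>n. - int n) ` {..?T}"
      proof
        fix k assume k: "k \<in> ?B"
        have "k = int (nat k) \<or> k = - int (nat (- k))" by auto
        moreover have "nat k \<le> ?T" "nat (- k) \<le> ?T"
          using k unfolding nat_le_iff atLeastAtMost_iff by linarith+
        ultimately show "k \<in> int ` {..?T} \<union> (\<lambda>n. - int n) ` {..?T}" by blast
      qed
    qed (use x in auto)
    also have "\<dots> \<le> (\<Sum>k\<in>int ` {..?T}. x ^ nat \<bar>k\<bar>) + (\<Sum>k\<in>(\<lambda>n. - int n) ` {..?T}. x ^ nat \<bar>k\<bar>)"
      using x by (subst sum_Un) (auto intro!: sum_nonneg)
    also have "\<dots> = 2 * (\<Sum>n\<le>?T. x ^ n)"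
      by (simp add: sum.reindex inj_on_def)
    also have "\<dots> = 2 * ((1 - x ^ Suc ?T) / (1 - x))"
      using x by (subst sum_gp0) auto
    also have "\<dots> \<le> 2 * (1 / (1 - x))"
      using x by (intro mult_left_mono divide_right_mono) auto
    also have "\<dots> = 4 * real A" using A by (simp add: x_def)
    finally show ?thesis .
  qed
  have "real (card Z) * x ^ ?T = (\<Sum>z\<in>Z. x ^ ?T)" by simp
  also have "\<dots> \<le> (\<Sum>z\<in>Z. \<Prod>j\<in>J. x ^ nat \<bar>z j\<bar>)"
    using x by (intro sum_mono) (auto simp: Z_def power_sum[symmetric] intro!: power_decreasing)
  also have "\<dots> \<le> (\<Sum>z\<in>(J \<rightarrow>\<^sub>E ?B). \<Prod>j\<in>J. x ^ nat \<bar>z j\<bar>)"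
    using x by (intro sum_mono2 Z finB) (auto intro!: prod_nonneg)
  also have "\<dots> = (\<Prod>j\<in>J. \<Sum>k\<in>?B. x ^ nat \<bar>k\<bar>)"
    using J by (subst prod_sum_PiE) auto
  also have "\<dots> \<le> (\<Prod>j\<in>J. 4 * real A)" using x geo by (intro prod_mono) (auto intro!: sum_nonneg)
  finally have 1: "real (card Z) * x ^ ?T \<le> (4 * real A) ^ card J" by simp
  have "1 / 2 \<le> x ^ A"
    using Bernoulli_inequality[of "- (1 / (2 * real A))" A] A by (simp add: x_def field_simps)
  then have "(1 / 2) ^ card J \<le> (x ^ A) ^ card J" by (intro power_mono) auto
  also have "\<dots> = x ^ ?T" by (simp add: power_mult[symmetric] mult.commute)
  finally have "real (card Z) * (1 / 2) ^ card J \<le> (4 * real A) ^ card J"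
    using 1 by (meson mult_left_mono of_nat_0_le_iff order_trans)
  then have "real (card Z) \<le> (4 * real A) ^ card J * 2 ^ card J"
    by (simp add: power_divide field_simps)
  also have "\<dots> = ((4 * real A) * 2) ^ card J" by (rule power_mult_distrib[symmetric])
  also have "(4 * real A) * 2 = real (8 * A)" by simp
  also have "real (8 * A) ^ card J = real ((8 * A) ^ card J)" by (rule of_nat_power[symmetric])
  finally show "card Z \<le> (8 * A) ^ card J" by (simp only: of_nat_le_iff)
qed

text \<open>Rounding every coordinate towards zero to a multiple of \<open>h\<close> keeps the squared norm of the
  integer vector below \<open>D / h\<^sup>2 = card J * A\<close>. This also bounds its \<open>\<ell>\<^sub>1\<close>-norm, since integers satisfy
  \<open>\<bar>k\<bar> \<le> k\<^sup>2\<close>.\<close>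

lemma lattice_rounding:
  fixes y :: "'j \<Rightarrow> real"
  assumes J: "finite J" and A: "1 \<le> A" and D: "(\<Sum>j\<in>J. (y j)\<^sup>2) \<le> D"
  defines "h \<equiv> sqrt (D / (real (card J) * real A))"
  shows "\<exists>z\<in>J \<rightarrow>\<^sub>E (UNIV :: int set). (\<Sum>j\<in>J. nat \<bar>z j\<bar>) \<le> card J * A \<and>
           (\<Sum>j\<in>J. (y j - h * of_int (z j))\<^sup>2) \<le> D / real A"
proof -
  have D0: "0 \<le> D" using D sum_nonneg[of J "\<lambda>j. (y j)\<^sup>2"] by fastforce
  show ?thesis
  proof (cases "D = 0 \<or> J = {}")
    case True
    have "(\<Sum>j\<in>J. (y j)\<^sup>2) = 0" using True D D0 sum_nonneg[of J "\<lambda>j. (y j)\<^sup>2"] by auto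
    then show ?thesis
      using D0 by (intro bexI[of _ "\<lambda>j\<in>J. 0"]) auto
  next
    case False
    have c: "0 < real (card J)" using False J by (simp add: card_gt_0_iff)
    have h: "0 < h" "h\<^sup>2 = D / (real (card J) * real A)"
      using False D0 A c by (auto simp: h_def)
    define t where "t = (\<lambda>j. \<bar>y j\<bar> / h)"
    define k where "k = (\<lambda>j. \<lfloor>t j\<rfloor>)"
    define z where "z = (\<lambda>j\<in>J. (if 0 \<le> y j then k j else - k j))"
    have k: "0 \<le> k j" "of_int (k j) \<le> t j" "t j - of_int (k j) \<le> 1" for j
      using h(1) unfolding k_def t_def by (auto simp: floor_le_iff) linarith
    have z_abs: "\<bar>z j\<bar> = k j" if "j \<in> J" for j using that k(1)[of j] by (simp add: z_def)
    have "real (\<Sum>j\<in>J. nat \<bar>z j\<bar>) = (\<Sum>j\<in>J. of_int (k j))"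
      using z_abs k(1) by (simp cong: sum.cong)
    also have "\<dots> \<le> (\<Sum>j\<in>J. (y j)\<^sup>2 / h\<^sup>2)"
    proof (rule sum_mono)
      fix j
      have "k j \<le> k j * k j" using k(1)[of j] by (cases "k j = 0") (auto intro: mult_right_mono)
      then have "real_of_int (k j) \<le> of_int (k j) * of_int (k j)" by (metis of_int_le_iff of_int_mult)
      also have "\<dots> \<le> t j * t j" using k[of j] by (intro mult_mono) auto
      also have "\<dots> = (y j)\<^sup>2 / h\<^sup>2" by (simp add: t_def power2_eq_square abs_mult[symmetric])
      finally show "real_of_int (k j) \<le> (y j)\<^sup>2 / h\<^sup>2" .
    qed
    also have "\<dots> \<le> D / h\<^sup>2" using D by (simp add: sum_divide_distrib[symmetric] divide_right_mono)
    also have "\<dots> = real (card J * A)" using False D0 c A by (simp add: h(2))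
    finally have 1: "(\<Sum>j\<in>J. nat \<bar>z j\<bar>) \<le> card J * A" by (simp only: of_nat_le_iff)
    have "(\<Sum>j\<in>J. (y j - h * of_int (z j))\<^sup>2) \<le> (\<Sum>j\<in>J. h\<^sup>2)"
    proof (rule sum_mono)
      fix j assume j: "j \<in> J"
      have "\<bar>y j - h * of_int (z j)\<bar> = \<bar>h * (t j - of_int (k j))\<bar>"
        using j h(1) by (simp add: z_def t_def right_diff_distrib abs_if)
      also have "\<dots> \<le> h" using k[of j] h(1) by (simp add: abs_mult mult_left_le)
      finally show "(y j - h * of_int (z j))\<^sup>2 \<le> h\<^sup>2" by (simp add: abs_le_square_iff[symmetric])
    qed
    also have "\<dots> = D / real A" using c by (simp add: h(2))
    finally show ?thesis using 1 by (intro bexI[of _ z]) (auto simp: z_def)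
  qed
qed

lemma L2_cover_abs_hull:
  assumes I: "finite I" "I \<noteq> {}" and g: "\<And>i. i \<in> I \<Longrightarrow> g i \<in> L2_space M"
    and R: "\<And>i. i \<in> I \<Longrightarrow> L2_inner M (g i) (g i) \<le> R" and n: "1 \<le> n"
  shows "L2_cover M (abs_hull g I) (2 * sqrt (R / real n)) (real n * ln (2 * real (card I)))"
proof -
  let ?X = "{xs. set xs \<subseteq> I \<times> {-1, 1 :: real} \<and> length xs = n}"
  let ?c = "\<lambda>xs x. (1 / real n) * (\<Sum>(i, s)\<leftarrow>xs. s * g i x)"
  have sL: "(\<lambda>x. \<Sum>(i, s)\<leftarrow>xs. s * g i x) \<in> L2_space M" if "set xs \<subseteq> I \<times> {-1, 1 :: real}" for xs
    using that g by (induction xs) (auto intro!: L2_space_add L2_space_scale)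
  have fin: "finite ?X" using I by (intro finite_lists_length_eq) auto
  have cI: "0 < card I" using I by (simp add: card_gt_0_iff)
  have "card (I \<times> {-1, 1 :: real}) = 2 * card I"
    by (simp add: card_cartesian_product)
  moreover have "finite (I \<times> {-1, 1 :: real})" using I by simp
  ultimately have "card ?X = (2 * card I) ^ n" by (simp only: card_lists_length_eq)
  then have "card (?c ` ?X) \<le> (2 * card I) ^ n" using card_image_le[OF fin, of ?c] by simp
  then have "real (card (?c ` ?X)) \<le> (2 * real (card I)) ^ n"
    by (metis (mono_tags, lifting) of_nat_le_iff of_nat_mult of_nat_numeral of_nat_power)
  also have "\<dots> = exp (real n * ln (2 * real (card I)))"
    using cI by (simp add: exp_of_nat_mult)
  finally have card: "real (card (?c ` ?X)) \<le> exp (real n * ln (2 * real (card I)))" .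
  have near: "\<exists>c\<in>?c ` ?X. L2_dist M f c \<le> 2 * sqrt (R / real n)" if f: "f \<in> abs_hull g I" for f
  proof -
    obtain xs where xs: "xs \<in> ?X" and le: "L2_inner M (\<lambda>x. real n * f x - (\<Sum>(i, s)\<leftarrow>xs. s * g i x))
      (\<lambda>x. real n * f x - (\<Sum>(i, s)\<leftarrow>xs. s * g i x)) \<le> 4 * R * real n"
      using Maurey[OF I g R f, of n] by auto
    have "L2_dist M f (?c xs) = L2_norm M (\<lambda>x. (1 / real n) * (real n * f x - (\<Sum>(i, s)\<leftarrow>xs. s * g i x)))"
      using n by (simp add: L2_dist_norm right_diff_distrib)
    also have "\<dots> = (1 / real n) * L2_norm M (\<lambda>x. real n * f x - (\<Sum>(i, s)\<leftarrow>xs. s * g i x))"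
      by (subst L2_norm_scale) simp
    also have "\<dots> \<le> (1 / real n) * sqrt (4 * R * real n)"
      unfolding L2_norm_def using le by (intro mult_left_mono real_sqrt_le_mono) auto
    also have "\<dots> = 2 * sqrt (R / real n)"
      using n by (simp add: real_sqrt_mult real_sqrt_divide field_simps)
    finally show ?thesis using xs by blast
  qed
  have "?c xs \<in> L2_space M" if "xs \<in> ?X" for xs
    using that sL[of xs] by (intro L2_space_scale) simp
  then have "?c ` ?X \<subseteq> L2_space M" by blast
  then show ?thesis
    unfolding L2_cover_def using fin card near by (intro exI[of _ "?c ` ?X"]) blast
qed

text \<open>In a space of finite dimension \<open>card J\<close>, the error left by Maurey's lemma can be reduced by a
  further factor \<open>sqrt A\<close> at the price of \<open>ln (8 * A)\<close> per dimension, by rounding its coordinates.\<close>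

lemma L2_cover_abs_hull_finite_dim:
  assumes I: "finite I" "I \<noteq> {}" and e: "orthonormal M e J"
    and R: "\<And>i. i \<in> I \<Longrightarrow> (\<Sum>j\<in>J. (a i j)\<^sup>2) \<le> R" and n: "1 \<le> n" and A: "1 \<le> A"
  shows "L2_cover M (abs_hull (\<lambda>i x. \<Sum>j\<in>J. a i j * e j x) I) (2 * sqrt (R / (real n * real A)))
           (real n * ln (2 * real (card I)) + real (card J) * ln (8 * real A))"
proof -
  let ?g = "\<lambda>i x. \<Sum>j\<in>J. a i j * e j x"
  have J: "finite J" and eL: "\<And>j. j \<in> J \<Longrightarrow> e j \<in> L2_space M" using e by (auto simp: orthonormal_def)
  have gL: "?g i \<in> L2_space M" for i using eL by (rule L2_space_lincomb)
  obtain i0 where "i0 \<in> I" using I by blast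
  then have R0: "0 \<le> R" using R[of i0] sum_nonneg[of J "\<lambda>j. (a i0 j)\<^sup>2"] by fastforce
  have Rg: "L2_inner M (?g i) (?g i) \<le> R" if "i \<in> I" for i
    using R[OF that] by (simp add: norm_orthonormal_lincomb[OF e])
  let ?\<delta> = "2 * sqrt (R / real n)"
  have "L2_cover M (abs_hull ?g I) ?\<delta> (real n * ln (2 * real (card I)))"
    by (rule L2_cover_abs_hull[OF I gL Rg n])
  then obtain C where C: "finite C" "C \<subseteq> L2_space M"
    "real (card C) \<le> exp (real n * ln (2 * real (card I)))"
    "\<And>f. f \<in> abs_hull ?g I \<Longrightarrow> \<exists>c\<in>C. L2_dist M f c \<le> ?\<delta>"
    by (auto simp: L2_cover_def)
  define D where "D = 4 * R / real n"
  have D: "?\<delta>\<^sup>2 = D" using R0 by (simp add: D_def power_mult_distrib)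
  define h where "h = sqrt (D / (real (card J) * real A))"
  let ?Z = "{z \<in> J \<rightarrow>\<^sub>E UNIV. (\<Sum>j\<in>J. nat \<bar>z j :: int\<bar>) \<le> card J * A}"
  \<comment> \<open>The centres may be projected to the span, since this only brings them closer to the hull.\<close>
  let ?b = "\<lambda>(c, z) x. \<Sum>j\<in>J. (L2_inner M c (e j) + h * of_int (z j)) * e j x"
  let ?B = "?b ` (C \<times> ?Z)"
  note Z = card_integer_ball[OF J A]
  have "card ?B \<le> card C * card ?Z"
    using card_image_le[of "C \<times> ?Z" ?b] C(1) Z(1) by (simp add: card_cartesian_product)
  also have "\<dots> \<le> card C * (8 * A) ^ card J" using Z(2) by (intro mult_left_mono) auto
  finally have "real (card ?B) \<le> real (card C * (8 * A) ^ card J)" by (simp only: of_nat_le_iff)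
  also have "\<dots> = real (card C) * (8 * real A) ^ card J" by simp
  also have "\<dots> \<le> exp (real n * ln (2 * real (card I))) * (8 * real A) ^ card J"
    using C(3) by (intro mult_right_mono) auto
  also have "\<dots> = exp (real n * ln (2 * real (card I)) + real (card J) * ln (8 * real A))"
    using A by (simp add: exp_add exp_of_nat_mult)
  finally have card: "real (card ?B) \<le> \<dots>" .
  have near: "\<exists>b\<in>?B. L2_dist M f b \<le> 2 * sqrt (R / (real n * real A))" if f: "f \<in> abs_hull ?g I" for f
  proof -
    obtain c where c: "c \<in> C" "L2_dist M f c \<le> ?\<delta>" using C(4)[OF f] by auto
    have cL: "c \<in> L2_space M" using c C by auto
    obtain \<beta> where \<beta>: "f = (\<lambda>x. \<Sum>i\<in>I. \<beta> i * ?g i x)" using f by (auto simp: abs_hull_def)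
    define u where "u = (\<lambda>j. \<Sum>i\<in>I. \<beta> i * a i j)"
    have fu: "f = (\<lambda>x. \<Sum>j\<in>J. u j * e j x)"
    proof
      fix x
      have "f x = (\<Sum>i\<in>I. \<Sum>j\<in>J. \<beta> i * a i j * e j x)" by (simp add: \<beta> sum_distrib_left mult.assoc)
      also have "\<dots> = (\<Sum>j\<in>J. \<Sum>i\<in>I. \<beta> i * a i j * e j x)" by (rule sum.swap)
      also have "\<dots> = (\<Sum>j\<in>J. u j * e j x)" by (simp add: u_def sum_distrib_right)
      finally show "f x = (\<Sum>j\<in>J. u j * e j x)" .
    qed
    define y where "y = (\<lambda>j. u j - L2_inner M c (e j))"
    have "(\<Sum>j\<in>J. (y j)\<^sup>2) \<le> residual M e J c + (\<Sum>j\<in>J. (u j - L2_inner M c (e j))\<^sup>2)"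
      using residual_nonneg[OF e cL] by (simp add: y_def)
    also have "\<dots> = L2_inner M (\<lambda>x. c x - f x) (\<lambda>x. c x - f x)"
      unfolding fu by (rule norm_diff_orthonormal_lincomb[OF e cL, symmetric])
    also have "\<dots> = (L2_dist M f c)\<^sup>2"
      by (subst L2_dist_commute) (simp add: L2_dist_norm L2_norm_sq)
    also have "\<dots> \<le> ?\<delta>\<^sup>2" using c(2) by (intro power_mono) (auto simp: L2_dist_norm)
    finally have yD: "(\<Sum>j\<in>J. (y j)\<^sup>2) \<le> D" using D by simp
    obtain z where z: "z \<in> ?Z" "(\<Sum>j\<in>J. (y j - h * of_int (z j))\<^sup>2) \<le> D / real A"
      using lattice_rounding[OF J A yD] unfolding h_def by auto
    have "(\<lambda>x. f x - ?b (c, z) x) = (\<lambda>x. \<Sum>j\<in>J. (y j - h * of_int (z j)) * e j x)"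
      by (simp add: fu y_def sum_subtractf[symmetric] algebra_simps)
    then have "L2_inner M (\<lambda>x. f x - ?b (c, z) x) (\<lambda>x. f x - ?b (c, z) x) \<le> D / real A"
      using z(2) by (simp only: norm_orthonormal_lincomb[OF e])
    then have "L2_dist M f (?b (c, z)) \<le> sqrt (D / real A)"
      unfolding L2_dist_norm L2_norm_def by (rule real_sqrt_le_mono)
    also have "\<dots> = 2 * sqrt (R / (real n * real A))"
      by (simp add: D_def real_sqrt_mult real_sqrt_divide)
    finally show ?thesis using c(1) z(1) by blast
  qed
  have "?B \<subseteq> L2_space M" using eL by (auto intro!: L2_space_lincomb)
  then show ?thesis
    unfolding L2_cover_def using C(1) Z(1) card near by (intro exI[of _ ?B]) auto
qed

section \<open>Hulls with coefficients on several levels\<close>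

lemma sum_pow2: "(\<Sum>l\<le>L. 2 ^ l) = 2 * 2 ^ L - (1 :: real)"
  by (induction L) simp_all

lemma sum_pow2_codepth: "(\<Sum>l\<le>L. 2 ^ l * real (L - l)) = 2 * 2 ^ L - real L - 2"
proof (induction L)
  case (Suc L)
  have "(\<Sum>l\<le>Suc L. 2 ^ l * real (Suc L - l)) = (\<Sum>l\<le>L. 2 ^ l * real (L - l)) + (\<Sum>l\<le>L. 2 ^ l)"
    unfolding sum.distrib[symmetric] by (auto simp: Suc_diff_le algebra_simps intro!: sum.cong)
  also have "\<dots> = (2 * 2 ^ L - real L - 2) + (2 * 2 ^ L - 1)" by (simp only: Suc sum_pow2)
  finally show ?case by simp
qed simp

lemma sum_inverse_pow2_codepth: "(\<Sum>l\<le>L. 1 / 2 ^ (L - l)) \<le> (2 :: real)"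
proof -
  have "(\<Sum>l\<le>L. 1 / 2 ^ (L - l)) = (\<Sum>l\<le>L. 2 ^ l) / (2 ^ L :: real)"
    unfolding sum_divide_distrib by (intro sum.cong) (auto simp: power_diff)
  also have "\<dots> \<le> 2" by (simp add: sum_pow2 field_simps)
  finally show ?thesis .
qed

lemma square_le_pow2: "L * L + 2 * L \<le> 4 * 2 ^ (L :: nat)"
proof -
  have "(L + 4) * (L + 4) + 2 * (L + 4) \<le> 4 * 2 ^ (L + 4)" for L :: nat
  proof (induction L)
    case (Suc L)
    then show ?case by (simp add: algebra_simps power_add)
  qed simp
  from this[of "L - 4"] show ?thesis
  proof (cases "4 \<le> L")
    case False
    then have "L = 0 \<or> L = 1 \<or> L = 2 \<or> L = 3" by linarith
    then show ?thesis by auto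
  qed simp
qed

text \<open>Here the atoms have coefficients of squared norm about \<open>P * 2 powr (- l * (2 * q - 1))\<close>
  in a block of dimension about \<open>P * 2 ^ l\<close>, for each level \<open>l\<close>. With about \<open>P * 2 ^ l / L\<close> steps on level \<open>l\<close>,
  Maurey's lemma costs at most \<open>P * 2 ^ l\<close> up to constants, as the logarithm of the number of atoms is of
  order \<open>L\<close>, and leaves an error \<open>sqrt L * 2 powr (- q * l)\<close>. On the last level and on the remainder, this
  is the desired accuracy. On a lower level the missing factor \<open>2 ^ (q * (L - l))\<close>, and a further
  \<open>2 ^ (L - l)\<close> that makes the errors summable, come from rounding; they cost \<open>L - l\<close> per dimension,
  which is harmless because the dimensions decrease geometrically in \<open>L - l\<close>.\<close>

lemma L2_cover_abs_hull_multilevel: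
  fixes g :: "'i \<Rightarrow> 'a \<Rightarrow> real" and e :: "'j \<Rightarrow> 'a \<Rightarrow> real" and lev :: "'j \<Rightarrow> nat"
  assumes I: "finite I" "I \<noteq> {}" and g: "\<And>i. i \<in> I \<Longrightarrow> g i \<in> L2_space M"
    and e: "orthonormal M e J" and lev: "\<And>j. j \<in> J \<Longrightarrow> lev j \<le> L"
    and q: "1 \<le> q" and L: "1 \<le> L" and P: "1 \<le> P" and B: "0 \<le> B" and a: "0 \<le> a"
    and atoms: "ln (2 * real (card I)) \<le> a * real L"
    and dim: "\<And>l. l \<le> L \<Longrightarrow> real (card {j \<in> J. lev j = l}) \<le> b * P * 2 ^ l"
    and coeff: "\<And>i l. i \<in> I \<Longrightarrow> l \<le> L \<Longrightarrow>
      (\<Sum>j | j \<in> J \<and> lev j = l. (L2_inner M (g i) (e j))\<^sup>2) \<le> B * P / 2 ^ (l * (2 * q - 1))"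
    and tail: "\<And>i. i \<in> I \<Longrightarrow> residual M e J (g i) \<le> B * P / 2 ^ (L * (2 * q - 1))"
  shows "L2_cover M (abs_hull g I) (6 * sqrt B * sqrt (real L) / 2 ^ (q * L))
           ((7 * a + (10 + 4 * real q) * b) * P * 2 ^ L)"
proof -
  let ?c = "\<lambda>i j. L2_inner M (g i) (e j)"
  let ?J = "\<lambda>l. {j \<in> J. lev j = l}"
  let ?Bs = "{\<beta> :: 'i \<Rightarrow> real. (\<Sum>i\<in>I. \<bar>\<beta> i\<bar>) \<le> 1}"
  have J: "finite J" and eL: "\<And>j. j \<in> J \<Longrightarrow> e j \<in> L2_space M" using e by (auto simp: orthonormal_def)
  have b: "0 \<le> b"
  proof (rule ccontr)
    assume "\<not> 0 \<le> b"
    then have "b * (P * 2 ^ L) < 0" using P by (intro mult_neg_pos) auto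
    then show False using dim[of L] by (simp add: mult.assoc)
  qed
  define n where "n = (\<lambda>l. nat \<lceil>P * 2 ^ l / real L\<rceil>)"
  have x0: "0 < P * 2 ^ l / real L" for l using P L by simp
  have n: "1 \<le> n l" "P * 2 ^ l / real L \<le> real (n l)" "real (n l) \<le> P * 2 ^ l / real L + 1" for l
  proof -
    show "1 \<le> n l" using x0[of l] by (simp add: n_def Suc_le_eq)
    show "P * 2 ^ l / real L \<le> real (n l)" unfolding n_def by linarith
    show "real (n l) \<le> P * 2 ^ l / real L + 1"
      using x0[of l] of_int_ceiling_le_add_one[of "P * 2 ^ l / real L"] by (simp add: n_def)
  qed
  have cost: "real (n l) * ln (2 * real (card I)) \<le> a * P * 2 ^ l + a * real L" for l
  proof -
    have "real (n l) * ln (2 * real (card I)) \<le> (P * 2 ^ l / real L + 1) * (a * real L)"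
      using n(3)[of l] a by (intro order_trans[OF mult_left_mono[OF atoms] mult_right_mono]) auto
    also have "\<dots> = a * P * 2 ^ l + a * real L" using L by (simp add: field_simps)
    finally show ?thesis .
  qed
  define F where "F = (\<lambda>l \<beta> x. \<Sum>i\<in>I. \<beta> i * (\<Sum>j\<in>?J l. ?c i j * e j x))"
  have F_hull: "F l ` ?Bs = abs_hull (\<lambda>i x. \<Sum>j\<in>?J l. ?c i j * e j x) I" for l
    by (auto simp: F_def abs_hull_def image_def)
  define t where "t = (\<lambda>i x. g i x - (\<Sum>j\<in>J. ?c i j * e j x))"
  have tL: "t i \<in> L2_space M" if "i \<in> I" for i
    unfolding t_def using g[OF that] eL by (intro L2_space_diff L2_space_lincomb)
  have FL: "F l \<beta> \<in> L2_space M" for l \<beta>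
    unfolding F_def using eL by (intro L2_space_lincomb) auto
  define \<epsilon> where "\<epsilon> = 2 * sqrt (B * real L) / 2 ^ (q * L)"
  have \<epsilon>0: "0 \<le> \<epsilon>" using B by (simp add: \<epsilon>_def)
  have level: "L2_cover M (F l ` ?Bs) (\<epsilon> * (1 / 2 ^ (L - l)))
      (a * P * 2 ^ l + a * real L + b * P * (3 * 2 ^ l + 2 * real (q + 1) * (2 ^ l * real (L - l))))"
    if l: "l \<le> L" for l
  proof -
    define k where "k = L - l"
    have Lk: "L = l + k" using l by (simp add: k_def)
    define A :: nat where "A = 4 ^ ((q + 1) * k)"
    have A: "1 \<le> A" by (simp add: A_def)
    have "L2_cover M (F l ` ?Bs) (2 * sqrt (B * P / 2 ^ (l * (2 * q - 1)) / (real (n l) * real A)))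
      (real (n l) * ln (2 * real (card I)) + real (card (?J l)) * ln (8 * real A))"
      unfolding F_hull
      by (rule L2_cover_abs_hull_finite_dim[OF I orthonormal_subset[OF e] coeff n(1) A]) (use l in auto)
    then show ?thesis
    proof (rule L2_cover_mono)
      have "B * P / 2 ^ (l * (2 * q - 1)) / (real (n l) * real A)
          \<le> B * P / 2 ^ (l * (2 * q - 1)) / (P * 2 ^ l / real L * real A)"
        using n(2)[of l] x0[of l] A B P by (intro divide_left_mono mult_right_mono mult_pos_pos) auto
      also have "\<dots> = B * real L / (2 ^ (l * (2 * q - 1)) * 2 ^ l * real A)"
        using P by (simp add: field_simps)
      also have "(2 ^ (l * (2 * q - 1)) * 2 ^ l * real A) = (2 ^ (q * L) * 2 ^ (L - l))\<^sup>2"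
      proof -
        have "l * (2 * q - 1) + l = 2 * (q * l)"
          using q by (cases q) (auto simp: algebra_simps)
        then have "2 ^ (l * (2 * q - 1)) * 2 ^ l = (2 :: real) ^ (2 * (q * l))"
          by (metis power_add)
        moreover have "real A = 2 ^ (2 * ((q + 1) * k))"
        proof -
          have "real A = (2 ^ 2) ^ ((q + 1) * k)" by (simp add: A_def)
          then show ?thesis by (simp only: power_mult)
        qed
        ultimately show ?thesis
          by (simp add: Lk power_add[symmetric] power_mult[symmetric] algebra_simps)
      qed
      finally have "sqrt (B * P / 2 ^ (l * (2 * q - 1)) / (real (n l) * real A))
          \<le> sqrt (B * real L / (2 ^ (q * L) * 2 ^ (L - l))\<^sup>2)"
        by (rule real_sqrt_le_mono)
      then show "2 * sqrt (B * P / 2 ^ (l * (2 * q - 1)) / (real (n l) * real A)) \<le> \<epsilon> * (1 / 2 ^ (L - l))"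
        by (simp add: \<epsilon>_def real_sqrt_divide)
      have "ln (8 * real A) = real (3 + 2 * ((q + 1) * k)) * ln 2"
      proof -
        have "8 * real A = 2 ^ (3 + 2 * ((q + 1) * k))"
        proof -
          have "8 * real A = 2 ^ 3 * (2 ^ 2) ^ ((q + 1) * k)" by (simp add: A_def)
          then show ?thesis by (simp only: power_mult power_add)
        qed
        then show ?thesis by (simp add: ln_realpow)
      qed
      also have "\<dots> \<le> real (3 + 2 * ((q + 1) * k)) * 1"
        using ln_2_less_1 by (intro mult_left_mono) auto
      also have "\<dots> = 3 + 2 * real (q + 1) * real k" by (simp add: algebra_simps)
      finally have lnA: "ln (8 * real A) \<le> 3 + 2 * real (q + 1) * real (L - l)"
        unfolding k_def .
      have "real (card (?J l)) * ln (8 * real A) \<le> (b * P * 2 ^ l) * (3 + 2 * real (q + 1) * real (L - l))"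
        using dim[OF l] lnA A b P by (intro mult_mono) auto
      also have "\<dots> = b * P * (3 * 2 ^ l + 2 * real (q + 1) * (2 ^ l * real (L - l)))"
        by (simp add: algebra_simps)
      finally show "real (n l) * ln (2 * real (card I)) + real (card (?J l)) * ln (8 * real A)
        \<le> a * P * 2 ^ l + a * real L + b * P * (3 * 2 ^ l + 2 * real (q + 1) * (2 ^ l * real (L - l)))"
        using cost[of l] by linarith
    qed
  qed
  have main: "L2_cover M ((\<lambda>\<beta> x. \<Sum>l\<le>L. F l \<beta> x) ` ?Bs) (\<Sum>l\<le>L. \<epsilon> * (1 / 2 ^ (L - l)))
    (\<Sum>l\<le>L. a * P * 2 ^ l + a * real L + b * P * (3 * 2 ^ l + 2 * real (q + 1) * (2 ^ l * real (L - l))))"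
    using level FL by (intro L2_cover_sum) auto
  have rest: "L2_cover M (abs_hull t I) \<epsilon> (a * P * 2 ^ L + a * real L)"
  proof (rule L2_cover_mono[OF L2_cover_abs_hull[OF I tL _ n(1)[of L]]])
    show "L2_inner M (t i) (t i) \<le> B * P / 2 ^ (L * (2 * q - 1))" if "i \<in> I" for i
      using tail[OF that] unfolding t_def norm_diff_projection[OF e g[OF that]] .
    show "real (n L) * ln (2 * real (card I)) \<le> a * P * 2 ^ L + a * real L" by (rule cost)
    have "B * P / 2 ^ (L * (2 * q - 1)) / real (n L) \<le> B * P / 2 ^ (L * (2 * q - 1)) / (P * 2 ^ L / real L)"
      using n(2)[of L] x0[of L] n(1)[of L] B P by (intro divide_left_mono mult_pos_pos) auto
    also have "\<dots> = B * real L / (2 ^ (L * (2 * q - 1)) * 2 ^ L)"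
      using P by (simp add: field_simps)
    also have "(2 ^ (L * (2 * q - 1)) * 2 ^ L :: real) = (2 ^ (q * L))\<^sup>2"
    proof -
      have "L * (2 * q - 1) + L = q * L * 2" using q by (cases q) (auto simp: algebra_simps)
      then show ?thesis by (metis power_add power_mult)
    qed
    finally show "2 * sqrt (B * P / 2 ^ (L * (2 * q - 1)) / real (n L)) \<le> \<epsilon>"
      using real_sqrt_le_mono by (fastforce simp: \<epsilon>_def real_sqrt_divide)
  qed auto
  have "L2_cover M (abs_hull g I) ((\<Sum>l\<le>L. \<epsilon> * (1 / 2 ^ (L - l))) + \<epsilon>)
    ((\<Sum>l\<le>L. a * P * 2 ^ l + a * real L + b * P * (3 * 2 ^ l + 2 * real (q + 1) * (2 ^ l * real (L - l))))
      + (a * P * 2 ^ L + a * real L))"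
  proof (rule L2_cover_add[OF main rest])
    show "(\<lambda>\<beta> x. \<Sum>l\<le>L. F l \<beta> x) ` ?Bs \<subseteq> L2_space M" using FL by (auto intro!: L2_space_sum)
    show "abs_hull t I \<subseteq> L2_space M" using tL by (auto simp: abs_hull_def intro!: L2_space_lincomb)
    fix f assume "f \<in> abs_hull g I"
    then obtain \<beta> where \<beta>: "f = (\<lambda>x. \<Sum>i\<in>I. \<beta> i * g i x)" "\<beta> \<in> ?Bs" by (auto simp: abs_hull_def)
    have "f x = (\<Sum>l\<le>L. F l \<beta> x) + (\<Sum>i\<in>I. \<beta> i * t i x)" for x
    proof -
      have "(\<Sum>l\<le>L. \<Sum>j\<in>?J l. ?c i j * e j x) = (\<Sum>j\<in>J. ?c i j * e j x)" for i
        using J lev by (intro sum.group) auto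
      moreover have "(\<Sum>l\<le>L. F l \<beta> x) = (\<Sum>i\<in>I. \<beta> i * (\<Sum>l\<le>L. \<Sum>j\<in>?J l. ?c i j * e j x))"
        unfolding F_def sum_distrib_left[of _ _ "{..L}"] by (rule sum.swap)
      ultimately show ?thesis by (simp add: \<beta>(1) t_def sum.distrib[symmetric] algebra_simps)
    qed
    then show "\<exists>u\<in>(\<lambda>\<beta> x. \<Sum>l\<le>L. F l \<beta> x) ` ?Bs. \<exists>w\<in>abs_hull t I. f = (\<lambda>x. u x + w x)"
      using \<beta>(2) by (intro bexI[of _ "\<lambda>x. \<Sum>l\<le>L. F l \<beta> x"] bexI[of _ "\<lambda>x. \<Sum>i\<in>I. \<beta> i * t i x"])
        (auto simp: abs_hull_def)
  qed
  then show ?thesis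
  proof (rule L2_cover_mono)
    have "(\<Sum>l\<le>L. \<epsilon> * (1 / 2 ^ (L - l))) \<le> \<epsilon> * 2"
      unfolding sum_distrib_left[symmetric] using sum_inverse_pow2_codepth \<epsilon>0 by (rule mult_left_mono)
    then show "(\<Sum>l\<le>L. \<epsilon> * (1 / 2 ^ (L - l))) + \<epsilon> \<le> 6 * sqrt B * sqrt (real L) / 2 ^ (q * L)"
      by (simp add: \<epsilon>_def real_sqrt_mult field_simps)
    let ?X = "P * 2 ^ L"
    have X: "0 < ?X" using P by simp
    have split: "(\<Sum>l\<le>L. x * 2 ^ l + y + z * (3 * 2 ^ l + w * s l))
        = x * (\<Sum>l\<le>L. 2 ^ l) + y * real (L + 1) + z * (3 * (\<Sum>l\<le>L. 2 ^ l) + w * (\<Sum>l\<le>L. s l))"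
      for x y z w :: real and s
      unfolding sum.distrib sum_distrib_left[symmetric] by simp
    have "(\<Sum>l\<le>L. a * P * 2 ^ l + a * real L + b * P * (3 * 2 ^ l + 2 * real (q + 1) * (2 ^ l * real (L - l))))
        = a * P * (\<Sum>l\<le>L. 2 ^ l) + a * real L * real (L + 1)
          + b * P * (3 * (\<Sum>l\<le>L. 2 ^ l) + 2 * real (q + 1) * (\<Sum>l\<le>L. 2 ^ l * real (L - l)))"
      by (rule split)
    also have "\<dots> \<le> a * P * (2 * 2 ^ L) + a * real L * real (L + 1)
        + b * P * (3 * (2 * 2 ^ L) + 2 * real (q + 1) * (2 * 2 ^ L))"
      using a b P unfolding sum_pow2 sum_pow2_codepth
      by (intro add_mono mult_left_mono order_refl mult_nonneg_nonneg) auto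
    also have "\<dots> = 2 * a * ?X + a * real (L * (L + 1)) + (10 + 4 * real q) * b * ?X"
      by (simp add: algebra_simps)
    finally have 1: "(\<Sum>l\<le>L. a * P * 2 ^ l + a * real L + b * P * (3 * 2 ^ l + 2 * real (q + 1) * (2 ^ l * real (L - l))))
      \<le> \<dots>" .
    have "real (L * L + 2 * L) \<le> real (4 * 2 ^ L)" using square_le_pow2 by (simp only: of_nat_le_iff)
    also have "\<dots> \<le> 4 * ?X" using P by simp
    finally have "a * real (L * L + 2 * L) \<le> a * (4 * ?X)" using a by (rule mult_left_mono)
    then have "a * real (L * (L + 1)) + a * real L \<le> 4 * a * ?X" by (simp add: algebra_simps)
    then show "(\<Sum>l\<le>L. a * P * 2 ^ l + a * real L + b * P * (3 * 2 ^ l + 2 * real (q + 1) * (2 ^ l * real (L - l))))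
      + (a * P * 2 ^ L + a * real L) \<le> (7 * a + (10 + 4 * real q) * b) * P * 2 ^ L"
      using 1 by (simp add: algebra_simps)
  qed
qed

section \<open>Truncated powers in one variable\<close>

lemma L2_space_bounded:
  assumes "finite_measure M" "f \<in> borel_measurable M" "\<And>x. x \<in> space M \<Longrightarrow> \<bar>f x\<bar> \<le> B"
  shows "f \<in> L2_space M"
proof -
  interpret finite_measure M by fact
  have "integrable M (\<lambda>x. (f x)\<^sup>2)"
  proof (rule integrable_const_bound[where B = "B\<^sup>2"])
    show "AE x in M. norm ((f x)\<^sup>2) \<le> B\<^sup>2"
    proof (rule AE_I2)
      fix x assume "x \<in> space M"
      then have "\<bar>f x\<bar>\<^sup>2 \<le> B\<^sup>2" using assms(3) by (intro power_mono) auto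
      then show "norm ((f x)\<^sup>2) \<le> B\<^sup>2" by simp
    qed
  qed (use assms in measurable)
  then show ?thesis using assms(2) by (simp add: L2_space_def)
qed

lemma space_unit_measure [simp]: "space unit_measure = {0..1}"
  by (simp add: unit_measure_def space_restrict_space)

lemma measure_space_unit_measure: "measure unit_measure {0..1} = 1"
  using emeasure_unit_measure by (simp add: measure_def)

lemma measurable_unit_measure: "f \<in> borel_measurable borel \<Longrightarrow> f \<in> borel_measurable unit_measure"
  unfolding unit_measure_def by (rule measurable_restrict_space1) simp

lemma psi_le_1: "0 \<le> v \<Longrightarrow> u \<le> 1 \<Longrightarrow> \<bar>psi q v u\<bar> \<le> 1"
  by (auto simp: psi_def trunc_pow_def abs_if power_le_one max_def)

lemma psi_L2:
  assumes "0 \<le> v"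
  shows "psi q v \<in> L2_space unit_measure"
proof (rule L2_space_bounded[OF finite_measure_unit_measure, where B = 1])
  show "psi q v \<in> borel_measurable unit_measure"
    by (rule measurable_unit_measure) (unfold psi_def[abs_def] trunc_pow_def, measurable)
qed (use assms psi_le_1 in auto)

lemma L2_inner_unit_le:
  assumes "f \<in> L2_space unit_measure" "\<And>u. u \<in> {0..1} \<Longrightarrow> (f u)\<^sup>2 \<le> B"
  shows "L2_inner unit_measure f f \<le> B"
proof -
  interpret finite_measure unit_measure by (rule finite_measure_unit_measure)
  have "L2_inner unit_measure f f \<le> (\<integral>u. B \<partial>unit_measure)"
    unfolding L2_inner_def using assms L2_inner_integrable[OF assms(1,1)]
    by (intro integral_mono) (auto simp: power2_eq_square)
  then show ?thesis by (simp add: measure_space_unit_measure)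
qed

text \<open>The functions that span the piecewise polynomials of degree less than \<open>q\<close> on the dyadic intervals
  of length \<open>2 powr (- k)\<close>.\<close>

definition dyadic_piece :: "nat \<Rightarrow> nat \<times> nat \<Rightarrow> real \<Rightarrow> real" where
  "dyadic_piece k = (\<lambda>(j, i) u. if real j / 2 ^ k \<le> u then u ^ i else 0)"

lemma dyadic_piece_L2: "dyadic_piece k p \<in> L2_space unit_measure"
proof (rule L2_space_bounded[OF finite_measure_unit_measure, where B = 1])
  show "dyadic_piece k p \<in> borel_measurable unit_measure"
    by (rule measurable_unit_measure) (unfold dyadic_piece_def case_prod_beta, measurable)
qed (auto simp: dyadic_piece_def case_prod_beta power_le_one)

text \<open>Cut \<open>psi q v\<close> off between \<open>v\<close> and the next dyadic point \<open>x\<close>. Both the length of this interval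
  and \<open>u - v\<close> on it are at most \<open>2 powr (- k)\<close>, whence the squared error.\<close>

lemma psi_dyadic_approximation:
  assumes q: "1 \<le> q" and v: "v \<in> {0..1}"
  shows "\<exists>a. L2_inner unit_measure
      (\<lambda>u. psi q v u - (\<Sum>p\<in>{..2 ^ k} \<times> {..<q}. a p * dyadic_piece k p u))
      (\<lambda>u. psi q v u - (\<Sum>p\<in>{..2 ^ k} \<times> {..<q}. a p * dyadic_piece k p u)) \<le> 1 / 2 ^ (k * (2 * q - 1))"
proof -
  define j0 where "j0 = nat \<lceil>v * 2 ^ k\<rceil>"
  define x where "x = real j0 / 2 ^ k"
  have vk: "0 \<le> v * 2 ^ k" "v * 2 ^ k \<le> 2 ^ k" using v by (auto simp: mult_left_le_one_le)
  have "real j0 = of_int \<lceil>v * 2 ^ k\<rceil>" using vk by (simp add: j0_def)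
  then have "v * 2 ^ k \<le> real j0" "real j0 \<le> v * 2 ^ k + 1" by linarith+
  then have x: "v \<le> x" "x \<le> v + 1 / 2 ^ k" by (auto simp: x_def field_simps)
  have "\<lceil>v * 2 ^ k\<rceil> \<le> 2 ^ k" using vk by (simp add: ceiling_le_iff)
  then have j0: "j0 \<le> 2 ^ k" by (simp add: j0_def nat_le_iff)
  then have x1: "x \<le> 1" by (simp add: x_def)
  define a where "a = (\<lambda>(j, i). if j = j0 then real (q - 1 choose i) * (- v) ^ (q - 1 - i) else 0)"
  define w where "w = (\<lambda>u. \<Sum>p\<in>{..2 ^ k} \<times> {..<q}. a p * dyadic_piece k p u)"
  have w: "w u = (if x \<le> u then (u - v) ^ (q - 1) else 0)" for u
  proof -
    have "w u = (\<Sum>j\<le>2 ^ k. \<Sum>i<q. a (j, i) * dyadic_piece k (j, i) u)"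
      by (simp add: w_def sum.cartesian_product)
    also have "\<dots> = (\<Sum>j\<le>2 ^ k. if j = j0 then \<Sum>i<q. a (j0, i) * dyadic_piece k (j0, i) u else 0)"
      by (intro sum.cong) (auto simp: a_def)
    also have "\<dots> = (\<Sum>i<q. a (j0, i) * dyadic_piece k (j0, i) u)" using j0 by simp
    also have "\<dots> = (if x \<le> u then \<Sum>i<q. real (q - 1 choose i) * u ^ i * (- v) ^ (q - 1 - i) else 0)"
      by (auto simp: a_def dyadic_piece_def x_def mult_ac intro!: sum.cong)
    also have "{..<q} = {..q - 1}" using q by auto
    also have "(\<Sum>i\<le>q - 1. real (q - 1 choose i) * u ^ i * (- v) ^ (q - 1 - i)) = (u - v) ^ (q - 1)"
      using binomial_ring[of u "- v" "q - 1"] by simp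
    finally show ?thesis .
  qed
  have le: "(psi q v u - w u) * (psi q v u - w u) \<le> (1 / 2 ^ k) ^ (2 * (q - 1)) * indicator {v..x} u" for u
  proof (cases "v \<le> u \<and> u < x")
    case True
    then have "psi q v u - w u = (u - v) ^ (q - 1)" by (auto simp: psi_def trunc_pow_def w max_def)
    then have "(psi q v u - w u) * (psi q v u - w u) = (u - v) ^ (2 * (q - 1))"
      by (simp add: power_add[symmetric] mult_2)
    also have "\<dots> \<le> (1 / 2 ^ k) ^ (2 * (q - 1))" using True x by (intro power_mono) auto
    finally show ?thesis using True by simp
  next
    case False
    then have "psi q v u - w u = 0" using x(1) by (auto simp: psi_def trunc_pow_def w max_def)
    then show ?thesis by simp
  qed
  have wL: "w \<in> L2_space unit_measure" unfolding w_def by (intro L2_space_lincomb dyadic_piece_L2)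
  have psiL: "psi q v \<in> L2_space unit_measure" using v by (intro psi_L2) simp
  have dL: "(\<lambda>u. psi q v u - w u) \<in> L2_space unit_measure" using psiL wL by (rule L2_space_diff)
  have int: "integrable unit_measure (indicator {v..x} :: real \<Rightarrow> real)"
  proof -
    interpret finite_measure unit_measure by (rule finite_measure_unit_measure)
    show ?thesis
      by (rule integrable_const_bound[where B = 1]) (auto intro!: measurable_unit_measure)
  qed
  have "L2_inner unit_measure (\<lambda>u. psi q v u - w u) (\<lambda>u. psi q v u - w u)
      \<le> (\<integral>u. (1 / 2 ^ k) ^ (2 * (q - 1)) * indicator {v..x} u \<partial>unit_measure)"
    unfolding L2_inner_def
    by (intro integral_mono le L2_inner_integrable[OF dL dL] integrable_mult_right int)
  also have "\<dots> = (1 / 2 ^ k) ^ (2 * (q - 1)) * (\<integral>u. indicator {v..x} u \<partial>unit_measure)" by simp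
  also have "(\<integral>u. (indicator {v..x} u :: real) \<partial>unit_measure) = x - v"
  proof -
    have "(\<integral>u. (indicator {v..x} u :: real) \<partial>unit_measure)
        = (\<integral>u. indicator {0..1} u *\<^sub>R (indicator {v..x} u :: real) \<partial>lborel)"
      unfolding unit_measure_def by (rule integral_restrict_space) simp
    also have "\<dots> = (\<integral>u. (indicator {v..x} u :: real) \<partial>lborel)"
      using v x1 by (intro Bochner_Integration.integral_cong) (auto simp: indicator_def)
    also have "\<dots> = x - v" using x by simp
    finally show ?thesis .
  qed
  also have "(1 / 2 ^ k) ^ (2 * (q - 1)) * (x - v) \<le> (1 / 2 ^ k) ^ (2 * (q - 1)) * (1 / 2 ^ k)"
    using x by (intro mult_left_mono) auto
  also have "\<dots> = (1 / 2 ^ k) ^ (2 * q - 1)"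
    using q by (cases q) auto
  also have "\<dots> = 1 / 2 ^ (k * (2 * q - 1))" by (simp add: power_divide power_mult)
  finally show ?thesis unfolding w_def by (intro exI[of _ a])
qed

text \<open>Level \<open>k + 1\<close> consists of the new functions that the Gram--Schmidt
  process needs to include the dyadic pieces of that scale. By Pythagoras, the squared coefficients of
  \<open>psi q v\<close> on this level sum to the decrease of the residual, so at most to the residual before.\<close>

lemma psi_multiresolution:
  assumes q: "1 \<le> q"
  shows "\<exists>E lev. orthonormal unit_measure (\<lambda>e. e) E \<and> (\<forall>e\<in>E. lev e \<le> L) \<and>
    (\<forall>k\<le>L. card {e \<in> E. lev e = k} \<le> 2 * q * 2 ^ k) \<and>
    (\<forall>v\<in>{0..1}. (\<forall>k\<le>L. (\<Sum>e | e \<in> E \<and> lev e = k. (L2_inner unit_measure (psi q v) e)\<^sup>2)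
          \<le> 2 ^ (2 * q - 1) / 2 ^ (k * (2 * q - 1))) \<and>
      residual unit_measure (\<lambda>e. e) E (psi q v) \<le> 1 / 2 ^ (L * (2 * q - 1)))"
proof -
  let ?r = "2 * q - 1"
  let ?U = "unit_measure"
  have ext: "\<exists>E'. E \<subseteq> E' \<and> orthonormal ?U (\<lambda>e. e) E' \<and> card (E' - E) \<le> 2 * q * 2 ^ k \<and>
    (\<forall>v\<in>{0..1}. residual ?U (\<lambda>e. e) E' (psi q v) \<le> 1 / 2 ^ (k * ?r))"
    if E: "orthonormal ?U (\<lambda>e. e) E" for E k
  proof -
    let ?K = "{..2 ^ k :: nat} \<times> {..<q}"
    obtain E' where E': "E \<subseteq> E'" "orthonormal ?U (\<lambda>e. e) E'" "card E' \<le> card E + card ?K"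
      "\<And>p. p \<in> ?K \<Longrightarrow> \<exists>c. L2_norm ?U (\<lambda>x. dyadic_piece k p x - (\<Sum>e\<in>E'. c e * e x)) = 0"
      using Gram_Schmidt[OF E, of ?K "dyadic_piece k"] dyadic_piece_L2 by auto
    have fin: "finite E" "finite E'" using E E'(2) by (auto simp: orthonormal_def)
    have "card (E' - E) = card E' - card E" using E'(1) fin by (intro card_Diff_subset)
    also have "\<dots> \<le> card ?K" using E'(3) by simp
    also have "\<dots> = (2 ^ k + 1) * q" by (simp add: card_cartesian_product)
    also have "\<dots> \<le> 2 * q * 2 ^ k" using one_le_power[of "2 :: nat" k] by (simp add: algebra_simps)
    finally have card: "card (E' - E) \<le> 2 * q * 2 ^ k" .
    have "residual ?U (\<lambda>e. e) E' (psi q v) \<le> 1 / 2 ^ (k * ?r)" if v: "v \<in> {0..1}" for v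
    proof -
      obtain a where a: "L2_inner ?U (\<lambda>u. psi q v u - (\<Sum>p\<in>?K. a p * dyadic_piece k p u))
        (\<lambda>u. psi q v u - (\<Sum>p\<in>?K. a p * dyadic_piece k p u)) \<le> 1 / 2 ^ (k * ?r)"
        using psi_dyadic_approximation[OF q v] by blast
      have "residual ?U (\<lambda>e. e) E' (psi q v)
        \<le> L2_inner ?U (\<lambda>u. psi q v u - (\<Sum>p\<in>?K. a p * dyadic_piece k p u))
          (\<lambda>u. psi q v u - (\<Sum>p\<in>?K. a p * dyadic_piece k p u))"
        using v E'(2,4) by (intro residual_le_spanned) (auto intro!: psi_L2 dyadic_piece_L2)
      then show ?thesis using a by linarith
    qed
    then show ?thesis using E' card by blast
  qed
  show ?thesis
  proof (induction L)
    case 0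
    have "orthonormal ?U (\<lambda>e. e) {}" by (simp add: orthonormal_def)
    from ext[OF this, of 0] obtain E where E: "orthonormal ?U (\<lambda>e. e) E" "card E \<le> 2 * q"
      "\<And>v. v \<in> {0..1} \<Longrightarrow> residual ?U (\<lambda>e. e) E (psi q v) \<le> 1" by auto
    have "(\<Sum>e\<in>E. (L2_inner ?U (psi q v) e)\<^sup>2) \<le> 2 ^ ?r" if v: "v \<in> {0..1}" for v
    proof -
      have L: "psi q v \<in> L2_space ?U" using v by (intro psi_L2) simp
      have "L2_inner ?U (psi q v) (psi q v) \<le> 1"
        using v psi_le_1[of v] by (intro L2_inner_unit_le[OF L]) (auto simp: abs_square_le_1)
      moreover have "(1 :: real) \<le> 2 ^ ?r" by simp
      ultimately show ?thesis using residual_nonneg[OF E(1) L] unfolding residual_def by linarith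
    qed
    then show ?case using E by (intro exI[of _ E] exI[of _ "\<lambda>_. 0"]) auto
  next
    case (Suc L)
    then obtain E lev where E: "orthonormal ?U (\<lambda>e. e) E" "\<And>e. e \<in> E \<Longrightarrow> lev e \<le> L"
      "\<And>k. k \<le> L \<Longrightarrow> card {e \<in> E. lev e = k} \<le> 2 * q * 2 ^ k"
      "\<And>v k. v \<in> {0..1} \<Longrightarrow> k \<le> L \<Longrightarrow> (\<Sum>e | e \<in> E \<and> lev e = k. (L2_inner ?U (psi q v) e)\<^sup>2)
          \<le> 2 ^ ?r / 2 ^ (k * ?r)"
      "\<And>v. v \<in> {0..1} \<Longrightarrow> residual ?U (\<lambda>e. e) E (psi q v) \<le> 1 / 2 ^ (L * ?r)" by blast
    obtain E' where E': "E \<subseteq> E'" "orthonormal ?U (\<lambda>e. e) E'" "card (E' - E) \<le> 2 * q * 2 ^ Suc L"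
      "\<And>v. v \<in> {0..1} \<Longrightarrow> residual ?U (\<lambda>e. e) E' (psi q v) \<le> 1 / 2 ^ (Suc L * ?r)"
      using ext[OF E(1), of "Suc L"] by blast
    define lev' where "lev' = (\<lambda>e. if e \<in> E then lev e else Suc L)"
    have old: "{e \<in> E'. lev' e = k} = {e \<in> E. lev e = k}" if "k \<le> L" for k
      using that E'(1) by (auto simp: lev'_def)
    have new: "{e \<in> E'. lev' e = Suc L} = E' - E"
      using E(2) by (force simp: lev'_def)
    have coeff: "(\<Sum>e\<in>E' - E. (L2_inner ?U (psi q v) e)\<^sup>2) \<le> 2 ^ ?r / 2 ^ (Suc L * ?r)"
      if v: "v \<in> {0..1}" for v
    proof -
      have L: "psi q v \<in> L2_space ?U" using v by (intro psi_L2) simp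
      have "(\<Sum>e\<in>E' - E. (L2_inner ?U (psi q v) e)\<^sup>2)
        = residual ?U (\<lambda>e. e) E (psi q v) - residual ?U (\<lambda>e. e) E' (psi q v)"
        using E' by (simp add: residual_def sum_diff orthonormal_def)
      also have "\<dots> \<le> 1 / 2 ^ (L * ?r)" using E(5)[OF v] residual_nonneg[OF E'(2) L] by linarith
      also have "\<dots> = 2 ^ ?r / 2 ^ (Suc L * ?r)" by (simp add: power_add)
      finally show ?thesis .
    qed
    have "card {e \<in> E'. lev' e = k} \<le> 2 * q * 2 ^ k" if "k \<le> Suc L" for k
      using that E(3)[of k] E'(3) by (cases "k = Suc L") (simp_all only: new old le_Suc_eq simp_thms)
    moreover have "(\<Sum>e | e \<in> E' \<and> lev' e = k. (L2_inner ?U (psi q v) e)\<^sup>2) \<le> 2 ^ ?r / 2 ^ (k * ?r)"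
      if "v \<in> {0..1}" "k \<le> Suc L" for v k
      using that E(4)[of v k] coeff[of v] by (cases "k = Suc L") (simp_all only: new old le_Suc_eq simp_thms)
    moreover have "lev' e \<le> Suc L" for e
      using E(2)[of e] by (auto simp: lev'_def)
    ultimately show ?case using E'(2,4) by (intro exI[of _ E'] exI[of _ lev']) blast
  qed
qed

text \<open>The parameter \<open>v\<close> enters Lipschitz continuously for \<open>q \<ge> 2\<close>, but for \<open>q = 1\<close> only in the
  \<open>L\<^sub>2\<close>-norm and with exponent one half.\<close>

lemma psi_Lipschitz:
  assumes q: "2 \<le> q" and "v \<in> {0..1}" "w \<in> {0..1}" "u \<in> {0..1}"
  shows "\<bar>psi q v u - psi q w u\<bar> \<le> real (q - 1) * \<bar>v - w\<bar>"
proof -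
  let ?a = "max (u - v) 0" and ?b = "max (u - w) 0"
  have "\<bar>?a ^ (q - 1) - ?b ^ (q - 1)\<bar> \<le> real (q - 1) * \<bar>?a - ?b\<bar>"
    using norm_power_diff[of ?a ?b "q - 1"] assms by auto
  also have "\<dots> \<le> real (q - 1) * \<bar>v - w\<bar>" by (intro mult_left_mono) auto
  finally show ?thesis using q by (simp add: psi_def trunc_pow_def)
qed

lemma psi_Hoelder_L2:
  assumes q: "1 \<le> q" and v: "v \<in> {0..1}" and w: "w \<in> {0..1}"
  shows "L2_norm unit_measure (\<lambda>u. psi q v u - psi q w u) \<le> real q * sqrt \<bar>v - w\<bar>"
proof (cases "q = 1")
  case True
  have *: "L2_norm unit_measure (\<lambda>u. psi 1 v u - psi 1 w u) = sqrt (w - v)"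
    if "v \<le> w" "v \<in> {0..1}" "w \<in> {0..1}" for v w
    using integral_psi_1_diff[of v w] that by (simp add: L2_norm_def L2_inner_def power2_eq_square)
  have "L2_norm unit_measure (\<lambda>u. psi 1 v u - psi 1 w u) = sqrt \<bar>v - w\<bar>"
  proof (cases "v \<le> w")
    case False
    have "L2_norm unit_measure (\<lambda>u. psi 1 v u - psi 1 w u) = L2_norm unit_measure (\<lambda>u. psi 1 w u - psi 1 v u)"
      using L2_dist_commute[of unit_measure "psi 1 v" "psi 1 w"] by (simp only: L2_dist_norm)
    then show ?thesis using *[of w v] False v w by simp
  qed (use * v w in simp)
  then show ?thesis using True by simp
next
  case False
  have L: "(\<lambda>u. psi q v u - psi q w u) \<in> L2_space unit_measure"
    using v w by (intro L2_space_diff psi_L2) auto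
  have le1: "\<bar>v - w\<bar> \<le> 1" using v w by auto
  have "(psi q v u - psi q w u)\<^sup>2 \<le> (real q * sqrt \<bar>v - w\<bar>)\<^sup>2" if "u \<in> {0..1}" for u
  proof -
    have "\<bar>psi q v u - psi q w u\<bar> \<le> real (q - 1) * \<bar>v - w\<bar>"
      using False q v w that by (intro psi_Lipschitz) auto
    also have "\<dots> \<le> real q * sqrt \<bar>v - w\<bar>"
    proof (intro mult_mono)
      have "\<bar>v - w\<bar> * \<bar>v - w\<bar> \<le> \<bar>v - w\<bar> * 1" using le1 by (intro mult_left_mono) auto
      then show "\<bar>v - w\<bar> \<le> sqrt \<bar>v - w\<bar>" by (intro real_le_rsqrt) (simp add: power2_eq_square)
    qed auto
    finally show ?thesis by (simp add: abs_le_square_iff[symmetric])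
  qed
  then show ?thesis by (subst L2_norm_le_iff) (auto intro!: L2_inner_unit_le[OF L])
qed

section \<open>Tensor products\<close>

definition tensor :: "nat \<Rightarrow> (nat \<Rightarrow> real \<Rightarrow> real) \<Rightarrow> (nat \<Rightarrow> real) \<Rightarrow> real" where
  "tensor d f u = (\<Prod>i<d. f i (u i))"

lemma product_sigma_finite_unit: "product_sigma_finite (\<lambda>_ :: nat. unit_measure)"
  unfolding product_sigma_finite_def
  using finite_measure.axioms(1)[OF finite_measure_unit_measure] by blast

lemma L2_inner_tensor:
  assumes "\<And>i. i < d \<Longrightarrow> f i \<in> L2_space unit_measure" "\<And>i. i < d \<Longrightarrow> g i \<in> L2_space unit_measure"
  shows "L2_inner (cube_measure d) (tensor d f) (tensor d g) = (\<Prod>i<d. L2_inner unit_measure (f i) (g i))"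
proof -
  interpret product_sigma_finite "\<lambda>_ :: nat. unit_measure" by (rule product_sigma_finite_unit)
  show ?thesis
    unfolding L2_inner_def cube_measure_def tensor_def prod.distrib[symmetric]
    using assms by (intro product_integral_prod L2_inner_integrable) auto
qed

lemma tensor_L2:
  assumes "\<And>i. i < d \<Longrightarrow> f i \<in> L2_space unit_measure"
  shows "tensor d f \<in> L2_space (cube_measure d)"
proof -
  interpret product_sigma_finite "\<lambda>_ :: nat. unit_measure" by (rule product_sigma_finite_unit)
  have "integrable (cube_measure d) (\<lambda>u. (tensor d f u)\<^sup>2)"
    unfolding cube_measure_def tensor_def power2_eq_square prod.distrib[symmetric]
    using assms by (intro product_integrable_prod L2_inner_integrable) auto
  moreover have "tensor d f \<in> borel_measurable (cube_measure d)"
    unfolding cube_measure_def tensor_def[abs_def]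
  proof (rule borel_measurable_prod)
    fix i assume "i \<in> {..<d}"
    then have "f i \<in> borel_measurable unit_measure" using assms L2_spaceD by blast
    then show "(\<lambda>u. f i (u i)) \<in> borel_measurable (Pi\<^sub>M {..<d} (\<lambda>_. unit_measure))"
      using \<open>i \<in> {..<d}\<close> by (rule measurable_compose[OF measurable_component_singleton, rotated])
  qed
  ultimately show ?thesis by (simp add: L2_space_def)
qed

lemma L2_norm_tensor:
  assumes "\<And>i. i < d \<Longrightarrow> f i \<in> L2_space unit_measure"
  shows "L2_norm (cube_measure d) (tensor d f) = (\<Prod>i<d. L2_norm unit_measure (f i))"
proof -
  have "sqrt (\<Prod>i<n. a i) = (\<Prod>i<n. sqrt (a i))" for n and a :: "nat \<Rightarrow> real"
    by (induction n) (simp_all add: real_sqrt_mult)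
  then show ?thesis unfolding L2_norm_def using assms by (simp add: L2_inner_tensor)
qed

text \<open>Replace the factors one at a time; in each step, the norms of the other factors are at most one.\<close>

lemma L2_dist_tensor_le:
  assumes f: "\<And>i. i < d \<Longrightarrow> f i \<in> L2_space unit_measure" "\<And>i. i < d \<Longrightarrow> L2_norm unit_measure (f i) \<le> 1"
    and g: "\<And>i. i < d \<Longrightarrow> g i \<in> L2_space unit_measure" "\<And>i. i < d \<Longrightarrow> L2_norm unit_measure (g i) \<le> 1"
  shows "L2_dist (cube_measure d) (tensor d f) (tensor d g) \<le> (\<Sum>i<d. L2_dist unit_measure (f i) (g i))"
proof -
  define h where "h = (\<lambda>n. tensor d (\<lambda>i. if i < n then g i else f i))"
  have hL: "h n \<in> L2_space (cube_measure d)" for n unfolding h_def using f g by (intro tensor_L2) auto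
  have "L2_dist (cube_measure d) (h 0) (h n) \<le> (\<Sum>i<n. L2_dist unit_measure (f i) (g i))" if "n \<le> d" for n
    using that
  proof (induction n)
    case 0
    then show ?case by (simp add: L2_dist_norm)
  next
    case (Suc n)
    define k where "k = (\<lambda>i. if i < n then g i else if i = n then (\<lambda>x. f n x - g n x) else f i)"
    have kL: "k i \<in> L2_space unit_measure" if "i < d" for i
      unfolding k_def using f g that by (auto intro!: L2_space_diff)
    have "h n u - h (Suc n) u = tensor d k u" for u
    proof -
      have split: "(\<Prod>i<d. G i) = G n * (\<Prod>i\<in>{..<d} - {n}. G i)" for G :: "nat \<Rightarrow> real"
        using Suc.prems by (intro prod.remove) auto
      have "(\<Prod>i\<in>{..<d} - {n}. (if i < Suc n then g i else f i) (u i))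
          = (\<Prod>i\<in>{..<d} - {n}. (if i < n then g i else f i) (u i))"
        and "(\<Prod>i\<in>{..<d} - {n}. k i (u i)) = (\<Prod>i\<in>{..<d} - {n}. (if i < n then g i else f i) (u i))"
        by (intro prod.cong; auto simp: k_def)+
      then show ?thesis
        unfolding h_def tensor_def split by (simp add: k_def left_diff_distrib)
    qed
    then have "L2_dist (cube_measure d) (h n) (h (Suc n)) = (\<Prod>i<d. L2_norm unit_measure (k i))"
      using L2_norm_tensor[OF kL] by (simp add: L2_dist_norm)
    also have "\<dots> = L2_norm unit_measure (k n) * (\<Prod>i\<in>{..<d} - {n}. L2_norm unit_measure (k i))"
      using Suc.prems by (intro prod.remove) auto
    also have "\<dots> \<le> L2_norm unit_measure (k n) * 1"
      using f g by (intro mult_left_mono prod_le_1) (auto simp: k_def)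
    also have "\<dots> = L2_dist unit_measure (f n) (g n)" by (simp add: k_def L2_dist_norm)
    finally show ?case
      using Suc L2_dist_triangle[OF hL[of 0] hL[of n] hL[of "Suc n"]] by simp
  qed
  moreover have "h 0 = tensor d f" "h d = tensor d g"
    by (auto simp: h_def tensor_def fun_eq_iff intro!: prod.cong)
  ultimately show ?thesis by (metis order_refl)
qed

lemma orthonormal_tensor:
  assumes E: "orthonormal unit_measure (\<lambda>e. e) E" and J: "J \<subseteq> {..<d} \<rightarrow>\<^sub>E E"
  shows "orthonormal (cube_measure d) (tensor d) J"
proof -
  have finE: "finite E" and EL: "\<And>e. e \<in> E \<Longrightarrow> e \<in> L2_space unit_measure"
    and EE: "\<And>e e'. e \<in> E \<Longrightarrow> e' \<in> E \<Longrightarrow> L2_inner unit_measure e e' = (if e = e' then 1 else 0)"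
    using E by (auto simp: orthonormal_def)
  have mem: "\<eta> i \<in> E" if "\<eta> \<in> J" "i < d" for \<eta> i using that J by (auto simp: PiE_iff)
  have "finite J" using J finE by (meson finite_PiE finite_lessThan finite_subset)
  moreover have "L2_inner (cube_measure d) (tensor d \<eta>) (tensor d \<theta>) = (if \<eta> = \<theta> then 1 else 0)"
    if "\<eta> \<in> J" "\<theta> \<in> J" for \<eta> \<theta>
  proof -
    have eq: "L2_inner (cube_measure d) (tensor d \<eta>) (tensor d \<theta>) = (\<Prod>i<d. if \<eta> i = \<theta> i then 1 else 0)"
      using that mem EL by (subst L2_inner_tensor) (auto simp: EE intro!: prod.cong)
    show ?thesis
    proof (cases "\<eta> = \<theta>")
      case False
      have "\<exists>i<d. \<eta> i \<noteq> \<theta> i"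
      proof (rule ccontr)
        assume "\<not> ?thesis"
        then have "\<eta> = \<theta>" using that J by (intro PiE_ext[of \<eta> "{..<d}" "\<lambda>_. E" \<theta>]) auto
        then show False using False by simp
      qed
      then have "(\<Prod>i<d. if \<eta> i = \<theta> i then 1 else 0 :: real) = 0" by (intro prod_zero) auto
      then show ?thesis using False unfolding eq by simp
    next
      case True
      then show ?thesis unfolding eq by simp
    qed
  qed
  moreover have "tensor d \<eta> \<in> L2_space (cube_measure d)" if "\<eta> \<in> J" for \<eta>
    using that mem EL by (intro tensor_L2) auto
  ultimately show ?thesis by (auto simp: orthonormal_def)
qed

section \<open>Hyperbolic cross sums\<close>

definition compositions :: "nat \<Rightarrow> nat \<Rightarrow> (nat \<Rightarrow> nat) set" where
  "compositions d l = {\<kappa> \<in> {..<d} \<rightarrow>\<^sub>E UNIV. (\<Sum>i<d. \<kappa> i) = l}"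

lemma compositions_le: "\<kappa> \<in> compositions d l \<Longrightarrow> i < d \<Longrightarrow> \<kappa> i \<le> l"
  using member_le_sum[of i "{..<d}" \<kappa>] by (auto simp: compositions_def)

lemma finite_compositions: "finite (compositions d l)"
proof (rule finite_subset)
  show "compositions d l \<subseteq> {..<d} \<rightarrow>\<^sub>E {..l}"
  proof
    fix \<kappa> assume "\<kappa> \<in> compositions d l"
    then show "\<kappa> \<in> {..<d} \<rightarrow>\<^sub>E {..l}"
      using compositions_le[of \<kappa> d l] by (simp add: compositions_def PiE_iff)
  qed
qed (auto intro: finite_PiE)

text \<open>All entries but the last one determine a composition.\<close>

lemma card_compositions:
  assumes "1 \<le> d"
  shows "card (compositions d l) \<le> (l + 1) ^ (d - 1)"
proof -
  obtain n where d: "d = Suc n" using assms by (cases d) auto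
  have "inj_on (\<lambda>\<kappa>. restrict \<kappa> {..<n}) (compositions d l)"
  proof (rule inj_onI)
    fix \<kappa> \<mu> assume \<kappa>: "\<kappa> \<in> compositions d l" and \<mu>: "\<mu> \<in> compositions d l"
      and eq: "restrict \<kappa> {..<n} = restrict \<mu> {..<n}"
    have less: "\<kappa> i = \<mu> i" if "i < n" for i using fun_cong[OF eq, of i] that by simp
    then have "(\<Sum>i<n. \<kappa> i) = (\<Sum>i<n. \<mu> i)" by simp
    moreover have "(\<Sum>i<n. \<kappa> i) + \<kappa> n = (\<Sum>i<n. \<mu> i) + \<mu> n"
      using \<kappa> \<mu> by (simp add: compositions_def d)
    ultimately have "\<kappa> n = \<mu> n" by simp
    then have "\<kappa> i = \<mu> i" if "i < d" for i using less that by (auto simp: d less_Suc_eq)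
    then show "\<kappa> = \<mu>" using \<kappa> \<mu> by (intro PiE_ext) (auto simp: compositions_def)
  qed
  moreover have "(\<lambda>\<kappa>. restrict \<kappa> {..<n}) ` compositions d l \<subseteq> {..<n} \<rightarrow>\<^sub>E {..l}"
  proof (rule image_subsetI)
    fix \<kappa> assume "\<kappa> \<in> compositions d l"
    then show "restrict \<kappa> {..<n} \<in> {..<n} \<rightarrow>\<^sub>E {..l}"
      using compositions_le[of \<kappa> d l] by (intro restrict_PiE_iff[THEN iffD2]) (simp add: d)
  qed
  ultimately have "card (compositions d l) \<le> card ({..<n} \<rightarrow>\<^sub>E {..l})"
    by (intro card_inj_on_le) (auto intro: finite_PiE)
  then show ?thesis by (simp add: card_PiE d)
qed

lemma sum_prod_level:
  fixes h :: "nat \<Rightarrow> 'e \<Rightarrow> 'c :: comm_semiring_1" and lev :: "'e \<Rightarrow> nat"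
  assumes E: "finite E"
  shows "(\<Sum>\<eta> | \<eta> \<in> {..<d} \<rightarrow>\<^sub>E E \<and> (\<Sum>i<d. lev (\<eta> i)) = l. \<Prod>i<d. h i (\<eta> i))
       = (\<Sum>\<kappa>\<in>compositions d l. \<Prod>i<d. \<Sum>e | e \<in> E \<and> lev e = \<kappa> i. h i e)"
proof -
  let ?S = "{\<eta> \<in> {..<d} \<rightarrow>\<^sub>E E. (\<Sum>i<d. lev (\<eta> i)) = l}"
  let ?g = "\<lambda>\<eta>. \<lambda>i\<in>{..<d}. lev (\<eta> i)"
  have fin: "finite ?S"
    by (rule finite_subset[of _ "{..<d} \<rightarrow>\<^sub>E E"]) (use E in \<open>auto intro: finite_PiE\<close>)
  have "(\<Sum>\<eta>\<in>?S. \<Prod>i<d. h i (\<eta> i)) = (\<Sum>\<kappa>\<in>compositions d l. \<Sum>\<eta> | \<eta> \<in> ?S \<and> ?g \<eta> = \<kappa>. \<Prod>i<d. h i (\<eta> i))"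
    by (rule sum.group[symmetric]) (use fin finite_compositions in \<open>auto simp: compositions_def\<close>)
  also have "\<dots> = (\<Sum>\<kappa>\<in>compositions d l. \<Prod>i<d. \<Sum>e | e \<in> E \<and> lev e = \<kappa> i. h i e)"
  proof (rule sum.cong)
    fix \<kappa> assume \<kappa>: "\<kappa> \<in> compositions d l"
    have "{\<eta>. \<eta> \<in> ?S \<and> ?g \<eta> = \<kappa>} = (\<Pi>\<^sub>E i\<in>{..<d}. {e \<in> E. lev e = \<kappa> i})"
    proof (intro set_eqI iffI)
      fix \<eta> assume "\<eta> \<in> {\<eta>. \<eta> \<in> ?S \<and> ?g \<eta> = \<kappa>}"
      then show "\<eta> \<in> (\<Pi>\<^sub>E i\<in>{..<d}. {e \<in> E. lev e = \<kappa> i})" by (auto simp: PiE_iff)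
    next
      fix \<eta> assume \<eta>: "\<eta> \<in> (\<Pi>\<^sub>E i\<in>{..<d}. {e \<in> E. lev e = \<kappa> i})"
      then have "?g \<eta> = \<kappa>"
        using \<kappa> by (intro ext) (auto simp: compositions_def PiE_iff extensional_def restrict_def)
      moreover have "(\<Sum>i<d. lev (\<eta> i)) = l" using \<eta> \<kappa> by (simp add: compositions_def PiE_iff)
      ultimately show "\<eta> \<in> {\<eta>. \<eta> \<in> ?S \<and> ?g \<eta> = \<kappa>}" using \<eta> by (auto simp: PiE_iff)
    qed
    then show "(\<Sum>\<eta> | \<eta> \<in> ?S \<and> ?g \<eta> = \<kappa>. \<Prod>i<d. h i (\<eta> i)) = (\<Prod>i<d. \<Sum>e | e \<in> E \<and> lev e = \<kappa> i. h i e)"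
      using E by (simp only:) (subst prod_sum_PiE, auto)
  qed simp
  finally show ?thesis .
qed

text \<open>From \<open>y ^ p \<le> fact p * exp y\<close> at \<open>y = (m + 1) / 3\<close>, the terms are dominated by a geometric
  series with ratio \<open>exp (1 / 3) / 2\<close>, which is less than one because \<open>exp 1 < 8\<close>.\<close>

lemma polynomial_geometric_sum_bounded:
  "\<exists>S\<ge>1. \<forall>N. (\<Sum>m\<le>N. real (m + 1) ^ p / 2 ^ m) \<le> S"
proof -
  have le: "real (m + 1) ^ p / 2 ^ m \<le> (fact p * 3 ^ p * exp (1 / 3)) * (exp (1 / 3) / 2) ^ m" for m
  proof -
    let ?x = "real (m + 1) / 3"
    have "x ^ p / fact p \<le> exp x" if "0 \<le> x" for x :: real
    proof -
      have "(\<Sum>n\<in>{p}. x ^ n /\<^sub>R fact n) \<le> (\<Sum>n. x ^ n /\<^sub>R fact n)"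
        using that by (intro sum_le_suminf summable_exp_generic) auto
      then show ?thesis unfolding exp_def by (simp add: divide_inverse mult.commute)
    qed
    then have "?x ^ p / fact p \<le> exp ?x" by simp
    then have "?x ^ p \<le> exp ?x * fact p" by (subst (asm) pos_divide_le_eq) auto
    then have "real (m + 1) ^ p / 3 ^ p \<le> exp ?x * fact p" unfolding power_divide .
    then have "real (m + 1) ^ p \<le> exp ?x * fact p * 3 ^ p" by (subst (asm) pos_divide_le_eq) auto
    then have "real (m + 1) ^ p \<le> fact p * 3 ^ p * exp ?x" by (simp only: mult_ac)
    also have "exp ?x = exp (1 / 3) * exp (1 / 3) ^ m"
      by (simp add: exp_of_nat_mult[symmetric] exp_add[symmetric] add_divide_distrib)
    finally show ?thesis by (simp add: field_simps power_divide)
  qed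
  have "exp (1 :: real) < 2 ^ 3" using exp_le by simp
  moreover have "exp (1 :: real) = exp (1 / 3) ^ 3" by (simp add: exp_of_nat_mult[symmetric])
  ultimately have "exp (1 / 3 :: real) ^ 3 < 2 ^ 3" by (simp only:)
  then have "exp (1 / 3 :: real) < 2" by (rule power_less_imp_less_base) simp
  then have q: "norm (exp (1 / 3) / 2 :: real) < 1" by simp
  let ?C = "fact p * 3 ^ p * exp (1 / 3) :: real"
  have "(\<Sum>m\<le>N. real (m + 1) ^ p / 2 ^ m) \<le> ?C * (1 / (1 - exp (1 / 3) / 2))" for N
  proof -
    have "(\<Sum>m\<le>N. real (m + 1) ^ p / 2 ^ m) \<le> (\<Sum>m\<le>N. ?C * (exp (1 / 3) / 2) ^ m)"
      by (intro sum_mono le)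
    also have "\<dots> = ?C * (\<Sum>m\<le>N. (exp (1 / 3) / 2) ^ m)" by (rule sum_distrib_left[symmetric])
    also have "\<dots> \<le> ?C * (\<Sum>m. (exp (1 / 3) / 2) ^ m)"
      using q by (intro mult_left_mono sum_le_suminf summable_geometric) auto
    also have "\<dots> = ?C * (1 / (1 - exp (1 / 3) / 2))" using suminf_geometric[OF q] by simp
    finally show ?thesis .
  qed
  then show ?thesis
    by (intro exI[of _ "max 1 (?C * (1 / (1 - exp (1 / 3) / 2)))"]) (auto simp: max.coboundedI2)
qed

text \<open>If the coefficients of each factor decay as \<open>2 powr (- k * r)\<close> over the levels \<open>k\<close>, then so do
  those of the tensor product over the levels \<open>l\<close>, up to the number of compositions of \<open>l\<close>.\<close>

lemma tensor_coefficients: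
  assumes E: "orthonormal unit_measure (\<lambda>e. e) E" and d: "1 \<le> d" and l: "l \<le> L" and C: "0 \<le> C"
    and f: "\<And>i. i < d \<Longrightarrow> f i \<in> L2_space unit_measure"
    and coeff: "\<And>i k. i < d \<Longrightarrow> k \<le> L \<Longrightarrow>
      (\<Sum>e | e \<in> E \<and> lev e = k. (L2_inner unit_measure (f i) e)\<^sup>2) \<le> C / 2 ^ (k * r)"
  shows "(\<Sum>\<eta> | \<eta> \<in> {..<d} \<rightarrow>\<^sub>E E \<and> (\<Sum>i<d. lev (\<eta> i)) = l.
      (L2_inner (cube_measure d) (tensor d f) (tensor d \<eta>))\<^sup>2) \<le> C ^ d * real (L + 1) ^ (d - 1) / 2 ^ (l * r)"
proof -
  have finE: "finite E" and EL: "\<And>e. e \<in> E \<Longrightarrow> e \<in> L2_space unit_measure"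
    using E by (auto simp: orthonormal_def)
  have "(\<Sum>\<eta> | \<eta> \<in> {..<d} \<rightarrow>\<^sub>E E \<and> (\<Sum>i<d. lev (\<eta> i)) = l.
      (L2_inner (cube_measure d) (tensor d f) (tensor d \<eta>))\<^sup>2)
    = (\<Sum>\<eta> | \<eta> \<in> {..<d} \<rightarrow>\<^sub>E E \<and> (\<Sum>i<d. lev (\<eta> i)) = l.
      \<Prod>i<d. (L2_inner unit_measure (f i) (\<eta> i))\<^sup>2)"
    using f EL by (intro sum.cong) (auto simp: PiE_iff L2_inner_tensor prod_power_distrib)
  also have "\<dots> = (\<Sum>\<kappa>\<in>compositions d l. \<Prod>i<d. \<Sum>e | e \<in> E \<and> lev e = \<kappa> i. (L2_inner unit_measure (f i) e)\<^sup>2)"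
    by (rule sum_prod_level[OF finE])
  also have "\<dots> \<le> (\<Sum>\<kappa>\<in>compositions d l. C ^ d / 2 ^ (l * r))"
  proof (rule sum_mono)
    fix \<kappa> assume \<kappa>: "\<kappa> \<in> compositions d l"
    have "(\<Prod>i<d. \<Sum>e | e \<in> E \<and> lev e = \<kappa> i. (L2_inner unit_measure (f i) e)\<^sup>2)
      \<le> (\<Prod>i<d. C / 2 ^ (\<kappa> i * r))"
      using compositions_le[OF \<kappa>] l by (intro prod_mono conjI coeff sum_nonneg) (auto intro: order_trans)
    also have "\<dots> = C ^ d / 2 ^ (l * r)"
      using \<kappa> by (simp add: prod_dividef power_sum[symmetric] sum_distrib_right[symmetric] compositions_def)
    finally show "(\<Prod>i<d. \<Sum>e | e \<in> E \<and> lev e = \<kappa> i. (L2_inner unit_measure (f i) e)\<^sup>2) \<le> C ^ d / 2 ^ (l * r)" .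
  qed
  also have "\<dots> = real (card (compositions d l)) * (C ^ d / 2 ^ (l * r))" by simp
  also have "\<dots> \<le> real (L + 1) ^ (d - 1) * (C ^ d / 2 ^ (l * r))"
  proof (intro mult_right_mono)
    have "card (compositions d l) \<le> (L + 1) ^ (d - 1)"
      using card_compositions[OF d, of l] power_mono[of "l + 1" "L + 1" "d - 1"] l by linarith
    then show "real (card (compositions d l)) \<le> real (L + 1) ^ (d - 1)"
      by (metis of_nat_le_iff of_nat_power)
  qed (use C in simp)
  finally show ?thesis by (simp add: mult.commute)
qed

text \<open>Treat the residual of each factor as the coefficients on one more level \<open>L + 1\<close>. Then the squared
  norm of the tensor product is the sum, over all multi-indices of levels, of the products of these numbers,
  and the terms with level sum at most \<open>L\<close> belong to the hyperbolic cross.\<close>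

lemma tensor_residual:
  assumes E: "orthonormal unit_measure (\<lambda>e. e) E" and d: "1 \<le> d" and r: "1 \<le> r" and C: "0 \<le> C"
    and lev: "\<And>e. e \<in> E \<Longrightarrow> lev e \<le> L"
    and f: "\<And>i. i < d \<Longrightarrow> f i \<in> L2_space unit_measure"
    and coeff: "\<And>i k. i < d \<Longrightarrow> k \<le> L \<Longrightarrow>
      (\<Sum>e | e \<in> E \<and> lev e = k. (L2_inner unit_measure (f i) e)\<^sup>2) \<le> C / 2 ^ (k * r)"
    and resid: "\<And>i. i < d \<Longrightarrow> residual unit_measure (\<lambda>e. e) E (f i) \<le> C / 2 ^ (Suc L * r)"
    and S: "\<And>N. (\<Sum>m\<le>N. real (m + 1) ^ (d - 1) / 2 ^ m) \<le> S"
  shows "residual (cube_measure d) (tensor d) {\<eta> \<in> {..<d} \<rightarrow>\<^sub>E E. (\<Sum>i<d. lev (\<eta> i)) \<le> L} (tensor d f)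
    \<le> C ^ d * S * real (L + 1) ^ (d - 1) / 2 ^ (L * r)"
proof -
  have finE: "finite E" and EL: "\<And>e. e \<in> E \<Longrightarrow> e \<in> L2_space unit_measure"
    using E by (auto simp: orthonormal_def)
  define c where "c = (\<lambda>i k. if k \<le> L then \<Sum>e | e \<in> E \<and> lev e = k. (L2_inner unit_measure (f i) e)\<^sup>2
    else residual unit_measure (\<lambda>e. e) E (f i))"
  have c: "0 \<le> c i k" "k \<le> Suc L \<Longrightarrow> c i k \<le> C / 2 ^ (k * r)" if "i < d" for i k
    using that coeff[of i k] resid[of i] residual_nonneg[OF E f[OF that]]
    by (auto simp: c_def le_Suc_eq intro!: sum_nonneg)
  let ?all = "{..<d} \<rightarrow>\<^sub>E {..Suc L}"
  let ?J = "{\<eta> \<in> {..<d} \<rightarrow>\<^sub>E E. (\<Sum>i<d. lev (\<eta> i)) \<le> L}"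
  let ?pr = "\<lambda>\<kappa>. \<Prod>i<d. c i (\<kappa> i)"
  let ?in = "{\<kappa> \<in> ?all. (\<Sum>i<d. \<kappa> i) \<le> L}" and ?out = "{\<kappa> \<in> ?all. L < (\<Sum>i<d. \<kappa> i)}"
  have fin_all: "finite ?all" by (auto intro: finite_PiE)
  have fin_in: "finite ?in" and fin_out: "finite ?out"
    by (rule finite_subset[OF _ fin_all], blast)+
  have finJ: "finite ?J"
    by (rule finite_subset[of _ "{..<d} \<rightarrow>\<^sub>E E"]) (use finE in \<open>auto intro: finite_PiE\<close>)
  have norm_f: "L2_inner unit_measure (f i) (f i) = (\<Sum>k\<le>Suc L. c i k)" for i
  proof -
    have "(\<Sum>k\<le>L. \<Sum>e | e \<in> E \<and> lev e = k. (L2_inner unit_measure (f i) e)\<^sup>2)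
      = (\<Sum>e\<in>E. (L2_inner unit_measure (f i) e)\<^sup>2)"
      using finE lev by (intro sum.group) auto
    then show ?thesis by (simp add: c_def residual_def)
  qed
  have split: "sum p A = sum p {a \<in> A. h a \<le> L} + sum p {a \<in> A. L < h a}"
    if "finite A" for p :: "'x \<Rightarrow> real" and A h
  proof -
    have "sum p A = sum p ({a \<in> A. h a \<le> L} \<union> {a \<in> A. L < h a})" by (rule sum.cong) auto
    then show ?thesis using that by (subst (asm) sum.union_disjoint) auto
  qed
  have "L2_inner (cube_measure d) (tensor d f) (tensor d f) = (\<Prod>i<d. \<Sum>k\<le>Suc L. c i k)"
    using f by (simp only: L2_inner_tensor norm_f lessThan_iff cong: prod.cong)
  also have "\<dots> = sum ?pr ?all" by (rule prod_sum_PiE) auto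
  also have "\<dots> = sum ?pr ?in + sum ?pr ?out"
    by (rule split[OF fin_all])
  finally have norm: "L2_inner (cube_measure d) (tensor d f) (tensor d f) = sum ?pr ?in + sum ?pr ?out" .
  have "(\<Sum>\<eta>\<in>?J. (L2_inner (cube_measure d) (tensor d f) (tensor d \<eta>))\<^sup>2)
    = (\<Sum>\<eta>\<in>?J. \<Prod>i<d. (L2_inner unit_measure (f i) (\<eta> i))\<^sup>2)"
    using f EL by (intro sum.cong) (auto simp: PiE_iff L2_inner_tensor prod_power_distrib)
  also have "\<dots> = (\<Sum>l\<le>L. \<Sum>\<eta> | \<eta> \<in> ?J \<and> (\<Sum>i<d. lev (\<eta> i)) = l. \<Prod>i<d. (L2_inner unit_measure (f i) (\<eta> i))\<^sup>2)"
    using finJ by (intro sum.group[symmetric]) auto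
  also have "\<dots> = (\<Sum>l\<le>L. \<Sum>\<kappa> | \<kappa> \<in> ?in \<and> (\<Sum>i<d. \<kappa> i) = l. ?pr \<kappa>)"
  proof (rule sum.cong)
    fix l assume l: "l \<in> {..L}"
    have "{\<eta>. \<eta> \<in> ?J \<and> (\<Sum>i<d. lev (\<eta> i)) = l} = {\<eta>. \<eta> \<in> {..<d} \<rightarrow>\<^sub>E E \<and> (\<Sum>i<d. lev (\<eta> i)) = l}"
      using l by auto
    then have "(\<Sum>\<eta> | \<eta> \<in> ?J \<and> (\<Sum>i<d. lev (\<eta> i)) = l. \<Prod>i<d. (L2_inner unit_measure (f i) (\<eta> i))\<^sup>2)
      = (\<Sum>\<kappa>\<in>compositions d l. \<Prod>i<d. \<Sum>e | e \<in> E \<and> lev e = \<kappa> i. (L2_inner unit_measure (f i) e)\<^sup>2)"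
      using sum_prod_level[OF finE, where h = "\<lambda>i e. (L2_inner unit_measure (f i) e)\<^sup>2"] by simp
    also have "\<dots> = sum ?pr (compositions d l)"
      using l compositions_le[of _ d l] by (intro sum.cong prod.cong) (auto simp: c_def intro: order_trans)
    also have "compositions d l = {\<kappa>. \<kappa> \<in> ?in \<and> (\<Sum>i<d. \<kappa> i) = l}"
    proof (intro set_eqI iffI)
      fix \<kappa> assume \<kappa>: "\<kappa> \<in> compositions d l"
      have "\<kappa> i \<le> Suc L" if "i < d" for i using compositions_le[OF \<kappa> that] l by simp
      then have "\<kappa> \<in> ?all" using \<kappa> by (simp add: compositions_def PiE_iff)
      then show "\<kappa> \<in> {\<kappa>. \<kappa> \<in> ?in \<and> (\<Sum>i<d. \<kappa> i) = l}"
        using \<kappa> l by (simp add: compositions_def)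
    qed (simp add: compositions_def PiE_iff)
    finally show "(\<Sum>\<eta> | \<eta> \<in> ?J \<and> (\<Sum>i<d. lev (\<eta> i)) = l. \<Prod>i<d. (L2_inner unit_measure (f i) (\<eta> i))\<^sup>2)
      = (\<Sum>\<kappa> | \<kappa> \<in> ?in \<and> (\<Sum>i<d. \<kappa> i) = l. ?pr \<kappa>)" .
  qed simp
  also have "\<dots> = sum ?pr ?in"
    by (rule sum.group[OF fin_in]) auto
  finally have "residual (cube_measure d) (tensor d) ?J (tensor d f) = sum ?pr ?out"
    using norm by (simp add: residual_def)
  also have "\<dots> \<le> (\<Sum>\<kappa>\<in>?out. C ^ d / 2 ^ ((\<Sum>i<d. \<kappa> i) * r))"
  proof (rule sum_mono)
    fix \<kappa> assume \<kappa>: "\<kappa> \<in> ?out"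
    have "?pr \<kappa> \<le> (\<Prod>i<d. C / 2 ^ (\<kappa> i * r))"
      using \<kappa> c by (intro prod_mono conjI) (auto simp: PiE_iff)
    also have "\<dots> = C ^ d / 2 ^ ((\<Sum>i<d. \<kappa> i) * r)"
      by (simp add: prod_dividef power_sum[symmetric] sum_distrib_right[symmetric])
    finally show "?pr \<kappa> \<le> C ^ d / 2 ^ ((\<Sum>i<d. \<kappa> i) * r)" .
  qed
  also have "\<dots> = (\<Sum>l\<in>{Suc L..d * Suc L}. \<Sum>\<kappa> | \<kappa> \<in> ?out \<and> (\<Sum>i<d. \<kappa> i) = l. C ^ d / 2 ^ ((\<Sum>i<d. \<kappa> i) * r))"
  proof (rule sum.group[OF fin_out, symmetric])
    have "(\<Sum>i<d. \<kappa> i) \<le> d * Suc L" if "\<kappa> \<in> ?out" for \<kappa>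
      using that sum_bounded_above[of "{..<d}" \<kappa> "Suc L"] by (simp add: PiE_iff)
    then show "(\<lambda>\<kappa>. \<Sum>i<d. \<kappa> i) ` ?out \<subseteq> {Suc L..d * Suc L}"
      by (intro image_subsetI) (simp add: Suc_le_eq)
  qed simp
  also have "\<dots> \<le> (\<Sum>l\<in>{Suc L..d * Suc L}.
      C ^ d * real (L + 1) ^ (d - 1) / 2 ^ (L * r) * (real (l - L + 1) ^ (d - 1) / 2 ^ (l - L)))"
  proof (rule sum_mono)
    fix l assume l: "l \<in> {Suc L..d * Suc L}"
    \<comment> \<open>Factor out the value at level \<open>L\<close>, using \<open>l + 1 \<le> (L + 1) * (m + 1)\<close>.\<close>
    define m where "m = l - L"
    have lm: "l = L + m" using l by (simp add: m_def)
    let ?K = "{\<kappa>. \<kappa> \<in> ?out \<and> (\<Sum>i<d. \<kappa> i) = l}"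
    have "(\<Sum>\<kappa>\<in>?K. C ^ d / 2 ^ ((\<Sum>i<d. \<kappa> i) * r)) = real (card ?K) * (C ^ d / 2 ^ (l * r))" by simp
    also have "\<dots> \<le> (real (L + 1) ^ (d - 1) * real (m + 1) ^ (d - 1)) * (C ^ d / (2 ^ (L * r) * 2 ^ m))"
    proof (intro mult_mono divide_left_mono)
      have "?K \<subseteq> compositions d l" by (auto simp: compositions_def)
      then have "card ?K \<le> (l + 1) ^ (d - 1)"
        using card_compositions[OF d, of l] card_mono[OF finite_compositions] by (meson order_trans)
      also have "\<dots> \<le> ((L + 1) * (m + 1)) ^ (d - 1)"
        by (intro power_mono) (auto simp: lm algebra_simps)
      finally have "real (card ?K) \<le> real (((L + 1) * (m + 1)) ^ (d - 1))" by (simp only: of_nat_le_iff)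
      then show "real (card ?K) \<le> real (L + 1) ^ (d - 1) * real (m + 1) ^ (d - 1)"
        by (simp only: of_nat_power of_nat_mult power_mult_distrib)
      have "L * r + m \<le> l * r" using r by (simp add: lm algebra_simps)
      then show "2 ^ (L * r) * 2 ^ m \<le> (2 ^ (l * r) :: real)"
        by (simp add: power_add[symmetric] power_increasing)
    qed (use C in auto)
    also have "\<dots> = C ^ d * real (L + 1) ^ (d - 1) / 2 ^ (L * r) * (real (m + 1) ^ (d - 1) / 2 ^ m)"
      by simp
    finally show "(\<Sum>\<kappa>\<in>?K. C ^ d / 2 ^ ((\<Sum>i<d. \<kappa> i) * r))
      \<le> C ^ d * real (L + 1) ^ (d - 1) / 2 ^ (L * r) * (real (l - L + 1) ^ (d - 1) / 2 ^ (l - L))"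
      by (simp only: m_def)
  qed
  also have "\<dots> = C ^ d * real (L + 1) ^ (d - 1) / 2 ^ (L * r)
      * (\<Sum>l\<in>{Suc L..d * Suc L}. real (l - L + 1) ^ (d - 1) / 2 ^ (l - L))"
    by (rule sum_distrib_left[symmetric])
  also have "\<dots> \<le> C ^ d * real (L + 1) ^ (d - 1) / 2 ^ (L * r) * S"
  proof (rule mult_left_mono)
    have "(\<Sum>l\<in>{Suc L..d * Suc L}. real (l - L + 1) ^ (d - 1) / 2 ^ (l - L))
      = (\<Sum>m\<in>(\<lambda>l. l - L) ` {Suc L..d * Suc L}. real (m + 1) ^ (d - 1) / 2 ^ m)"
      by (subst sum.reindex) (auto intro!: inj_onI)
    also have "\<dots> \<le> (\<Sum>m\<le>d * Suc L. real (m + 1) ^ (d - 1) / 2 ^ m)"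
      by (intro sum_mono2) auto
    also have "\<dots> \<le> S" by (rule S)
    finally show "(\<Sum>l\<in>{Suc L..d * Suc L}. real (l - L + 1) ^ (d - 1) / 2 ^ (l - L)) \<le> S" .
  qed (use C in auto)
  finally show ?thesis by (simp add: mult_ac)
qed

section \<open>The entropy of the tensor class\<close>

lemma L2_cover_near:
  assumes T: "L2_cover M T \<epsilon> H" "T \<subseteq> L2_space M" and S: "S \<subseteq> L2_space M"
    and near: "\<And>f. f \<in> S \<Longrightarrow> \<exists>g\<in>T. L2_dist M f g \<le> \<delta>"
  shows "L2_cover M S (\<delta> + \<epsilon>) H"
proof -
  obtain C where C: "finite C" "C \<subseteq> L2_space M" "real (card C) \<le> exp H"
    "\<And>g. g \<in> T \<Longrightarrow> \<exists>c\<in>C. L2_dist M g c \<le> \<epsilon>"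
    using T(1) by (auto simp: L2_cover_def)
  have "\<exists>c\<in>C. L2_dist M f c \<le> \<delta> + \<epsilon>" if f: "f \<in> S" for f
  proof -
    obtain g where g: "g \<in> T" "L2_dist M f g \<le> \<delta>" using near[OF f] by auto
    obtain c where c: "c \<in> C" "L2_dist M g c \<le> \<epsilon>" using C(4)[OF g(1)] by auto
    have "L2_dist M f c \<le> L2_dist M f g + L2_dist M g c"
      using f g(1) c(1) S T(2) C(2) by (intro L2_dist_triangle) auto
    then show ?thesis using g(2) c by (intro bexI[of _ c]) auto
  qed
  then show ?thesis using C unfolding L2_cover_def by blast
qed

definition grid_tensor :: "nat \<Rightarrow> nat \<Rightarrow> nat \<Rightarrow> (nat \<Rightarrow> nat) \<Rightarrow> (nat \<Rightarrow> real) \<Rightarrow> real" where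
  "grid_tensor q d m \<iota> = tensor d (\<lambda>i. psi q (real (\<iota> i) / real m))"

text \<open>The grid is so fine that the rounding error \<open>1 / sqrt (4 ^ (q * L))\<close> is at most the intended accuracy.
  The logarithm of the number of atoms is still only of order \<open>L\<close>.\<close>

lemma grid_hull_cover:
  assumes q: "1 \<le> q" and d: "1 \<le> d"
  shows "\<exists>A\<ge>0. \<exists>K\<ge>0. \<forall>L\<ge>1.
    L2_cover (cube_measure d) (abs_hull (grid_tensor q d (4 ^ (q * L))) ({..<d} \<rightarrow>\<^sub>E {..4 ^ (q * L)}))
      (A * sqrt (real L) / 2 ^ (q * L)) (K * real (L + 1) ^ (d - 1) * 2 ^ L)"
proof -
  let ?r = "2 * q - 1"
  obtain S where S: "1 \<le> S" "\<And>N. (\<Sum>m\<le>N. real (m + 1) ^ (d - 1) / 2 ^ m) \<le> S"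
    using polynomial_geometric_sum_bounded[of "d - 1"] by auto
  define C :: real where "C = 2 ^ ?r"
  define B where "B = C ^ d * S"
  define a where "a = 1 + real d + 2 * real q * real d"
  define b where "b = (2 * real q) ^ d"
  have C: "0 \<le> C" by (simp add: C_def)
  have B: "0 \<le> B" using S(1) C by (simp add: B_def)
  have "L2_cover (cube_measure d) (abs_hull (grid_tensor q d (4 ^ (q * L))) ({..<d} \<rightarrow>\<^sub>E {..4 ^ (q * L)}))
      (6 * sqrt B * sqrt (real L) / 2 ^ (q * L)) ((7 * a + (10 + 4 * real q) * b) * real (L + 1) ^ (d - 1) * 2 ^ L)"
    if L: "1 \<le> L" for L
  proof -
    define m :: nat where "m = 4 ^ (q * L)"
    have m: "1 \<le> m" by (simp add: m_def)
    let ?I = "{..<d} \<rightarrow>\<^sub>E {..m}"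
    obtain E lev where E: "orthonormal unit_measure (\<lambda>e. e) E" "\<And>e. e \<in> E \<Longrightarrow> lev e \<le> L"
      "\<And>k. k \<le> L \<Longrightarrow> card {e \<in> E. lev e = k} \<le> 2 * q * 2 ^ k"
      "\<And>v k. v \<in> {0..1} \<Longrightarrow> k \<le> L \<Longrightarrow> (\<Sum>e | e \<in> E \<and> lev e = k. (L2_inner unit_measure (psi q v) e)\<^sup>2)
          \<le> C / 2 ^ (k * ?r)"
      "\<And>v. v \<in> {0..1} \<Longrightarrow> residual unit_measure (\<lambda>e. e) E (psi q v) \<le> 1 / 2 ^ (L * ?r)"
      using psi_multiresolution[OF q, of L] unfolding C_def by blast
    have finE: "finite E" using E(1) by (simp add: orthonormal_def)
    let ?lev = "\<lambda>\<eta>. \<Sum>i<d. lev (\<eta> i)"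
    let ?J = "{\<eta> \<in> {..<d} \<rightarrow>\<^sub>E E. ?lev \<eta> \<le> L}"
    have J_level: "{\<eta> \<in> ?J. ?lev \<eta> = l} = {\<eta>. \<eta> \<in> {..<d} \<rightarrow>\<^sub>E E \<and> ?lev \<eta> = l}" if "l \<le> L" for l
      using that by auto
    have v01: "real (\<iota> i) / real m \<in> {0..1}" if "\<iota> \<in> ?I" "i < d" for \<iota> i
      using that m by (auto simp: PiE_iff divide_le_eq)
    have psiL: "psi q (real (\<iota> i) / real m) \<in> L2_space unit_measure" if "\<iota> \<in> ?I" "i < d" for \<iota> i
      using v01[OF that] by (intro psi_L2) simp
    have resid: "residual unit_measure (\<lambda>e. e) E (psi q v) \<le> C / 2 ^ (Suc L * ?r)" if "v \<in> {0..1}" for v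
      using E(5)[OF that] by (simp add: C_def power_add)
    have "L2_cover (cube_measure d) (abs_hull (grid_tensor q d m) ?I)
      (6 * sqrt B * sqrt (real L) / 2 ^ (q * L)) ((7 * a + (10 + 4 * real q) * b) * real (L + 1) ^ (d - 1) * 2 ^ L)"
    proof (rule L2_cover_abs_hull_multilevel[where lev = ?lev and J = ?J and e = "tensor d"])
      show "finite ?I" by (intro finite_PiE) auto
      show "?I \<noteq> {}" by (simp add: PiE_eq_empty_iff)
      show "orthonormal (cube_measure d) (tensor d) ?J" using E(1) by (rule orthonormal_tensor) auto
      show "?lev \<eta> \<le> L" if "\<eta> \<in> ?J" for \<eta> using that by simp
      show "1 \<le> q" "1 \<le> L" "0 \<le> B" by fact+
      show "1 \<le> real (L + 1) ^ (d - 1)" by (intro one_le_power) simp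
      show "0 \<le> a" by (simp add: a_def)
      show "grid_tensor q d m \<iota> \<in> L2_space (cube_measure d)" if "\<iota> \<in> ?I" for \<iota>
        unfolding grid_tensor_def using psiL[OF that] by (rule tensor_L2)
      show "ln (2 * real (card ?I)) \<le> a * real L"
      proof -
        have "card ?I = (m + 1) ^ d" by (simp add: card_PiE)
        also have "\<dots> \<le> (2 * m) ^ d" using m by (intro power_mono) auto
        finally have "real (2 * card ?I) \<le> real (2 * (2 * m) ^ d)" by (simp only: of_nat_le_iff)
        also have "real (2 * (2 * m) ^ d) = 2 * (2 * (2 ^ 2) ^ (q * L)) ^ d" by (simp add: m_def)
        also have "\<dots> = 2 ^ (1 + (1 + 2 * (q * L)) * d)"
          by (simp only: power_add power_mult power_one_right)
        finally have le: "2 * real (card ?I) \<le> 2 ^ (1 + (1 + 2 * (q * L)) * d)" by simp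
        have "card ?I > 0" by (simp add: card_PiE)
        then have "ln (2 * real (card ?I)) \<le> ln (2 ^ (1 + (1 + 2 * (q * L)) * d))"
          using le by (subst ln_le_cancel_iff) auto
        also have "\<dots> = real (1 + (1 + 2 * (q * L)) * d) * ln 2" by (rule ln_realpow)
        also have "\<dots> \<le> real (1 + (1 + 2 * (q * L)) * d) * 1"
          using ln_2_less_1 by (intro mult_left_mono) auto
        also have "\<dots> = (1 + real d) * 1 + 2 * real q * real d * real L" by (simp add: algebra_simps)
        also have "\<dots> \<le> (1 + real d) * real L + 2 * real q * real d * real L"
          using L by (intro add_right_mono mult_left_mono) auto
        finally show ?thesis by (simp add: a_def algebra_simps)
      qed
      show "real (card {\<eta> \<in> ?J. ?lev \<eta> = l}) \<le> b * real (L + 1) ^ (d - 1) * 2 ^ l" if l: "l \<le> L" for l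
      proof -
        have "card {\<eta> \<in> ?J. ?lev \<eta> = l} = (\<Sum>\<eta> | \<eta> \<in> {..<d} \<rightarrow>\<^sub>E E \<and> ?lev \<eta> = l. \<Prod>i<d. 1 :: nat)"
          by (simp only: J_level[OF l]) simp
        also have "\<dots> = (\<Sum>\<kappa>\<in>compositions d l. \<Prod>i<d. \<Sum>e | e \<in> E \<and> lev e = \<kappa> i. 1)"
          by (rule sum_prod_level[OF finE])
        also have "\<dots> \<le> (\<Sum>\<kappa>\<in>compositions d l. (2 * q) ^ d * 2 ^ l)"
        proof (rule sum_mono)
          fix \<kappa> assume \<kappa>: "\<kappa> \<in> compositions d l"
          have "(\<Prod>i<d. \<Sum>e | e \<in> E \<and> lev e = \<kappa> i. 1) \<le> (\<Prod>i<d. 2 * q * 2 ^ \<kappa> i)"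
            using compositions_le[OF \<kappa>] l E(3) by (intro prod_mono) (auto intro: order_trans)
          also have "\<dots> = (2 * q) ^ d * 2 ^ l"
            using \<kappa> by (simp add: prod.distrib power_sum[symmetric] compositions_def power_mult_distrib)
          finally show "(\<Prod>i<d. \<Sum>e | e \<in> E \<and> lev e = \<kappa> i. 1) \<le> (2 * q) ^ d * 2 ^ l" .
        qed
        also have "\<dots> = card (compositions d l) * ((2 * q) ^ d * 2 ^ l)" by simp
        also have "\<dots> \<le> (L + 1) ^ (d - 1) * ((2 * q) ^ d * 2 ^ l)"
          using card_compositions[OF d, of l] power_mono[of "l + 1" "L + 1" "d - 1"] l
          by (intro mult_right_mono) auto
        finally have "real (card {\<eta> \<in> ?J. ?lev \<eta> = l}) \<le> real ((L + 1) ^ (d - 1) * ((2 * q) ^ d * 2 ^ l))"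
          by (simp only: of_nat_le_iff)
        also have "\<dots> = b * real (L + 1) ^ (d - 1) * 2 ^ l" by (simp add: b_def)
        finally show ?thesis .
      qed
      show "(\<Sum>\<eta> | \<eta> \<in> ?J \<and> ?lev \<eta> = l. (L2_inner (cube_measure d) (grid_tensor q d m \<iota>) (tensor d \<eta>))\<^sup>2)
        \<le> B * real (L + 1) ^ (d - 1) / 2 ^ (l * ?r)" if \<iota>: "\<iota> \<in> ?I" and l: "l \<le> L" for \<iota> l
      proof -
        have "(\<Sum>\<eta> | \<eta> \<in> ?J \<and> ?lev \<eta> = l. (L2_inner (cube_measure d) (grid_tensor q d m \<iota>) (tensor d \<eta>))\<^sup>2)
          \<le> C ^ d * real (L + 1) ^ (d - 1) / 2 ^ (l * ?r)"
          unfolding J_level[OF l] grid_tensor_def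
          using psiL[OF \<iota>] E(4) v01[OF \<iota>] by (intro tensor_coefficients[OF E(1) d l C]) auto
        also have "\<dots> \<le> B * real (L + 1) ^ (d - 1) / 2 ^ (l * ?r)"
          using S(1) C by (intro divide_right_mono mult_right_mono) (auto simp: B_def mult_le_cancel_left1)
        finally show ?thesis .
      qed
      show "residual (cube_measure d) (tensor d) ?J (grid_tensor q d m \<iota>)
        \<le> B * real (L + 1) ^ (d - 1) / 2 ^ (L * ?r)" if \<iota>: "\<iota> \<in> ?I" for \<iota>
        unfolding grid_tensor_def B_def
        using psiL[OF \<iota>] E(2,4) v01[OF \<iota>] resid S(2) q by (intro tensor_residual[OF E(1) d _ C]) auto
    qed
    then show ?thesis by (simp only: m_def)
  qed
  moreover have "0 \<le> 6 * sqrt B" "0 \<le> 7 * a + (10 + 4 * real q) * b"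
    using B by (auto simp: a_def b_def)
  ultimately show ?thesis by blast
qed

text \<open>Round the parameters down to multiples of \<open>1 / m\<close>. This moves every generator by at most
  \<open>d * q * sqrt (1 / m)\<close> and merges coefficients, so their absolute sum does not increase.\<close>

lemma tensor_combinations_near_grid:
  assumes q: "1 \<le> q" and m: "1 \<le> m" and f: "f \<in> tensor_combinations (psi q) d"
  shows "f \<in> L2_space (cube_measure d)"
    and "\<exists>g\<in>abs_hull (grid_tensor q d m) ({..<d} \<rightarrow>\<^sub>E {..m}).
      L2_dist (cube_measure d) f g \<le> real d * (real q * sqrt (1 / real m))"
proof -
  obtain V \<beta> where f_eq: "f = (\<lambda>u. \<Sum>v\<in>PiE {..<d} V. \<beta> v * tensor d (\<lambda>i. psi q (v i)) u)"
    and V: "\<And>i. i < d \<Longrightarrow> finite (V i)" "\<And>i. i < d \<Longrightarrow> V i \<subseteq> {0..1}"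
    and \<beta>: "(\<Sum>v \<in> PiE {..<d} V. \<bar>\<beta> v\<bar>) \<le> 1"
    using f unfolding tensor_combinations_def tensor_def by blast
  let ?V = "PiE {..<d} V"
  let ?M = "cube_measure d"
  let ?I = "{..<d} \<rightarrow>\<^sub>E {..m}"
  have finV: "finite ?V" using V(1) by (intro finite_PiE) auto
  have finI: "finite ?I" by (intro finite_PiE) auto
  have v01: "v i \<in> {0..1}" if "v \<in> ?V" "i < d" for v i using that V(2)[of i] by (auto simp: PiE_iff)
  have psiL: "psi q w \<in> L2_space unit_measure" if "w \<in> {0..1}" for w using that by (intro psi_L2) simp
  have psi1: "L2_norm unit_measure (psi q w) \<le> 1" if "w \<in> {0..1}" for w
    using that psi_le_1[of w] by (subst L2_norm_le_iff) (auto simp: abs_square_le_1 intro!: L2_inner_unit_le psiL)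
  have tL: "tensor d (\<lambda>i. psi q (v i)) \<in> L2_space ?M" if "v \<in> ?V" for v
    using psiL v01[OF that] by (intro tensor_L2) auto
  show fL: "f \<in> L2_space ?M" unfolding f_eq using tL by (rule L2_space_lincomb)
  define \<rho> where "\<rho> = (\<lambda>v :: nat \<Rightarrow> real. \<lambda>i\<in>{..<d}. nat \<lfloor>v i * real m\<rfloor>)"
  have \<rho>: "real (\<rho> v i) / real m \<in> {0..1}" "\<bar>v i - real (\<rho> v i) / real m\<bar> \<le> 1 / real m" "\<rho> v i \<le> m"
    if "v \<in> ?V" "i < d" for v i
  proof -
    have vm: "0 \<le> v i * real m" "v i * real m \<le> real m"
      using v01[OF that] m by (auto simp: mult_left_le_one_le)
    have "real (\<rho> v i) = of_int \<lfloor>v i * real m\<rfloor>" using that vm by (simp add: \<rho>_def)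
    then have bds: "real (\<rho> v i) \<le> v i * real m" "v i * real m \<le> real (\<rho> v i) + 1" by linarith+
    then show le: "\<rho> v i \<le> m" using vm by linarith
    show "real (\<rho> v i) / real m \<in> {0..1}" using le m by (simp add: divide_le_eq)
    have "v i - real (\<rho> v i) / real m = (v i * real m - real (\<rho> v i)) / real m"
      using m by (simp add: field_simps)
    moreover have "\<bar>v i * real m - real (\<rho> v i)\<bar> \<le> 1" using bds by linarith
    ultimately show "\<bar>v i - real (\<rho> v i) / real m\<bar> \<le> 1 / real m" by (simp add: divide_right_mono)
  qed
  have \<rho>I: "\<rho> v \<in> ?I" if "v \<in> ?V" for v using \<rho>(3)[OF that] by (auto simp: \<rho>_def)
  define g where "g = (\<lambda>u. \<Sum>v\<in>?V. \<beta> v * grid_tensor q d m (\<rho> v) u)"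
  have gL: "grid_tensor q d m (\<rho> v) \<in> L2_space ?M" if "v \<in> ?V" for v
    unfolding grid_tensor_def using psiL \<rho>(1)[OF that] by (intro tensor_L2) auto
  have "g \<in> abs_hull (grid_tensor q d m) ?I"
  proof -
    let ?\<gamma> = "\<lambda>\<iota>. \<Sum>v | v \<in> ?V \<and> \<rho> v = \<iota>. \<beta> v"
    have "g = (\<lambda>u. \<Sum>\<iota>\<in>?I. ?\<gamma> \<iota> * grid_tensor q d m \<iota> u)"
    proof
      fix u
      have "g u = (\<Sum>\<iota>\<in>?I. \<Sum>v | v \<in> ?V \<and> \<rho> v = \<iota>. \<beta> v * grid_tensor q d m (\<rho> v) u)"
        unfolding g_def using finV finI \<rho>I by (intro sum.group[symmetric]) blast+
      also have "\<dots> = (\<Sum>\<iota>\<in>?I. ?\<gamma> \<iota> * grid_tensor q d m \<iota> u)"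
        unfolding sum_distrib_right by (intro sum.cong) auto
      finally show "g u = (\<Sum>\<iota>\<in>?I. ?\<gamma> \<iota> * grid_tensor q d m \<iota> u)" .
    qed
    moreover have "(\<Sum>\<iota>\<in>?I. \<bar>?\<gamma> \<iota>\<bar>) \<le> (\<Sum>\<iota>\<in>?I. \<Sum>v | v \<in> ?V \<and> \<rho> v = \<iota>. \<bar>\<beta> v\<bar>)"
      by (intro sum_mono sum_abs)
    moreover have "\<dots> = (\<Sum>v\<in>?V. \<bar>\<beta> v\<bar>)"
      using finV finI \<rho>I by (intro sum.group) blast+
    ultimately show ?thesis using \<beta> unfolding abs_hull_def by (intro CollectI exI[of _ ?\<gamma>]) auto
  qed
  moreover have "L2_dist ?M f g \<le> real d * (real q * sqrt (1 / real m))"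
  proof -
    let ?h = "\<lambda>v u. tensor d (\<lambda>i. psi q (v i)) u - grid_tensor q d m (\<rho> v) u"
    have h: "L2_norm ?M (?h v) \<le> real d * (real q * sqrt (1 / real m))" if v: "v \<in> ?V" for v
    proof -
      have "L2_norm ?M (?h v) = L2_dist ?M (tensor d (\<lambda>i. psi q (v i)))
          (tensor d (\<lambda>i. psi q (real (\<rho> v i) / real m)))"
        by (simp add: L2_dist_norm grid_tensor_def)
      also have "\<dots> \<le> (\<Sum>i<d. L2_dist unit_measure (psi q (v i)) (psi q (real (\<rho> v i) / real m)))"
        using psiL psi1 v01[OF v] \<rho>(1)[OF v] by (intro L2_dist_tensor_le) auto
      also have "\<dots> \<le> (\<Sum>i<d. real q * sqrt (1 / real m))"
      proof (rule sum_mono)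
        fix i assume i: "i \<in> {..<d}"
        have "L2_dist unit_measure (psi q (v i)) (psi q (real (\<rho> v i) / real m))
          \<le> real q * sqrt \<bar>v i - real (\<rho> v i) / real m\<bar>"
          unfolding L2_dist_norm using q v01[OF v] \<rho>(1)[OF v] i by (intro psi_Hoelder_L2) auto
        also have "\<dots> \<le> real q * sqrt (1 / real m)"
          using \<rho>(2)[OF v] i by (intro mult_left_mono real_sqrt_le_mono) auto
        finally show "L2_dist unit_measure (psi q (v i)) (psi q (real (\<rho> v i) / real m))
          \<le> real q * sqrt (1 / real m)" .
      qed
      finally show ?thesis by simp
    qed
    have "L2_dist ?M f g = L2_norm ?M (\<lambda>u. \<Sum>v\<in>?V. \<beta> v * ?h v u)"
      by (simp add: L2_dist_norm f_eq g_def sum_subtractf[symmetric] right_diff_distrib)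
    also have "\<dots> \<le> (\<Sum>v\<in>?V. \<bar>\<beta> v\<bar> * L2_norm ?M (?h v))"
      using tL gL by (intro L2_norm_lincomb L2_space_diff)
    also have "\<dots> \<le> (\<Sum>v\<in>?V. \<bar>\<beta> v\<bar> * (real d * (real q * sqrt (1 / real m))))"
      by (intro sum_mono mult_left_mono h) auto
    also have "\<dots> = (\<Sum>v\<in>?V. \<bar>\<beta> v\<bar>) * (real d * (real q * sqrt (1 / real m)))"
      by (rule sum_distrib_right[symmetric])
    also have "\<dots> \<le> 1 * (real d * (real q * sqrt (1 / real m)))"
      using \<beta> by (intro mult_right_mono) auto
    finally show ?thesis by simp
  qed
  ultimately show "\<exists>g\<in>abs_hull (grid_tensor q d m) ?I.
      L2_dist ?M f g \<le> real d * (real q * sqrt (1 / real m))" by blast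
qed

lemma absconv_tensor_cover:
  assumes q: "1 \<le> q" and d: "1 \<le> d"
  shows "\<exists>A>0. \<exists>K\<ge>0. \<forall>L\<ge>1. L2_cover (cube_measure d) (absconv_tensor (psi q) d)
      (A * sqrt (real L) / 2 ^ (q * L)) (K * real (L + 1) ^ (d - 1) * 2 ^ L)"
proof -
  obtain A K where A: "0 \<le> A" and K: "0 \<le> K"
    and cov: "\<And>L. 1 \<le> L \<Longrightarrow>
      L2_cover (cube_measure d) (abs_hull (grid_tensor q d (4 ^ (q * L))) ({..<d} \<rightarrow>\<^sub>E {..4 ^ (q * L)}))
        (A * sqrt (real L) / 2 ^ (q * L)) (K * real (L + 1) ^ (d - 1) * 2 ^ L)"
    using grid_hull_cover[OF q d] by blast
  let ?M = "cube_measure d"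
  have "L2_cover ?M (absconv_tensor (psi q) d)
      ((1 + real d * real q + A) * sqrt (real L) / 2 ^ (q * L)) (K * real (L + 1) ^ (d - 1) * 2 ^ L)"
    if L: "1 \<le> L" for L
  proof -
    define m :: nat where "m = 4 ^ (q * L)"
    have m: "1 \<le> m" by (simp add: m_def)
    have "real m = (2 ^ (q * L))\<^sup>2" by (simp add: m_def power2_eq_square power_mult_distrib[symmetric])
    then have sqrt_m: "sqrt (1 / real m) = 1 / 2 ^ (q * L)" by (simp add: real_sqrt_divide)
    let ?G = "abs_hull (grid_tensor q d m) ({..<d} \<rightarrow>\<^sub>E {..m})"
    have GL: "?G \<subseteq> L2_space ?M"
    proof
      fix g assume "g \<in> ?G"
      then obtain \<beta> where g: "g = (\<lambda>x. \<Sum>\<iota>\<in>{..<d} \<rightarrow>\<^sub>E {..m}. \<beta> \<iota> * grid_tensor q d m \<iota> x)"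
        by (auto simp: abs_hull_def)
      show "g \<in> L2_space ?M"
        unfolding g grid_tensor_def by (intro L2_space_lincomb tensor_L2 psi_L2) auto
    qed
    have T: "L2_cover ?M (tensor_combinations (psi q) d)
      (real d * (real q * sqrt (1 / real m)) + A * sqrt (real L) / 2 ^ (q * L)) (K * real (L + 1) ^ (d - 1) * 2 ^ L)"
      using tensor_combinations_near_grid[OF q m]
      by (intro L2_cover_near[OF cov[OF L, folded m_def] GL]) auto
    \<comment> \<open>Passing to the closure costs an arbitrarily small increase of the radius.\<close>
    have "L2_cover ?M (absconv_tensor (psi q) d)
      (1 / 2 ^ (q * L) + (real d * (real q * sqrt (1 / real m)) + A * sqrt (real L) / 2 ^ (q * L)))
      (K * real (L + 1) ^ (d - 1) * 2 ^ L)"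
    proof (rule L2_cover_near[OF T])
      show "tensor_combinations (psi q) d \<subseteq> L2_space ?M" using tensor_combinations_near_grid(1)[OF q m] by blast
      show "absconv_tensor (psi q) d \<subseteq> L2_space ?M" by (auto simp: absconv_tensor_def L2_closure_def)
      fix f assume "f \<in> absconv_tensor (psi q) d"
      moreover have "(0 :: real) < 1 / 2 ^ (q * L)" by simp
      ultimately show "\<exists>g\<in>tensor_combinations (psi q) d. L2_dist ?M f g \<le> 1 / 2 ^ (q * L)"
        unfolding absconv_tensor_def L2_closure_def by (blast intro: less_imp_le)
    qed
    then show ?thesis
    proof (rule L2_cover_mono)
      have "(1 + real d * real q) * 1 \<le> (1 + real d * real q) * sqrt (real L)"
        using L by (intro mult_left_mono) auto
      then have "((1 + real d * real q) * 1 + A * sqrt (real L)) / 2 ^ (q * L)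
        \<le> ((1 + real d * real q) * sqrt (real L) + A * sqrt (real L)) / 2 ^ (q * L)"
        by (intro divide_right_mono) auto
      then show "1 / 2 ^ (q * L) + (real d * (real q * sqrt (1 / real m)) + A * sqrt (real L) / 2 ^ (q * L))
        \<le> (1 + real d * real q + A) * sqrt (real L) / 2 ^ (q * L)"
        unfolding sqrt_m by (simp add: add_divide_distrib distrib_right)
    qed simp
  qed
  moreover have "0 < 1 + real d * real q + A" using A by (intro add_pos_nonneg) auto
  ultimately show ?thesis using K by blast
qed

section \<open>Asymptotics\<close>

lemma lesssimI:
  assumes "eventually (\<lambda>\<epsilon>. h \<epsilon> \<le> ereal (K * g \<epsilon>)) (at_right 0)"
    and "eventually (\<lambda>\<epsilon>. 0 < g \<epsilon>) (at_right 0)"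
  shows "lesssim h g"
proof -
  have "eventually (\<lambda>\<epsilon>. h \<epsilon> / ereal (g \<epsilon>) \<le> ereal K) (at_right 0)"
    using assms
  proof eventually_elim
    case (elim \<epsilon>)
    have "h \<epsilon> / ereal (g \<epsilon>) \<le> ereal (K * g \<epsilon>) / ereal (g \<epsilon>)"
      using elim by (intro ereal_divide_right_mono) auto
    also have "\<dots> = ereal K" using elim by simp
    finally show ?case .
  qed
  then have "Limsup (at_right 0) (\<lambda>\<epsilon>. h \<epsilon> / ereal (g \<epsilon>)) \<le> ereal K" by (rule Limsup_bounded)
  then show ?thesis unfolding lesssim_def by (rule order_le_less_trans) simp
qed

lemma covering_number_le:
  assumes "finite C" "C \<subseteq> X" "T \<subseteq> X" "\<And>t. t \<in> T \<Longrightarrow> \<exists>c\<in>C. \<rho> c t < \<epsilon>"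
  shows "covering_number X \<rho> \<epsilon> T \<le> enat (card C)"
  unfolding covering_number_def using assms by (intro INF_lower) fastforce

text \<open>The slack between \<open>\<delta>\<close> and \<open>\<epsilon>\<close> turns closed balls into open ones. The hypothesis \<open>0 \<le> H\<close> covers
  the case of the covering number \<open>0\<close>, as \<open>ln 0 = 0\<close>.\<close>

lemma metric_entropy_le:
  assumes cov: "L2_cover M T \<delta> H" and \<delta>: "\<delta> < \<epsilon>" and T: "T \<subseteq> L2_space M" and H: "0 \<le> H"
  shows "metric_entropy (L2_space M) (L2_dist M) \<epsilon> T \<le> ereal H"
proof -
  obtain C where C: "finite C" "C \<subseteq> L2_space M" "real (card C) \<le> exp H"
    "\<And>f. f \<in> T \<Longrightarrow> \<exists>c\<in>C. L2_dist M f c \<le> \<delta>"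
    using cov by (auto simp: L2_cover_def)
  have "covering_number (L2_space M) (L2_dist M) \<epsilon> T \<le> enat (card C)"
    using C T \<delta> by (intro covering_number_le) (metis L2_dist_commute order_le_less_trans)+
  then obtain n where n: "covering_number (L2_space M) (L2_dist M) \<epsilon> T = enat n" "n \<le> card C"
    by (cases "covering_number (L2_space M) (L2_dist M) \<epsilon> T") auto
  have "ln (real n) \<le> H"
  proof (cases "n = 0")
    case False
    then have "ln (real n) \<le> ln (exp H)" using n(2) C(3) by (subst ln_le_cancel_iff) auto
    then show ?thesis by simp
  qed (use H in simp)
  then show ?thesis by (simp add: metric_entropy_def n(1))
qed

text \<open>For \<open>q \<ge> 2\<close>, an equidistant grid of parameters gives the centres, by Lipschitz continuity.\<close>

lemma covering_number_Psi_lesssim: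
  assumes q: "2 \<le> q"
  shows "lesssim (\<lambda>\<epsilon>. ereal_of_enat (covering_number (L2_space unit_measure) (L2_dist unit_measure) \<epsilon> (Psi q)))
    (\<lambda>\<epsilon>. 1 / \<epsilon>)"
proof (rule lesssimI)
  show "eventually (\<lambda>\<epsilon> :: real. 0 < 1 / \<epsilon>) (at_right 0)"
    by (auto simp: eventually_at_right_field intro: exI[of _ 1])
  have "ereal_of_enat (covering_number (L2_space unit_measure) (L2_dist unit_measure) \<epsilon> (Psi q))
      \<le> ereal ((real q + 2) * (1 / \<epsilon>))" if \<epsilon>: "0 < \<epsilon>" "\<epsilon> < 1" for \<epsilon>
  proof -
    define m where "m = nat \<lceil>real q / \<epsilon>\<rceil>"
    have x0: "0 < real q / \<epsilon>" using \<epsilon> q by simp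
    have m: "real q / \<epsilon> \<le> real m" "real m \<le> real q / \<epsilon> + 1"
      using x0 of_int_ceiling_le_add_one[of "real q / \<epsilon>"] by (auto simp: m_def)
    then have m0: "0 < real m" using x0 by linarith
    let ?C = "(\<lambda>j. psi q (real j / real m)) ` {..m}"
    have "covering_number (L2_space unit_measure) (L2_dist unit_measure) \<epsilon> (Psi q) \<le> enat (card ?C)"
    proof (rule covering_number_le)
      show "?C \<subseteq> L2_space unit_measure" "Psi q \<subseteq> L2_space unit_measure"
        by (auto simp: Psi_def intro!: psi_L2)
      fix t assume "t \<in> Psi q"
      then obtain v where v: "t = psi q v" "v \<in> {0..1}" by (auto simp: Psi_def)
      define j where "j = nat \<lfloor>v * real m\<rfloor>"
      have vm: "0 \<le> v * real m" "v * real m \<le> real m" using v m0 by (auto simp: mult_left_le_one_le)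
      have "real j = of_int \<lfloor>v * real m\<rfloor>" using vm by (simp add: j_def)
      then have j: "real j \<le> v * real m" "v * real m \<le> real j + 1" by linarith+
      then have jm: "j \<le> m" using vm by linarith
      have w: "real j / real m \<in> {0..1}" using jm m0 by (simp add: divide_le_eq)
      have "real j / real m - v = (real j - v * real m) / real m" using m0 by (simp add: field_simps)
      moreover have "\<bar>real j - v * real m\<bar> \<le> 1" using j by linarith
      ultimately have d: "\<bar>real j / real m - v\<bar> \<le> 1 / real m" by (simp add: divide_right_mono)
      have "L2_norm unit_measure (\<lambda>u. psi q (real j / real m) u - psi q v u) \<le> real (q - 1) * (1 / real m)"
      proof (subst L2_norm_le_iff)
        show "L2_inner unit_measure (\<lambda>u. psi q (real j / real m) u - psi q v u)
          (\<lambda>u. psi q (real j / real m) u - psi q v u) \<le> (real (q - 1) * (1 / real m))\<^sup>2"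
        proof (rule L2_inner_unit_le)
          show "(\<lambda>u. psi q (real j / real m) u - psi q v u) \<in> L2_space unit_measure"
            using w v by (intro L2_space_diff psi_L2) auto
          fix u :: real assume u: "u \<in> {0..1}"
          have "\<bar>psi q (real j / real m) u - psi q v u\<bar> \<le> real (q - 1) * \<bar>real j / real m - v\<bar>"
            using psi_Lipschitz[OF q w v(2) u] .
          also have "\<dots> \<le> real (q - 1) * (1 / real m)" using d by (intro mult_left_mono) auto
          finally show "(psi q (real j / real m) u - psi q v u)\<^sup>2 \<le> (real (q - 1) * (1 / real m))\<^sup>2"
            using abs_le_square_iff[of "psi q (real j / real m) u - psi q v u" "real (q - 1) * (1 / real m)"]
            by simp
        qed
      qed simp
      also have "\<dots> < real q * (1 / real m)" using q m0 by (intro mult_strict_right_mono) auto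
      also have "\<dots> \<le> \<epsilon>" using m(1) \<epsilon> m0 by (simp add: field_simps)
      finally have "L2_dist unit_measure (psi q (real j / real m)) t < \<epsilon>" by (simp add: L2_dist_norm v(1))
      then show "\<exists>c\<in>?C. L2_dist unit_measure c t < \<epsilon>" using jm by blast
    qed simp
    also have "enat (card ?C) \<le> enat (m + 1)"
      using card_image_le[of "{..m}" "\<lambda>j. psi q (real j / real m)"] by simp
    finally have "ereal_of_enat (covering_number (L2_space unit_measure) (L2_dist unit_measure) \<epsilon> (Psi q))
      \<le> ereal_of_enat (enat (m + 1))" by (simp only: ereal_of_enat_le_iff)
    also have "\<dots> = ereal (real (m + 1))" by simp
    also have "\<dots> \<le> ereal ((real q + 2) * (1 / \<epsilon>))"
    proof -
      have "1 \<le> 1 / \<epsilon>" using \<epsilon> by simp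
      then have "real (m + 1) \<le> real q / \<epsilon> + 2 * (1 / \<epsilon>)" using m(2) by simp
      also have "\<dots> = (real q + 2) * (1 / \<epsilon>)" by (simp add: add_divide_distrib)
      finally show ?thesis by simp
    qed
    finally show ?thesis .
  qed
  then show "eventually (\<lambda>\<epsilon>. ereal_of_enat (covering_number (L2_space unit_measure) (L2_dist unit_measure) \<epsilon> (Psi q))
      \<le> ereal ((real q + 2) * (1 / \<epsilon>))) (at_right 0)"
    unfolding eventually_at_right_field by (intro exI[of _ 1]) auto
qed

text \<open>With \<open>x = ln (1 / \<epsilon>)\<close>, the level must satisfy \<open>2 ^ (q * L) > A * sqrt L / \<epsilon>\<close>, where
  \<open>L\<close> is of order \<open>x\<close>; so \<open>2 ^ L\<close> can be taken of order \<open>(sqrt x / \<epsilon>) powr (1 / q)\<close>.\<close>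

lemma choose_level:
  fixes A \<epsilon> :: real
  assumes q: "1 \<le> q" and A: "0 < A" and \<epsilon>: "0 < \<epsilon>"
    and x: "1 + \<bar>ln (3 * A)\<bar> \<le> ln (1 / \<epsilon>)"
  shows "\<exists>L\<ge>1. A * sqrt (real L) / 2 ^ (q * L) < \<epsilon> \<and> real (L + 1) \<le> 5 * ln (1 / \<epsilon>) \<and>
    2 ^ L \<le> 2 * (3 * A) powr (1 / real q) * (\<epsilon> powr (- (1 / real q)) * ln (1 / \<epsilon>) powr (1 / (2 * real q)))"
proof -
  define x where "x = ln (1 / \<epsilon>)"
  have x1: "1 \<le> x" using assms(4) by (simp add: x_def)
  have \<epsilon>x: "1 / \<epsilon> = exp x" using \<epsilon> by (simp add: x_def)
  \<comment> \<open>The factor \<open>3\<close> suffices because \<open>L < 9 * x\<close>.\<close>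
  define z where "z = 3 * A * sqrt x / \<epsilon>"
  define y where "y = z powr (1 / real q)"
  have z0: "0 < z" using A x1 \<epsilon> by (simp add: z_def)
  have y0: "0 < y" using z0 by (simp add: y_def)
  have yq: "y ^ q = z"
    using z0 q by (simp add: y_def powr_realpow[symmetric] powr_powr)
  have lnz: "ln z = ln (3 * A) + ln x / 2 + x"
  proof -
    have "ln z = ln (3 * A * sqrt x * exp x)" unfolding z_def \<epsilon>x[symmetric] by simp
    also have "\<dots> = ln (3 * A) + ln (sqrt x) + x" using A x1 by (simp add: ln_mult_pos)
    finally show ?thesis using x1 by (simp add: ln_sqrt)
  qed
  have lnz0: "0 < ln z"
    using assms(4) ln_ge_zero[OF x1] unfolding lnz x_def[symmetric] by linarith
  have lny: "ln y = ln z / real q" using z0 by (simp add: y_def ln_powr)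
  have lny0: "0 < ln y" using lnz0 q by (simp add: lny)
  define L where "L = nat \<lceil>ln y / ln 2\<rceil>"
  have t0: "0 < ln y / ln 2" using lny0 by simp
  have L: "1 \<le> L" "ln y / ln 2 \<le> real L" "real L \<le> ln y / ln 2 + 1"
    using t0 of_int_ceiling_le_add_one[of "ln y / ln 2"] by (auto simp: L_def Suc_le_eq)
  have "exp (real L * ln 2) = 2 ^ L" by (simp add: exp_of_nat_mult)
  moreover have "ln y \<le> real L * ln 2" using L(2) by (simp add: pos_divide_le_eq)
  moreover have "real L * ln 2 \<le> ln y + ln 2" using L(3) by (simp add: field_simps)
  ultimately have yL: "y \<le> 2 ^ L" and Ly: "2 ^ L \<le> 2 * y"
    using y0 exp_le_cancel_iff[of "ln y" "real L * ln 2"] exp_le_cancel_iff[of "real L * ln 2" "ln y + ln 2"]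
    by (auto simp: exp_add mult.commute)
  have "(1 / 2 :: real) \<le> ln 2"
    using ln_le_minus_one[of "1 / 2"] by (simp add: ln_div)
  then have "ln y / ln 2 \<le> ln y / (1 / 2)" using lny0 by (intro divide_left_mono) auto
  also have "\<dots> \<le> 2 * ln z" using lnz0 q by (simp add: lny divide_le_eq)
  also have "\<dots> \<le> 2 * ((x - 1) + x / 2 + x)"
  proof -
    have "2 * (a + b / 2 + x) \<le> 2 * ((x - 1) + x / 2 + x)" if "a \<le> x - 1" "b \<le> x" for a b
      using that by simp
    moreover have "ln (3 * A) \<le> x - 1" using assms(4) unfolding x_def[symmetric] by linarith
    moreover have "ln x \<le> x" using ln_le_minus_one[of x] x1 by linarith
    ultimately show ?thesis unfolding lnz by blast
  qed
  finally have Lx: "real (L + 1) \<le> 5 * x" using L(3) by simp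
  have "z \<le> 2 ^ (q * L)"
  proof -
    have "z \<le> (2 ^ L) ^ q" unfolding yq[symmetric] using yL y0 by (intro power_mono) auto
    then show ?thesis by (simp add: power_mult[symmetric] mult.commute)
  qed
  then have "A * sqrt (real L) / 2 ^ (q * L) \<le> A * sqrt (real L) / z"
    using A z0 by (intro divide_left_mono) auto
  also have "\<dots> = \<epsilon> * (sqrt (real L) / (3 * sqrt x))" using A \<epsilon> by (simp add: z_def)
  also have "\<dots> < \<epsilon> * 1"
  proof (rule mult_strict_left_mono)
    have "real L < 9 * x" using Lx x1 by simp
    then have "sqrt (real L) < sqrt (9 * x)" by (rule real_sqrt_less_mono)
    then show "sqrt (real L) / (3 * sqrt x) < 1" using x1 by (simp add: real_sqrt_mult)
  qed (rule \<epsilon>)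
  finally have 1: "A * sqrt (real L) / 2 ^ (q * L) < \<epsilon>" by simp
  have "y = (3 * A) powr (1 / real q) * (\<epsilon> powr (- (1 / real q)) * x powr (1 / (2 * real q)))"
  proof -
    have "z = (3 * A) * (\<epsilon> powr (-1) * x powr (1 / 2))"
    proof -
      have "\<epsilon> powr (-1) = 1 / \<epsilon>" using \<epsilon> by (simp only: powr_minus_divide powr_one)
      moreover have "x powr (1 / 2) = sqrt x" using x1 by (intro powr_half_sqrt) simp
      ultimately show ?thesis by (simp only: z_def) simp
    qed
    then have "y = ((3 * A) * (\<epsilon> powr (-1) * x powr (1 / 2))) powr (1 / real q)"
      by (simp only: y_def)
    also have "\<dots> = (3 * A) powr (1 / real q) * ((\<epsilon> powr (-1)) powr (1 / real q) * (x powr (1 / 2)) powr (1 / real q))"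
      by (simp only: powr_mult)
    also have "(\<epsilon> powr (-1)) powr (1 / real q) = \<epsilon> powr (- (1 / real q))"
      by (subst powr_powr) simp
    also have "(x powr (1 / 2)) powr (1 / real q) = x powr (1 / (2 * real q))"
      by (subst powr_powr) simp
    finally show ?thesis .
  qed
  then have "2 ^ L \<le> 2 * (3 * A) powr (1 / real q) * (\<epsilon> powr (- (1 / real q)) * x powr (1 / (2 * real q)))"
    using Ly by (simp only: mult.assoc)
  then show ?thesis using L(1) 1 Lx unfolding x_def[symmetric] by blast
qed

theorem corollary6p1:
  fixes q d :: nat
  assumes "1 \<le> q" and "1 \<le> d"
  shows "(2 \<le> q \<longrightarrow>
            (\<lambda>\<epsilon>. ereal_of_enat (covering_number (L2_space unit_measure) (L2_dist unit_measure)
                    \<epsilon> (Psi q)))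
              \<lesssim> (\<lambda>\<epsilon>. 1 / \<epsilon>))
       \<and> (\<lambda>\<epsilon>. metric_entropy (L2_space (cube_measure d)) (L2_dist (cube_measure d))
                  \<epsilon> (absconv_tensor (psi q) d))
            \<lesssim> (\<lambda>\<epsilon>. \<epsilon> powr (- (1 / real q)) * ln (1 / \<epsilon>) ^ (d - 1)
                        * ln (1 / \<epsilon>) powr (1 / (2 * real q)))"
proof (intro conjI impI)
  let ?g = "\<lambda>\<epsilon>. \<epsilon> powr (- (1 / real q)) * ln (1 / \<epsilon>) ^ (d - 1) * ln (1 / \<epsilon>) powr (1 / (2 * real q))"
  obtain A K where A: "0 < A" and K: "0 \<le> K"
    and cov: "\<And>L. 1 \<le> L \<Longrightarrow> L2_cover (cube_measure d) (absconv_tensor (psi q) d)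
      (A * sqrt (real L) / 2 ^ (q * L)) (K * real (L + 1) ^ (d - 1) * 2 ^ L)"
    using absconv_tensor_cover[OF assms] by blast
  let ?K = "K * 5 ^ (d - 1) * (2 * (3 * A) powr (1 / real q))"
  have bound: "metric_entropy (L2_space (cube_measure d)) (L2_dist (cube_measure d)) \<epsilon> (absconv_tensor (psi q) d)
      \<le> ereal (?K * ?g \<epsilon>)"
    if \<epsilon>: "0 < \<epsilon>" "1 + \<bar>ln (3 * A)\<bar> \<le> ln (1 / \<epsilon>)" for \<epsilon>
  proof -
    obtain L where L: "1 \<le> L" "A * sqrt (real L) / 2 ^ (q * L) < \<epsilon>" "real (L + 1) \<le> 5 * ln (1 / \<epsilon>)"
      "2 ^ L \<le> 2 * (3 * A) powr (1 / real q) * (\<epsilon> powr (- (1 / real q)) * ln (1 / \<epsilon>) powr (1 / (2 * real q)))"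
      using choose_level[OF assms(1) A \<epsilon>] by blast
    have entropy: "metric_entropy (L2_space (cube_measure d)) (L2_dist (cube_measure d)) \<epsilon>
        (absconv_tensor (psi q) d) \<le> ereal (K * real (L + 1) ^ (d - 1) * 2 ^ L)"
      using K by (intro metric_entropy_le[OF cov[OF L(1)] L(2)])
        (auto simp: absconv_tensor_def L2_closure_def)
    have x0: "0 \<le> ln (1 / \<epsilon>)" using \<epsilon>(2) by linarith
    then have "\<epsilon> \<le> 1" using \<epsilon>(1) by simp
    have "K * real (L + 1) ^ (d - 1) * 2 ^ L \<le> K * (5 * ln (1 / \<epsilon>)) ^ (d - 1)
      * (2 * (3 * A) powr (1 / real q) * (\<epsilon> powr (- (1 / real q)) * ln (1 / \<epsilon>) powr (1 / (2 * real q))))"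
      using K L(3,4) \<open>\<epsilon> \<le> 1\<close> \<epsilon>(1) by (intro mult_mono mult_left_mono power_mono mult_nonneg_nonneg zero_le_power) auto
    also have "\<dots> = ?K * ?g \<epsilon>" by (simp add: power_mult_distrib mult_ac)
    finally have "ereal (K * real (L + 1) ^ (d - 1) * 2 ^ L) \<le> ereal (?K * ?g \<epsilon>)"
      by (simp only: ereal_less_eq)
    with entropy show ?thesis by (rule order_trans)
  qed
  have small: "eventually (\<lambda>\<epsilon>. 1 + \<bar>ln (3 * A)\<bar> \<le> ln (1 / \<epsilon>)) (at_right (0 :: real))"
    unfolding eventually_at_right_field
  proof (intro exI[of _ "exp (- (1 + \<bar>ln (3 * A)\<bar>))"] conjI allI impI)
    fix \<epsilon> :: real assume \<epsilon>: "0 < \<epsilon>" "\<epsilon> < exp (- (1 + \<bar>ln (3 * A)\<bar>))"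
    then have "ln \<epsilon> < ln (exp (- (1 + \<bar>ln (3 * A)\<bar>)))" by (subst ln_less_cancel_iff) auto
    then show "1 + \<bar>ln (3 * A)\<bar> \<le> ln (1 / \<epsilon>)" using \<epsilon> by (simp add: ln_div)
  qed simp
  have pos: "eventually (\<lambda>\<epsilon> :: real. 0 < \<epsilon>) (at_right 0)" by (rule eventually_at_right_less)
  show "lesssim (\<lambda>\<epsilon>. metric_entropy (L2_space (cube_measure d)) (L2_dist (cube_measure d)) \<epsilon>
      (absconv_tensor (psi q) d)) ?g"
  proof (rule lesssimI)
    show "eventually (\<lambda>\<epsilon>. metric_entropy (L2_space (cube_measure d)) (L2_dist (cube_measure d)) \<epsilon>
      (absconv_tensor (psi q) d) \<le> ereal (?K * ?g \<epsilon>)) (at_right 0)"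
      using small pos by eventually_elim (rule bound)
    show "eventually (\<lambda>\<epsilon>. 0 < ?g \<epsilon>) (at_right 0)"
      using small pos
    proof eventually_elim
      case (elim \<epsilon>)
      then have "0 < ln (1 / \<epsilon>)" by linarith
      moreover have "0 < \<epsilon> powr (- (1 / real q))" using elim(2) by simp
      moreover have "0 < ln (1 / \<epsilon>) powr (1 / (2 * real q))"
        using \<open>0 < ln (1 / \<epsilon>)\<close> by (simp only: powr_gt_zero)
      ultimately show ?case by (intro mult_pos_pos zero_less_power)
    qed
  qed
qed (rule covering_number_Psi_lesssim)

end
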